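(* Let $S$ be a finite or infinite set of unimodular substitutions over a finite alphabet $\mathcal{A}=\{1,\ldots,d\}$ and let $\boldsymbol{\sigma}\in S^{\mathbb{N}}$ be a directive sequence with Property PRICE. Then $\lambda_{\mathbf{1}}(\partial\mathcal{R}(i))=0$ for each $i\in\mathcal{A}$.
   Context: A substitution $\sigma$ over $\mathcal{A}$ is a non-erasing endomorphism of the free monoid $\mathcal{A}^*$, with incidence matrix $M_\sigma=(|\sigma(j)|_i)_{i,j\in\mathcal{A}}$; it is unimodular if $|\det M_\sigma|=1$. $\mathbf{l}(w)={}^t(|w|_1,\ldots,|w|_d)$. For $\boldsymbol{\sigma}=(\sigma_n)_{n\in\mathbb{N}}$: $M_n=M_{\sigma_n}$, $\sigma_{[k,\ell)}=\sigma_k\cdots\sigma_{\ell-1}$, $M_{[k,\ell)}=M_k\cdots M_{\ell-1}$. $\mathcal{L}_{\boldsymbol{\sigma}}^{(m)}$ is the set of factors of the words $\sigma_{[m,n)}(i)$, $i\in\mathcal{A}$, $n\in\mathbb{N}$. A language is $C$-balanced if $\big||u|_j-|v|_j\big|\le C$ for all $j\in\mathcal{A}$ and all $u,v$ in it with $|u|=|v|$. Property PRICE: there are strictly increasing sequences $(n_k)_{k\in\mathbb{N}}$, $(\ell_k)_{k\in\mathbb{N}}$ and a vector $\mathbf{v}\in\mathbb{R}^d_{\ge0}\setminus\{\mathbf{0}\}$ such that: (P) there are $h\in\mathbb{N}$ and a positive matrix $B$ with $M_{[\ell_k-h,\ell_k)}=B$ for all $k$; (R) $(\sigma_{n_k},\ldots,\sigma_{n_k+\ell_k-1})=(\sigma_0,\ldots,\sigma_{\ell_k-1})$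 for all $k$; (I) for each $k$ the characteristic polynomial of $M_{[k,\ell)}$ is irreducible for all sufficiently large $\ell$; (C) there is $C>0$ such that $\mathcal{L}_{\boldsymbol{\sigma}}^{(n_k+\ell_k)}$ is $C$-balanced for all $k$; (E) $\lim_{k\to\infty}\mathbf{v}^{(n_k)}/\|\mathbf{v}^{(n_k)}\|=\mathbf{v}$, where $\mathbf{v}^{(n)}={}^t(M_{[0,n)})\mathbf{v}$ and $\|\cdot\|$ is the maximum norm. $\mathbf{u}$ is a generalized right eigenvector, i.e. a positive vector with $\bigcap_nM_{[0,n)}\mathbb{R}_+^d=\mathbb{R}_+\mathbf{u}$ (it exists under PRICE). A limit word of $\boldsymbol{\sigma}$ is an infinite word $\omega=\omega^{(0)}$ for which there are infinite words $\omega^{(n)}$ with $\omega^{(n)}=\sigma_n(\omega^{(n+1)})$ for all $n$. $\mathbf{1}={}^t(1,\ldots,1)$, $\mathbf{1}^\bot$ is the hyperplane orthogonal to $\mathbf{1}$ with $(d-1)$-dimensional Lebesgue measure $\lambda_{\mathbf{1}}$, $\pi_{\mathbf{u},\mathbf{1}}$ is the projection along $\mathbf{u}$ onto $\mathbf{1}^\bot$, and $\mathcal{R}(i)=\overline{\{\pi_{\mathbf{u},\mathbf{1}}\mathbf{l}(p):p\in\mathcal{A}^*,\ p\,i\text{ is a prefix of a limit word of }\boldsymbol{\sigma}\}}$; $\partial$ is the boundary in $\mathbf{1}^\bot$. *)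

theory Defs
  imports
    "HOL-Analysis.Analysis"
    "HOL-Computational_Algebra.Computational_Algebra"
    "HOL-Library.Stream"
    "HOL-Library.Sublist"
begin

text \<open>The alphabet is the universe of a finite type \<open>'a\<close>, so \<open>d = CARD('a)\<close> and
  \<open>real ^ 'a\<close> is Euclidean \<open>d\<close>-space with coordinates indexed by the letters.\<close>

definition substitution :: "('a list \<Rightarrow> 'a list) \<Rightarrow> bool" where
  "substitution s \<longleftrightarrow> (\<forall>u v. s (u @ v) = s u @ s v) \<and> (\<forall>w. w \<noteq> [] \<longrightarrow> s w \<noteq> [])"

text \<open>The coefficient type is left open: the incidence matrices are used over \<open>real\<close> when acting
  on vectors, and over \<open>rat\<close> when speaking about irreducibility of the characteristic polynomial.\<close>

definition incidence_matrix :: "('a::finite list \<Rightarrow> 'a list) \<Rightarrow> 'b::semiring_1 ^ 'a ^ 'a" where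
  "incidence_matrix s = (\<chi> i j. of_nat (count_list (s [j]) i))"

definition unimodular :: "('a::finite list \<Rightarrow> 'a list) \<Rightarrow> bool" where
  "unimodular s \<longleftrightarrow> \<bar>det (incidence_matrix s :: real ^ 'a ^ 'a)\<bar> = 1"

definition abelianization :: "'a::finite list \<Rightarrow> real ^ 'a" where
  "abelianization w = (\<chi> i. real (count_list w i))"

text \<open>\<open>block_subst \<sigma> k l\<close> and \<open>block_matrix \<sigma> k l\<close> are the products over the half-open range
  \<open>[k, l)\<close> in increasing order of the index; they are the identity if \<open>l \<le> k\<close>.\<close>

definition block_subst :: "(nat \<Rightarrow> 'a list \<Rightarrow> 'a list) \<Rightarrow> nat \<Rightarrow> nat \<Rightarrow> 'a list \<Rightarrow> 'a list" where
  "block_subst \<sigma> k l = foldr (\<circ>) (map \<sigma> [k..<l]) id"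

definition block_matrix ::
    "(nat \<Rightarrow> 'a::finite list \<Rightarrow> 'a list) \<Rightarrow> nat \<Rightarrow> nat \<Rightarrow> 'b::semiring_1 ^ 'a ^ 'a" where
  "block_matrix \<sigma> k l = foldr (**) (map (\<lambda>n. incidence_matrix (\<sigma> n)) [k..<l]) (mat 1)"

definition language :: "(nat \<Rightarrow> 'a list \<Rightarrow> 'a list) \<Rightarrow> nat \<Rightarrow> 'a list set" where
  "language \<sigma> m = {w. \<exists>n\<ge>m. \<exists>i. sublist w (block_subst \<sigma> m n [i])}"

definition balanced :: "real \<Rightarrow> 'a list set \<Rightarrow> bool" where
  "balanced C L \<longleftrightarrow> (\<forall>j. \<forall>u\<in>L. \<forall>v\<in>L. length u = length v \<longrightarrow>
     \<bar>real (count_list u j) - real (count_list v j)\<bar> \<le> C)"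

definition char_polynomial :: "'b::comm_ring_1 ^ 'a ^ 'a \<Rightarrow> 'b poly" where
  "char_polynomial A = det (mat [:0, 1:] - (\<chi> i j. [:A $ i $ j:]))"

definition property_PRICE :: "(nat \<Rightarrow> 'a::finite list \<Rightarrow> 'a list) \<Rightarrow> bool" where
  "property_PRICE \<sigma> \<longleftrightarrow>
    (\<exists>(n :: nat \<Rightarrow> nat) (l :: nat \<Rightarrow> nat) (v :: real ^ 'a).
      strict_mono n \<and> strict_mono l \<and> (\<forall>i. 0 \<le> v $ i) \<and> v \<noteq> 0 \<and>
      \<comment> \<open>(P)\<close>
      (\<exists>h (B :: real ^ 'a ^ 'a). (\<forall>i j. 0 < B $ i $ j) \<and>
         (\<forall>k. h \<le> l k \<and> block_matrix \<sigma> (l k - h) (l k) = B)) \<and>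
      \<comment> \<open>(R)\<close>
      (\<forall>k. \<forall>j<l k. \<sigma> (n k + j) = \<sigma> j) \<and>
      \<comment> \<open>(I)\<close>
      (\<forall>k. \<forall>\<^sub>F m in sequentially.
         irreducible (char_polynomial (block_matrix \<sigma> k m :: rat ^ 'a ^ 'a))) \<and>
      \<comment> \<open>(C)\<close>
      (\<exists>C>0. \<forall>k. balanced C (language \<sigma> (n k + l k))) \<and>
      \<comment> \<open>(E); \<open>infnorm\<close> is the maximum norm\<close>
      (\<lambda>k. let w = transpose (block_matrix \<sigma> 0 (n k)) *v v in w /\<^sub>R infnorm w)
         \<longlonglongrightarrow> v)"

text \<open>The open orthant. Under property PRICE positive blocks occur infinitely often, so that the
  closed orthant would lead to the same generalized right eigenvectors.\<close>

definition positive_cone :: "(real ^ 'a) set" where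
  "positive_cone = {x. \<forall>i. 0 < x $ i}"

definition generalized_right_eigenvector ::
    "(nat \<Rightarrow> 'a::finite list \<Rightarrow> 'a list) \<Rightarrow> real ^ 'a \<Rightarrow> bool" where
  "generalized_right_eigenvector \<sigma> u \<longleftrightarrow> u \<in> positive_cone \<and>
     (\<Inter>n. (\<lambda>x. block_matrix \<sigma> 0 n *v x) ` positive_cone) = {c *\<^sub>R u | c. 0 < c}"

text \<open>The image of an infinite word; \<open>flat\<close> is concatenation because \<open>s\<close> is non-erasing.\<close>

definition subst_stream :: "('a list \<Rightarrow> 'a list) \<Rightarrow> 'a stream \<Rightarrow> 'a stream" where
  "subst_stream s \<omega> = flat (smap (\<lambda>a. s [a]) \<omega>)"

definition limit_word :: "(nat \<Rightarrow> 'a list \<Rightarrow> 'a list) \<Rightarrow> 'a stream \<Rightarrow> bool" where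
  "limit_word \<sigma> \<omega> \<longleftrightarrow>
     (\<exists>W. W 0 = \<omega> \<and> (\<forall>n. W n = subst_stream (\<sigma> n) (W (Suc n))))"

definition orthogonal_hyperplane :: "'v::real_inner \<Rightarrow> 'v set" where
  "orthogonal_hyperplane w = {x. w \<bullet> x = 0}"

text \<open>The projection along \<open>u\<close> onto the hyperplane orthogonal to \<open>w\<close>, for \<open>u \<bullet> w \<noteq> 0\<close>.\<close>

definition projection_along :: "'v::real_inner \<Rightarrow> 'v \<Rightarrow> 'v \<Rightarrow> 'v" where
  "projection_along u w x = x - ((x \<bullet> w) / (u \<bullet> w)) *\<^sub>R u"

text \<open>Here \<open>1 :: real ^ 'a\<close> is the all-ones vector.\<close>

definition rauzy_subtile ::
    "(nat \<Rightarrow> 'a::finite list \<Rightarrow> 'a list) \<Rightarrow> real ^ 'a \<Rightarrow> 'a \<Rightarrow> (real ^ 'a) set" where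
  "rauzy_subtile \<sigma> u i = closure {projection_along u 1 (abelianization p) | p.
     \<exists>\<omega>. limit_word \<sigma> \<omega> \<and> p @ [i] = stake (length p + 1) \<omega>}"

text \<open>Lebesgue measure on a linear subspace, constructed from an orthonormal basis of the subspace
  in the same way as \<^const>\<open>lborel\<close> is constructed from \<^const>\<open>Basis\<close>.\<close>

definition orthonormal_basis_of :: "'v::euclidean_space set \<Rightarrow> 'v set \<Rightarrow> bool" where
  "orthonormal_basis_of V B \<longleftrightarrow>
     pairwise orthogonal B \<and> (\<forall>b\<in>B. norm b = 1) \<and> span B = V"

definition lebesgue_subspace :: "'v::euclidean_space set \<Rightarrow> 'v measure" where
  "lebesgue_subspace V = (let B = (SOME B. orthonormal_basis_of V B) in
     completion (distr (\<Pi>\<^sub>M b\<in>B. (lborel :: real measure)) (restrict_space borel V)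
       (\<lambda>f. \<Sum>b\<in>B. f b *\<^sub>R b)))"

lemma orthonormal_basis_of_exists:
  assumes "subspace V"
  shows "\<exists>B. orthonormal_basis_of V B"
  using orthonormal_basis_subspace[OF assms] unfolding orthonormal_basis_of_def by metis

lemma orthonormal_basis_of_measurable:
  assumes "orthonormal_basis_of V B"
  shows "(\<lambda>f. \<Sum>b\<in>B. f b *\<^sub>R b) \<in> (\<Pi>\<^sub>M b\<in>B. (lborel :: real measure)) \<rightarrow>\<^sub>M restrict_space borel V"
proof (rule measurable_restrict_space2)
  show "(\<lambda>f. \<Sum>b\<in>B. f b *\<^sub>R b) \<in> space (\<Pi>\<^sub>M b\<in>B. (lborel :: real measure)) \<rightarrow> V"
    using assms unfolding orthonormal_basis_of_def
    by (auto intro: span_sum span_scale span_base)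
qed measurable

end

theory Submission
  imports Defs
begin

text \<open>Everything is lifted from the hyperplane to \<open>\<real>\<^sup>d\<close>: with \<open>u\<^sub>n = A(0,n)\<inverse> u\<close>, the cylinder over
  the level-\<open>n\<close> subtile is the closure of all \<open>l(p) + \<real> u\<^sub>n\<close>, and the unimodular matrices \<open>A(n,m)\<close>
  map cylinders of level \<open>m\<close> into those of level \<open>n\<close>.

  Balance at the levels \<open>n\<^sub>k + \<ell>\<^sub>k\<close> together with irreducibility makes the coordinates of \<open>u\<close>
  rationally independent, and balance with recurrence of return words makes the pieces of level
  \<open>n\<^sub>k\<close> shrink. By Kronecker's theorem the translated cylinders indexed by a discrete hyperplane
  \<open>c \<le> \<langle>v,x\<rangle> < c + v\<^sub>i\<close> cover space. A point covered a minimal number of times, over all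
  offsets \<open>c\<close>, lies in the interior of every cylinder covering it; as refining cannot decrease
  covering degrees, the same ball stays inside the corresponding cylinder at all levels \<open>n\<^sub>k\<close>.
  Hence a fixed proportion of the pieces of a cylinder of level \<open>n\<^sub>k\<close> does not contribute to its
  boundary. The boundary measure weighted by \<open>v\<^sub>n\<close> is nondecreasing and bounded in \<open>n\<close>, and loses
  a fixed factor at the levels \<open>n\<^sub>k\<close>, so it vanishes.\<close>

section \<open>Substitutions and prefixes of limit words\<close>

text \<open>The sequence need not be periodic: level \<open>nk k\<close> shares with level 0 only
  the next \<open>lk k\<close> substitutions, so its tiles are perturbations of those of level 0,
  not copies. Whatever is found at level 0 has to survive a small change of the axis
  \<open>un\<close>, of the normal vector \<open>vn\<close> and of the tile. Axes converge because a
  long common block nearly determines them (\<open>ut_nk_tendsto\<close>), normal vectors by (E),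
  and tiles because one fixed \<open>A 0 l\<close> maps the prefixes of level \<open>l\<close> close
  to the axis, for all shifted sequences at once (\<open>uniform_small_level\<close>). The lift to
  R^d avoids projected maps: integer matrices of determinant 1 or -1 preserve volume, so subdivision
  involves no Jacobians. It is not known that the translated tiles form a tiling, so points covered
  exactly once may not exist. A point of minimal covering degree serves as well: near it no covering
  tile can be dispensed with. The weights \<open>vn\<close> are dictated by the identity
  \<open>vn n v* A n m = vn m\<close>, which turns a vector inequality between boundary measures
  into monotonicity of one number.\<close>

lemma substitution_append: "substitution s \<Longrightarrow> s (u @ v) = s u @ s v"
  by (simp add: substitution_def)

lemma substitution_Nil: "substitution s \<Longrightarrow> s [] = []"
  by (metis append_self_conv substitution_append)

lemma substitution_Cons: "substitution s \<Longrightarrow> s (a # w) = s [a] @ s w"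
  by (metis append_Cons append_Nil substitution_append)

lemma substitution_nonempty: "substitution s \<Longrightarrow> w \<noteq> [] \<Longrightarrow> s w \<noteq> []"
  by (simp add: substitution_def)

lemma substitution_id: "substitution (\<lambda>w. w)"
  by (simp add: substitution_def)

lemma substitution_comp: "substitution s \<Longrightarrow> substitution t \<Longrightarrow> substitution (s \<circ> t)"
  by (simp add: substitution_def)

lemma length_substitution_ge:
  assumes "substitution s" shows "length w \<le> length (s w)"
proof (induction w)
  case (Cons a w)
  have "s [a] \<noteq> []" using assms by (simp add: substitution_nonempty)
  then have "1 \<le> length (s [a])" by (simp add: Suc_le_eq)
  then show ?case using Cons by (subst substitution_Cons[OF assms]) simp
qed simp

lemma substitution_prefix:
  assumes "substitution s" "prefix u w" shows "prefix (s u) (s w)"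
  using assms by (metis prefix_def substitution_append)

lemma substitution_sublist:
  assumes "substitution s" "sublist u w" shows "sublist (s u) (s w)"
  using assms by (metis sublist_def substitution_append)

lemma count_list_substitution:
  fixes s :: "'a::finite list \<Rightarrow> 'a list"
  assumes "substitution s"
  shows "count_list (s w) i = (\<Sum>j\<in>UNIV. count_list (s [j]) i * count_list w j)"
proof (induction w)
  case Nil
  then show ?case using substitution_Nil[OF assms] by simp
next
  case (Cons a w)
  have "(\<Sum>j\<in>UNIV. count_list (s [j]) i * count_list (a # w) j)
      = (\<Sum>j\<in>UNIV. count_list (s [j]) i * count_list w j + (if j = a then count_list (s [j]) i else 0))"
    by (rule sum.cong) auto
  also have "\<dots> = count_list (s w) i + count_list (s [a]) i"
    by (simp add: sum.distrib Cons)
  finally show ?case by (subst substitution_Cons[OF assms]) simp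
qed

abbreviation "ab \<equiv> abelianization"

lemma ab_Nil [simp]: "ab [] = 0"
  by (simp add: abelianization_def vec_eq_iff)

lemma ab_append: "ab (u @ v) = ab u + ab v"
  by (simp add: abelianization_def vec_eq_iff)

lemma ab_Cons: "ab (a # w) = axis a 1 + ab w"
  by (auto simp add: abelianization_def vec_eq_iff axis_def)

lemma ab_nth: "ab w $ i = real (count_list w i)"
  by (simp add: abelianization_def)

lemma inner_one_vec: "(1::real^'a) \<bullet> x = (\<Sum>i\<in>UNIV. x $ i)"
  by (simp add: inner_vec_def)

lemma sum_count_list_UNIV: "(\<Sum>i\<in>(UNIV::'a::finite set). count_list w i) = length w"
  by (rule sum_count_set) auto

lemma inner_one_ab: "1 \<bullet> ab w = real (length w)"
  by (simp add: inner_one_vec ab_nth sum_count_list_UNIV flip: of_nat_sum)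

lemma block_subst_empty: "m \<le> n \<Longrightarrow> block_subst \<sigma> n m = id"
  by (simp add: block_subst_def)

lemma block_subst_rec: "n < m \<Longrightarrow> block_subst \<sigma> n m = \<sigma> n \<circ> block_subst \<sigma> (Suc n) m"
  by (simp add: block_subst_def upt_conv_Cons)

lemma block_subst_split:
  assumes "n \<le> k" "k \<le> m"
  shows "block_subst \<sigma> n m = block_subst \<sigma> n k \<circ> block_subst \<sigma> k m"
  using assms
proof (induction n rule: inc_induct)
  case base
  then show ?case by (simp add: block_subst_empty)
next
  case (step n)
  then show ?case by (simp add: block_subst_rec comp_assoc)
qed

lemma block_subst_split_app:
  assumes "n \<le> k" "k \<le> m"
  shows "block_subst \<sigma> n m w = block_subst \<sigma> n k (block_subst \<sigma> k m w)"
  using block_subst_split[OF assms, of \<sigma>] by simp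

lemma block_subst_cong:
  assumes "\<And>j. j < m - n \<Longrightarrow> \<sigma> (n + j) = \<tau> (n' + j)" "m - n = m' - n'" "n \<le> m" "n' \<le> m'"
  shows "block_subst \<sigma> n m = block_subst \<tau> n' m'"
proof -
  have "map \<sigma> [n..<m] = map \<tau> [n'..<m']"
    using assms by (intro nth_equalityI) auto
  then show ?thesis by (simp add: block_subst_def)
qed

lemma block_matrix_empty: "m \<le> n \<Longrightarrow> block_matrix \<sigma> n m = mat 1"
  by (simp add: block_matrix_def)

lemma block_matrix_rec:
  "n < m \<Longrightarrow> block_matrix \<sigma> n m = incidence_matrix (\<sigma> n) ** block_matrix \<sigma> (Suc n) m"
  by (simp add: block_matrix_def upt_conv_Cons)

lemma limit_word_shift_iff:
  "limit_word (\<lambda>k. \<sigma> (n + k)) \<omega> \<longleftrightarrow>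
     (\<exists>\<omega>'. limit_word (\<lambda>k. \<sigma> (Suc n + k)) \<omega>' \<and> \<omega> = subst_stream (\<sigma> n) \<omega>')"
proof
  assume "limit_word (\<lambda>k. \<sigma> (n + k)) \<omega>"
  then obtain W where W: "W 0 = \<omega>" "\<And>k. W k = subst_stream (\<sigma> (n + k)) (W (Suc k))"
    unfolding limit_word_def by blast
  have "limit_word (\<lambda>k. \<sigma> (Suc n + k)) (W 1)"
    unfolding limit_word_def
  proof (intro exI[of _ "\<lambda>k. W (Suc k)"] conjI allI)
    show "W (Suc k) = subst_stream (\<sigma> (Suc n + k)) (W (Suc (Suc k)))" for k
      using W(2)[of "Suc k"] by simp
  qed simp
  moreover have "\<omega> = subst_stream (\<sigma> n) (W 1)" using W(1) W(2)[of 0] by simp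
  ultimately show "\<exists>\<omega>'. limit_word (\<lambda>k. \<sigma> (Suc n + k)) \<omega>' \<and> \<omega> = subst_stream (\<sigma> n) \<omega>'"
    by blast
next
  assume "\<exists>\<omega>'. limit_word (\<lambda>k. \<sigma> (Suc n + k)) \<omega>' \<and> \<omega> = subst_stream (\<sigma> n) \<omega>'"
  then obtain W where W: "\<omega> = subst_stream (\<sigma> n) (W 0)"
    "\<And>k. W k = subst_stream (\<sigma> (Suc n + k)) (W (Suc k))"
    unfolding limit_word_def by blast
  show "limit_word (\<lambda>k. \<sigma> (n + k)) \<omega>"
    unfolding limit_word_def
  proof (intro exI[of _ "\<lambda>k. case k of 0 \<Rightarrow> \<omega> | Suc j \<Rightarrow> W j"] conjI allI)
    fix k
    show "(case k of 0 \<Rightarrow> \<omega> | Suc j \<Rightarrow> W j)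
        = subst_stream (\<sigma> (n + k)) (case Suc k of 0 \<Rightarrow> \<omega> | Suc j \<Rightarrow> W j)"
      using W(1) W(2)[of "k - 1"] by (cases k) simp_all
  qed simp
qed

lemma subst_stream_shift:
  assumes "substitution s"
  shows "subst_stream s (w @- \<omega>) = s w @- subst_stream s \<omega>"
proof (induction w)
  case Nil
  then show ?case by (simp add: substitution_Nil[OF assms])
next
  case (Cons a w)
  then show ?case
    using substitution_nonempty[OF assms, of "[a]"]
    by (subst substitution_Cons[OF assms]) (simp add: subst_stream_def)
qed

text \<open>Desubstitution of a prefix: its last letter \<open>i\<close> falls into the image of one
  letter \<open>j\<close> of \<open>w\<close>, and \<open>p'\<close> is the part of that image
  before it.\<close>

lemma prefix_subst:
  assumes "substitution s" "prefix (p @ [i]) (s w)"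
  shows "\<exists>q j p' r. prefix (q @ [j]) w \<and> p = s q @ p' \<and> s [j] = p' @ i # r"
  using assms(2)
proof (induction w rule: rev_induct)
  case Nil
  then show ?case by (simp add: substitution_Nil[OF assms(1)])
next
  case (snoc a w)
  show ?case
  proof (cases "prefix (p @ [i]) (s w)")
    case True
    then show ?thesis using snoc.IH by (meson prefix_append prefix_order.trans)
  next
    case False
    have "prefix (p @ [i]) (s w @ s [a])"
      using snoc.prems substitution_append[OF assms(1)] by metis
    then obtain us where us: "p @ [i] = s w @ us" "prefix us (s [a])"
      using False by (auto simp: prefix_append)
    then have "us \<noteq> []" using False by (metis append_Nil2 prefix_order.refl)
    then obtain p' where p': "us = p' @ [i]" "p = s w @ p'"
      using us(1) by (metis append_butlast_last_id append_assoc append1_eq_conv)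
    then obtain r where "s [a] = p' @ i # r" using us(2) by (auto simp: prefix_def)
    then show ?thesis using p'(2)
      by (intro exI[of _ w] exI[of _ a] exI[of _ p'] exI[of _ r]) simp
  qed
qed

section \<open>Sequences of unimodular substitutions: words, matrices, desubstitution\<close>

locale directive =
  fixes \<sigma> :: "nat \<Rightarrow> 'a::finite list \<Rightarrow> 'a list"
  assumes subst: "\<And>n. substitution (\<sigma> n)"
    and unimod: "\<And>n. unimodular (\<sigma> n)"
begin

abbreviation bs where "bs \<equiv> block_subst \<sigma>"

abbreviation A :: "nat \<Rightarrow> nat \<Rightarrow> real ^ 'a ^ 'a" where "A \<equiv> block_matrix \<sigma>"

lemma subst_bs: "substitution (bs n m)"
proof (cases "n \<le> m")
  case True
  then show ?thesis
  proof (induction n rule: inc_induct)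
    case base
    then show ?case using substitution_id by (simp add: block_subst_empty id_def)
  next
    case (step n)
    then show ?case using subst by (metis block_subst_rec substitution_comp)
  qed
qed (use substitution_id in \<open>simp add: block_subst_empty id_def\<close>)

lemma block_matrix_nth:
  "(block_matrix \<sigma> n m :: 'b::semiring_1 ^ 'a ^ 'a) $ i $ j = of_nat (count_list (bs n m [j]) i)"
proof (cases "n \<le> m")
  case True
  then show ?thesis
  proof (induction n arbitrary: i rule: inc_induct)
    case base
    then show ?case by (simp add: block_subst_empty block_matrix_empty mat_def)
  next
    case (step n)
    show ?case using step.hyps
      by (simp add: block_matrix_rec block_subst_rec matrix_matrix_mult_def step.IH
          incidence_matrix_def count_list_substitution[OF subst, of n "bs (Suc n) m [j]" i])
  qed
qed (simp add: block_subst_empty block_matrix_empty mat_def)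

lemma ab_bs: "ab (bs n m w) = A n m *v ab w"
  by (simp add: vec_eq_iff ab_nth matrix_vector_mult_def block_matrix_nth
      count_list_substitution[OF subst_bs, of n m w])

lemma A_column: "A n m *v axis j 1 = ab (bs n m [j])"
  by (simp add: ab_bs ab_Cons)

lemma A_nonneg: "0 \<le> A n m $ i $ j"
  by (simp add: block_matrix_nth)

lemma A_split: "n \<le> k \<Longrightarrow> k \<le> m \<Longrightarrow> A n m = A n k ** A k m"
proof -
  assume *: "n \<le> k" "k \<le> m"
  have "A n m $ i $ j = (A n k ** A k m) $ i $ j" for i j
    unfolding block_matrix_nth matrix_matrix_mult_def block_subst_split_app[OF *]
      count_list_substitution[OF subst_bs[of n k], of "bs k m [j]" i]
    by simp
  then show ?thesis by (simp add: vec_eq_iff)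
qed

lemma A_split_app: "n \<le> k \<Longrightarrow> k \<le> m \<Longrightarrow> A n m *v x = A n k *v (A k m *v x)"
  by (metis A_split matrix_vector_mul_assoc)

lemma A_self: "A n n *v x = x"
  by (simp add: block_matrix_empty)

lemma abs_det_A: "\<bar>det (A n m)\<bar> = 1"
proof (cases "n \<le> m")
  case True
  then show ?thesis
  proof (induction n rule: inc_induct)
    case base
    then show ?case by (simp add: block_matrix_empty)
  next
    case (step n)
    then show ?case using unimod[of n]
      by (simp add: block_matrix_rec det_mul abs_mult unimodular_def)
  qed
qed (simp add: block_matrix_empty)

lemma A_invertible: "invertible (A n m)"
  using abs_det_A[of n m] by (metis abs_0 invertible_det_nz zero_neq_one)

text \<open>The finite substitute for limit words of the sequence shifted by \<open>n\<close>. The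
  words \<open>p\<close> with \<open>pre n (p @ [i])\<close> are the ones that generate the subtile
  of \<open>i\<close> at level \<open>n\<close>.\<close>

definition pre :: "nat \<Rightarrow> 'a list \<Rightarrow> bool" where
  "pre n w \<longleftrightarrow> (\<exists>\<omega>. limit_word (\<lambda>k. \<sigma> (n + k)) \<omega> \<and> w = stake (length w) \<omega>)"

text \<open>Factors of limit words instead of factors of images of letters;
  \<open>language_eq_fac\<close> shows that both agree under PRICE, which makes (C) applicable to
  prefixes of limit words.\<close>

definition fac :: "nat \<Rightarrow> 'a list set" where
  "fac n = {V. \<exists>w. pre n w \<and> sublist V w}"

lemma pre_prefix:
  assumes "pre n w" "prefix v w" shows "pre n v"
proof -
  obtain \<omega> where w: "limit_word (\<lambda>k. \<sigma> (n + k)) \<omega>" "w = stake (length w) \<omega>"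
    using assms(1) pre_def by blast
  have "v = take (length v) w" using assms(2) by (auto simp: prefix_def)
  also have "\<dots> = take (length v) (stake (length w) \<omega>)" using w(2) by simp
  also have "\<dots> = stake (length v) \<omega>"
    using prefix_length_le[OF assms(2)] by (simp add: take_stake min_absorb1)
  finally show ?thesis using w(1) pre_def by blast
qed

lemma pre_extend:
  assumes "pre n w" obtains a where "pre n (w @ [a])"
proof -
  obtain \<omega> where w: "limit_word (\<lambda>k. \<sigma> (n + k)) \<omega>" "w = stake (length w) \<omega>"
    using assms(1) pre_def by blast
  have "pre n (w @ [\<omega> !! length w])"
    unfolding pre_def using w by (intro exI[of _ \<omega>]) (simp add: stake_Suc del: stake.simps)
  then show thesis using that by blast
qed

lemma pre_subst_Suc: "pre (Suc n) w \<Longrightarrow> pre n (\<sigma> n w)"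
proof -
  assume "pre (Suc n) w"
  then obtain \<omega> where w: "limit_word (\<lambda>k. \<sigma> (Suc n + k)) \<omega>" "w = stake (length w) \<omega>"
    using pre_def by blast
  have "subst_stream (\<sigma> n) \<omega> = \<sigma> n w @- subst_stream (\<sigma> n) (sdrop (length w) \<omega>)"
    using w(2) subst_stream_shift[OF subst] by (metis stake_sdrop)
  then have "\<sigma> n w = stake (length (\<sigma> n w)) (subst_stream (\<sigma> n) \<omega>)"
    by (simp add: stake_shift)
  then show "pre n (\<sigma> n w)" unfolding pre_def using w(1) limit_word_shift_iff[of \<sigma> n] by blast
qed

lemma pre_desubst_Suc:
  assumes "pre n w" shows "\<exists>w'. pre (Suc n) w' \<and> prefix w (\<sigma> n w')"
proof -
  obtain \<omega> where w: "limit_word (\<lambda>k. \<sigma> (n + k)) \<omega>" "w = stake (length w) \<omega>"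
    using assms pre_def by blast
  then obtain \<omega>' where w': "limit_word (\<lambda>k. \<sigma> (Suc n + k)) \<omega>'" "\<omega> = subst_stream (\<sigma> n) \<omega>'"
    using limit_word_shift_iff[of \<sigma> n] by blast
  \<comment> \<open>A prefix of the length of \<open>w\<close> is long enough, since
    \<open>\<sigma> n\<close> does not shorten words.\<close>
  define v where "v = stake (length w) \<omega>'"
  have v: "length v = length w" by (simp add: v_def)
  have "pre (Suc n) v" unfolding pre_def using w'(1) v v_def by auto
  moreover have "\<omega> = \<sigma> n v @- subst_stream (\<sigma> n) (sdrop (length w) \<omega>')"
    using w'(2) subst_stream_shift[OF subst] v_def by (metis stake_sdrop)
  then have "w = take (length w) (\<sigma> n v)"
    using w(2) length_substitution_ge[OF subst, of v n] v by (simp add: stake_shift)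
  then have "prefix w (\<sigma> n v)" by (metis take_is_prefix)
  ultimately show ?thesis by blast
qed

lemma pre_subst:
  assumes "n \<le> m" "pre m w" shows "pre n (bs n m w)"
  using assms
proof (induction n rule: inc_induct)
  case (step n)
  then show ?case by (simp add: block_subst_rec pre_subst_Suc)
qed (simp add: block_subst_empty)

lemma pre_desubst_prefix:
  assumes "n \<le> m" "pre n w" shows "\<exists>w'. pre m w' \<and> prefix w (bs n m w')"
  using assms
proof (induction n arbitrary: w rule: inc_induct)
  case (step n)
  obtain w' where w': "pre (Suc n) w'" "prefix w (\<sigma> n w')" using pre_desubst_Suc step by blast
  obtain w'' where w'': "pre m w''" "prefix w' (bs (Suc n) m w'')" using step.IH w' by blast
  have "prefix (\<sigma> n w') (bs n m w'')"
    using substitution_prefix[OF subst w''(2)] step.hyps by (simp add: block_subst_rec)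
  then show ?case using w'(2) w''(1) prefix_order.trans by blast
qed (auto simp: block_subst_empty)

lemma pre_desubst:
  assumes "n \<le> m" "pre n (p @ [i])"
  obtains q j p' r where "pre m (q @ [j])" "p = bs n m q @ p'" "bs n m [j] = p' @ i # r"
proof -
  obtain w' where w': "pre m w'" "prefix (p @ [i]) (bs n m w')"
    using pre_desubst_prefix[OF assms] by blast
  show thesis using prefix_subst[OF subst_bs w'(2)] that pre_prefix[OF w'(1)] by blast
qed

lemma pre_resubst:
  assumes "n \<le> m" "pre m (q @ [j])" "bs n m [j] = p' @ i # r"
  shows "pre n (bs n m q @ p' @ [i])"
proof -
  have "pre n (bs n m (q @ [j]))" using pre_subst assms by blast
  moreover have "prefix (bs n m q @ p' @ [i]) (bs n m (q @ [j]))"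
    by (subst substitution_append[OF subst_bs]) (simp add: assms(3))
  ultimately show ?thesis using pre_prefix by blast
qed

lemma pre_imp_fac: "pre n w \<Longrightarrow> w \<in> fac n"
  by (auto simp: fac_def)

lemma fac_sublist: "V \<in> fac n \<Longrightarrow> sublist U V \<Longrightarrow> U \<in> fac n"
  unfolding fac_def using sublist_order.order_trans by blast

lemma fac_subst: "n \<le> m \<Longrightarrow> V \<in> fac m \<Longrightarrow> bs n m V \<in> fac n"
  unfolding fac_def using pre_subst substitution_sublist[OF subst_bs] by blast

end

section \<open>Balance\<close>

lemma linear_axis_bound:
  fixes f :: "real ^ 'a::finite \<Rightarrow> 'b::real_normed_vector"
  assumes "linear f" "\<And>i. norm (f (axis i 1)) \<le> e"
  shows "norm (f x) \<le> real CARD('a) * e * norm x"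
proof -
  have "f x = f (\<Sum>i\<in>UNIV. x $ i *\<^sub>R axis i 1)"
    using basis_expansion[of x] by (simp add: scalar_mult_eq_scaleR)
  also have "\<dots> = (\<Sum>i\<in>UNIV. x $ i *\<^sub>R f (axis i 1))"
    by (simp add: linear_sum[OF assms(1)] linear_scale[OF assms(1)])
  also have "norm \<dots> \<le> (\<Sum>i\<in>(UNIV::'a set). e * norm x)"
  proof (rule sum_norm_le)
    fix i
    have "\<bar>x $ i\<bar> * norm (f (axis i 1)) \<le> norm x * e"
      by (intro mult_mono component_le_norm_cart assms) auto
    then show "norm (x $ i *\<^sub>R f (axis i 1)) \<le> e * norm x" by (simp add: mult.commute)
  qed
  finally show ?thesis by (simp add: mult.assoc)
qed

lemma matrix_mult_entry_ge:
  fixes X Y :: "real ^ 'a::finite ^ 'a"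
  assumes "\<And>i j. 0 \<le> X $ i $ j" "\<And>i j. 0 \<le> Y $ i $ j"
  shows "X $ i $ p * Y $ p $ j \<le> (X ** Y) $ i $ j"
  unfolding matrix_matrix_mult_def
  by (simp add: assms member_le_sum[of p UNIV "\<lambda>k. X $ i $ k * Y $ k $ j"])

lemma norm_ab_le: "norm (ab w) \<le> real (length w)"
proof -
  have "norm (ab w) \<le> (\<Sum>i\<in>UNIV. \<bar>ab w $ i\<bar>)"
    by (rule norm_le_l1_cart)
  then show ?thesis by (simp add: ab_nth sum_count_list_UNIV flip: of_nat_sum)
qed

text \<open>Cut \<open>V\<close> into blocks of length \<open>L\<close>. Each block deviates from
  \<open>c\<close> by at most \<open>C\<close>, and the last incomplete block costs at most
  \<open>L\<close> letters, which is the square of \<open>L\<close> after multiplication by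
  \<open>L\<close>.\<close>

lemma balance_long:
  fixes c C :: real
  assumes "\<And>U. sublist U V \<Longrightarrow> length U = L \<Longrightarrow> \<bar>real (count_list U j) - c\<bar> \<le> C"
    and "0 \<le> c" "c \<le> L" "0 \<le> C" "0 < L"
  shows "\<bar>real L * real (count_list V j) - real (length V) * c\<bar> \<le> real (length V) * C + (real L)\<^sup>2"
  using assms(1)
proof (induction "length V" arbitrary: V rule: less_induct)
  case less
  show ?case
  proof (cases "length V < L")
    case True
    have a: "real (count_list V j) \<le> real L" using count_le_length[of V j] True by linarith
    have "real L * real (count_list V j) \<le> (real L)\<^sup>2"
      unfolding power2_eq_square by (intro mult_left_mono a) simp
    moreover have "real (length V) * c \<le> (real L)\<^sup>2"
      unfolding power2_eq_square using True assms by (intro mult_mono) auto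
    moreover have "0 \<le> real L * real (count_list V j)" "0 \<le> real (length V) * c" "0 \<le> real (length V) * C"
      using assms by auto
    ultimately show ?thesis by linarith
  next
    case False
    define V1 V2 where "V1 = take L V" and "V2 = drop L V"
    have V: "V = V1 @ V2" "length V1 = L" using False by (auto simp: V1_def V2_def)
    have "\<bar>real L * real (count_list V2 j) - real (length V2) * c\<bar> \<le> real (length V2) * C + (real L)\<^sup>2"
    proof (rule less.hyps)
      show "length V2 < length V" using V assms by simp
      show "\<bar>real (count_list U j) - c\<bar> \<le> C" if "sublist U V2" "length U = L" for U
        using less.prems that V(1) sublist_order.order_trans by blast
    qed
    moreover have "\<bar>real (count_list V1 j) - c\<bar> \<le> C"
      using less.prems V by blast
    then have "real L * \<bar>real (count_list V1 j) - c\<bar> \<le> real L * C"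
      by (intro mult_left_mono) auto
    then have "\<bar>real L * real (count_list V1 j) - real L * c\<bar> \<le> real L * C"
      by (simp add: abs_mult right_diff_distrib flip: right_diff_distrib)
    ultimately show ?thesis using V by (simp add: algebra_simps)
  qed
qed

text \<open>The witnesses of PRICE are fixed, and two degenerate cases are excluded: with one letter
  (I) says nothing, linear polynomials being irreducible, and \<open>pre_0\<close> expresses that a
  limit word exists.\<close>

locale price = directive \<sigma> for \<sigma> :: "nat \<Rightarrow> 'a::finite list \<Rightarrow> 'a list" +
  fixes u v :: "real ^ 'a" and nk lk :: "nat \<Rightarrow> nat" and h :: nat and B :: "real ^ 'a ^ 'a"
    and C :: real
  assumes nk_mono: "strict_mono nk" and lk_mono: "strict_mono lk"
    and v_nonneg: "\<And>i. 0 \<le> v $ i" and v_nonzero: "v \<noteq> 0"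
    and B_pos: "\<And>i j. 0 < B $ i $ j"
    and h_le: "\<And>k. h \<le> lk k" and block_B: "\<And>k. A (lk k - h) (lk k) = B"
    and recurrence: "\<And>k j. j < lk k \<Longrightarrow> \<sigma> (nk k + j) = \<sigma> j"
    and irred: "\<And>k. \<forall>\<^sub>F m in sequentially.
         irreducible (char_polynomial (block_matrix \<sigma> k m :: rat ^ 'a ^ 'a))"
    and C_pos: "0 < C" and bal: "\<And>k. balanced C (language \<sigma> (nk k + lk k))"
    and v_limit: "(\<lambda>k. let w = transpose (A 0 (nk k)) *v v in w /\<^sub>R infnorm w) \<longlonglongrightarrow> v"
    and u_cone: "\<And>n. \<exists>x. (\<forall>i. 0 < x $ i) \<and> u = A 0 n *v x"
    and two_letters: "2 \<le> CARD('a)"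
    and pre_0: "pre 0 []"
begin

abbreviation Nk :: "nat \<Rightarrow> nat" where "Nk k \<equiv> nk k + lk k"

lemma lk_ge: "k \<le> lk k" and nk_ge: "k \<le> nk k"
  using strict_mono_imp_increasing lk_mono nk_mono by auto

section \<open>Positivity of long products and recurrence of factors\<close>

lemma A_row_nonzero: "\<exists>j. 1 \<le> A n m $ i $ j"
proof (rule ccontr)
  assume "\<not> ?thesis"
  then have "A n m $ i $ j = 0" for j
    by (metis block_matrix_nth not_less of_nat_0 of_nat_less_iff of_nat_1 less_one)
  then have "det (A n m) = 0"
    by (intro det_zero_row(1)[of i]) (simp add: row_def vec_eq_iff)
  then show False using abs_det_A[of n m] by simp
qed

lemma A_column_nonzero: "\<exists>i. 1 \<le> A n m $ i $ j"
proof (rule ccontr)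
  assume "\<not> ?thesis"
  then have "A n m $ i $ j = 0" for i
    by (metis block_matrix_nth not_less of_nat_0 of_nat_less_iff of_nat_1 less_one)
  then have "det (A n m) = 0"
    by (intro det_zero_column(1)[of j]) (simp add: column_def vec_eq_iff)
  then show False using abs_det_A[of n m] by simp
qed

lemma B_ge_1: "1 \<le> B $ i $ j"
proof -
  have "B $ i $ j = real (count_list (bs (lk 0 - h) (lk 0) [j]) i)"
    by (simp flip: block_matrix_nth block_B[of 0])
  then show ?thesis using B_pos[of i j] by simp
qed

text \<open>A product that contains the positive block \<open>B\<close> is positive, because the
  factor before it has no zero row and the factor after it no zero column. Entries are integers,
  hence at least 1.\<close>

lemma A_block_ge_1:
  assumes "n \<le> lk k - h" "lk k \<le> m" shows "1 \<le> A n m $ i $ j"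
proof -
  obtain p where p: "1 \<le> A n (lk k - h) $ i $ p" using A_row_nonzero by blast
  obtain q where q: "1 \<le> A (lk k) m $ q $ j" using A_column_nonzero by blast
  have "1 \<le> A n (lk k - h) $ i $ p * B $ p $ q"
    using p B_ge_1[of p q] by (metis mult_1 mult_mono' zero_le_one)
  also have "\<dots> \<le> (A n (lk k - h) ** B) $ i $ q"
    using A_nonneg B_pos by (intro matrix_mult_entry_ge) (auto intro: less_imp_le)
  also have "A n (lk k - h) ** B = A n (lk k)"
    using A_split[of n "lk k - h" "lk k"] assms block_B by simp
  finally have "1 \<le> A n (lk k) $ i $ q * A (lk k) m $ q $ j"
    using q by (metis mult_1 mult_mono' zero_le_one)
  also have "\<dots> \<le> (A n (lk k) ** A (lk k) m) $ i $ j"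
    using A_nonneg by (intro matrix_mult_entry_ge) auto
  also have "\<dots> = A n m $ i $ j"
    using A_split[of n "lk k" m] assms by simp
  finally show ?thesis .
qed

lemma A_eventually_ge_1: "\<exists>m0\<ge>n. \<forall>m\<ge>m0. \<forall>i j. 1 \<le> A n m $ i $ j"
proof (intro exI[of _ "lk (n + h)"] conjI allI impI)
  show "n \<le> lk (n + h)" using lk_ge[of "n + h"] by simp
  show "1 \<le> A n m $ i $ j" if "lk (n + h) \<le> m" for m i j
    using lk_ge[of "n + h"] that by (intro A_block_ge_1[of n "n + h"]) auto
qed

text \<open>Each further positive block multiplies the lower bound by at least the number of
  letters, which is at least 2.\<close>

lemma A_eventually_ge_power: "\<exists>m0\<ge>n. \<forall>m\<ge>m0. \<forall>i j. 2 ^ t \<le> A n m $ i $ j"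
proof (induction t)
  case 0
  then show ?case using A_eventually_ge_1 by simp
next
  case (Suc t)
  then obtain m0 where m0: "m0 \<ge> n" "\<And>m i j. m \<ge> m0 \<Longrightarrow> 2 ^ t \<le> A n m $ i $ j" by blast
  obtain m1 where m1: "m1 \<ge> m0" "\<And>m i j. m \<ge> m1 \<Longrightarrow> 1 \<le> A m0 m $ i $ j"
    using A_eventually_ge_1 by blast
  have "2 ^ Suc t \<le> A n m $ i $ j" if "m \<ge> m1" for m i j
  proof -
    have "2 ^ Suc t \<le> real CARD('a) * 2 ^ t" using two_letters by simp
    also have "\<dots> = (\<Sum>p\<in>(UNIV::'a set). 2 ^ t * 1)" by simp
    also have "\<dots> \<le> (\<Sum>p\<in>UNIV. A n m0 $ i $ p * A m0 m $ p $ j)"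
      using m0 m1 that by (intro sum_mono mult_mono) (auto simp: A_nonneg)
    also have "\<dots> = A n m $ i $ j"
      using A_split[of n m0 m] m0 m1 that by (simp add: matrix_matrix_mult_def)
    finally show ?thesis .
  qed
  then show ?case using m0(1) m1(1) by (meson le_trans)
qed

lemma A_eventually_ge: "\<exists>m0\<ge>n. \<forall>m\<ge>m0. \<forall>i j. K \<le> A n m $ i $ j"
proof -
  obtain t where "K < 2 ^ t" using real_arch_pow[of 2 K] by auto
  then show ?thesis using A_eventually_ge_power[of n t] by (meson less_imp_le order_trans)
qed

lemma A_entry_le_length: "A n m $ i $ j \<le> real (length (bs n m [j]))"
  by (simp add: block_matrix_nth count_le_length)

lemma pre_Nil: "pre n []"
  using pre_desubst_prefix[of 0 n "[]"] pre_0 pre_prefix[of n _ "[]"] by auto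

lemma letter_in_block: "1 \<le> A n m $ i $ j \<Longrightarrow> \<exists>p r. bs n m [j] = p @ i # r"
  by (metis block_matrix_nth count_notin not_one_le_zero of_nat_0 split_list)

text \<open>Any limit word of a deep level starts with some letter, and the image of this letter at
  level \<open>n\<close> contains all letters.\<close>

lemma pre_letter: "\<exists>q. pre n (q @ [j])"
proof -
  obtain m where m: "n \<le> m" "\<And>i j. 1 \<le> A n m $ i $ j" using A_eventually_ge_1 by blast
  obtain a where a: "pre m [a]" using pre_extend[OF pre_Nil] by (metis append_Nil)
  obtain p r where "bs n m [a] = p @ j # r" using letter_in_block[OF m(2)] by blast
  then show ?thesis using pre_resubst[OF m(1), of "[]" a p j r] a
    by (auto simp: substitution_Nil[OF subst_bs])
qed

lemma letter_in_fac: "[a] \<in> fac n"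
  using pre_letter[of n a] fac_sublist pre_imp_fac by (metis sublist_appendI append_Nil2 append.assoc)

lemma block_in_fac: "n \<le> m \<Longrightarrow> bs n m [a] \<in> fac n"
  using fac_subst letter_in_fac by blast

lemma sublist_block_mono:
  assumes "n \<le> m" "m \<le> m'" "1 \<le> A m m' $ b $ a"
  shows "sublist (bs n m [b]) (bs n m' [a])"
proof -
  obtain p r where "bs m m' [a] = p @ b # r" using letter_in_block assms by blast
  then have "sublist [b] (bs m m' [a])" by (metis append_Cons append_Nil sublist_appendI)
  then show ?thesis
    using substitution_sublist[OF subst_bs] block_subst_split_app[OF assms(1,2)] by metis
qed

text \<open>This is minimality in finite form: \<open>V\<close> lies in a prefix of a limit word,
  which lies in the image of the first letter of a deep desubstitution, and that letter occurs in
  the images of all letters from still deeper levels.\<close>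

lemma fac_in_block:
  assumes "V \<in> fac n" shows "\<exists>m0\<ge>n. \<forall>m\<ge>m0. \<forall>a. sublist V (bs n m [a])"
proof -
  obtain w where w: "pre n w" "sublist V w" using assms fac_def by blast
  show ?thesis
  proof (cases "w = []")
    case True
    then show ?thesis using w by (intro exI[of _ n]) auto
  next
    case False
    obtain m1 where m1: "n \<le> m1" "\<And>i j. real (length w) \<le> A n m1 $ i $ j"
      using A_eventually_ge by blast
    have len: "length w \<le> length (bs n m1 [a])" for a
      using m1(2)[of undefined a] A_entry_le_length[of n m1 undefined a] by linarith
    obtain w' where w': "pre m1 w'" "prefix w (bs n m1 w')"
      using pre_desubst_prefix[OF m1(1) w(1)] by blast
    have "w' \<noteq> []" using w'(2) False by (auto simp: substitution_Nil[OF subst_bs])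
    then obtain b w'' where b: "w' = b # w''" by (cases w') auto
    have "prefix w (bs n m1 [b] @ bs n m1 w'')"
      using w'(2) unfolding b by (subst (asm) substitution_Cons[OF subst_bs])
    then have "prefix w (bs n m1 [b])"
      using len[of b] by (auto simp: prefix_append)
    then have "sublist V (bs n m1 [b])"
      using w(2) prefix_imp_sublist sublist_order.order_trans by blast
    moreover obtain m2 where m2: "m1 \<le> m2" "\<And>m i j. m \<ge> m2 \<Longrightarrow> 1 \<le> A m1 m $ i $ j"
      using A_eventually_ge_1 by blast
    ultimately have "sublist V (bs n m [a])" if "m \<ge> m2" for m a
      using sublist_block_mono[of n m1 m b a] m1 m2 that sublist_order.order_trans
      by (meson le_trans)
    then show ?thesis using m1(1) m2(1) by (meson le_trans)
  qed
qed

lemma language_eq_fac: "language \<sigma> n = fac n"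
proof (intro subset_antisym subsetI)
  fix V assume "V \<in> language \<sigma> n"
  then show "V \<in> fac n" unfolding language_def using block_in_fac fac_sublist by blast
next
  fix V assume "V \<in> fac n"
  then show "V \<in> language \<sigma> n" unfolding language_def using fac_in_block by blast
qed

section \<open>Letter frequencies, projections and discrepancy at each level\<close>

definition un :: "nat \<Rightarrow> real ^ 'a" where
  "un n = (SOME x. (\<forall>i. 0 < x $ i) \<and> u = A 0 n *v x)"

lemma un_pos: "0 < un n $ i" and A_un_0: "A 0 n *v un n = u"
  using someI_ex[OF u_cone[of n]] unfolding un_def by auto

lemma abs_un [simp]: "\<bar>un n $ i\<bar> = un n $ i"
  using un_pos[of n i] by simp

lemma A_inj: "A n m *v x = A n m *v y \<Longrightarrow> x = y"
  using inj_matrix_vector_mult[OF A_invertible] by (metis injD)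

lemma un_0: "un 0 = u"
  using A_un_0[of 0] by (simp add: A_self)

lemma A_un: "n \<le> m \<Longrightarrow> A n m *v un m = un n"
  using A_inj[of 0 n] A_split_app[of 0 n m "un m"] A_un_0 by (metis le0)

lemma sum_un_pos: "0 < 1 \<bullet> un n"
  unfolding inner_one_vec using un_pos by (intro sum_pos) auto

text \<open>Scaled to coordinate sum 1, \<open>un n\<close> becomes the vector of letter frequencies
  at level \<open>n\<close>.\<close>

definition ut :: "nat \<Rightarrow> real ^ 'a" where
  "ut n = un n /\<^sub>R (1 \<bullet> un n)"

text \<open>The projection along \<open>un n\<close> onto the hyperplane orthogonal to 1. On
  \<open>ab w\<close> it is the discrepancy of \<open>w\<close> from the letter frequencies.\<close>

definition proj :: "nat \<Rightarrow> real ^ 'a \<Rightarrow> real ^ 'a" where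
  "proj n x = x - (1 \<bullet> x) *\<^sub>R ut n"

lemma ut_pos: "0 < ut n $ i"
  using un_pos sum_un_pos by (simp add: ut_def)

lemma abs_ut [simp]: "\<bar>ut n $ i\<bar> = ut n $ i"
  using ut_pos[of n i] by simp

lemma inner_one_ut: "1 \<bullet> ut n = 1"
  using sum_un_pos[of n] by (simp add: ut_def)

lemma un_eq: "un n = (1 \<bullet> un n) *\<^sub>R ut n"
  using sum_un_pos[of n] by (simp add: ut_def)

lemma norm_ut_le: "norm (ut n) \<le> 1"
proof -
  have "norm (ut n) \<le> (\<Sum>i\<in>UNIV. \<bar>ut n $ i\<bar>)" by (rule norm_le_l1_cart)
  also have "\<dots> = 1 \<bullet> ut n" by (simp add: inner_one_vec)
  finally show ?thesis by (simp add: inner_one_ut)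
qed

lemma linear_proj: "linear (proj n)"
  by (intro linearI) (simp_all add: proj_def inner_add_right algebra_simps)

lemmas proj_add = linear_add[OF linear_proj] and proj_diff = linear_diff[OF linear_proj]
  and proj_scale = linear_scale[OF linear_proj]

lemma proj_zero [simp]: "proj n 0 = 0"
  by (simp add: proj_def)

lemma proj_ut [simp]: "proj n (ut n) = 0"
  by (simp add: proj_def inner_one_ut)

lemma proj_un [simp]: "proj n (un n) = 0"
  by (subst un_eq) (simp add: proj_scale)

lemma proj_decomp: "x = proj n x + (1 \<bullet> x) *\<^sub>R ut n"
  by (simp add: proj_def)

lemma A_ut: "n \<le> m \<Longrightarrow> proj n (A n m *v ut m) = 0"
  by (simp add: ut_def matrix_vector_mult_scaleR A_un proj_scale)

text \<open>\<open>A n m\<close> maps the axis of level \<open>m\<close> onto that of level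
  \<open>n\<close>, so it acts on vectors modulo the axes.\<close>

lemma proj_A: "n \<le> m \<Longrightarrow> proj n (A n m *v x) = proj n (A n m *v proj m x)"
  by (subst (1) proj_decomp[of x m])
    (simp add: matrix_vector_right_distrib proj_add matrix_vector_mult_scaleR proj_scale A_ut)

lemma linear_proj_A: "linear (\<lambda>x. proj n (A m k *v x))"
  using linear_compose[OF matrix_vector_mul_linear linear_proj] by (simp add: comp_def)

text \<open>Balance compares only words of equal length. To compare \<open>w\<close> with the
  frequencies, write \<open>un n\<close> as a positive combination of abelianized images of letters
  from a deep level, and cut these long words into factors of the length of
  \<open>w\<close>.\<close>

lemma fac_balance:
  assumes "w \<in> fac (Nk k)"
  shows "\<bar>real (count_list w j) - real (length w) * ut (Nk k) $ j\<bar> \<le> C"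
proof (cases "w = []")
  case True
  then show ?thesis using C_pos by simp
next
  case False
  define n where "n = Nk k"
  define L where "L = length w"
  define c where "c = real (count_list w j)"
  define s where "s = 1 \<bullet> un n"
  have s: "0 < s" using sum_un_pos s_def by simp
  have L: "0 < L" using False by (simp add: L_def)
  \<comment> \<open>\<open>K\<close> is a lower bound for the lengths of the images. The incomplete
    block in each image costs the square of \<open>L\<close> once, which after weighting by
    \<open>un m\<close> is a relative error of order \<open>1 / K\<close>.\<close>
  have bound: "\<bar>real L * ut n $ j - c\<bar> \<le> C + (real L)\<^sup>2 / K" if K: "K > 0" for K :: real
  proof -
    obtain m where m: "n \<le> m" "\<And>i j. K \<le> A n m $ i $ j" using A_eventually_ge by blast
    let ?a = "un m" and ?V = "\<lambda>i. bs n m [i]"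
    have len: "K \<le> real (length (?V i))" for i
      using m(2) A_entry_le_length order_trans by blast
    have s_eq: "s = (\<Sum>i\<in>UNIV. ?a $ i * real (length (?V i)))"
    proof -
      have "s = (\<Sum>p\<in>UNIV. (A n m *v ?a) $ p)" using A_un[OF m(1)] by (simp add: s_def inner_one_vec)
      also have "\<dots> = (\<Sum>i\<in>UNIV. \<Sum>p\<in>UNIV. A n m $ p $ i * ?a $ i)"
        by (simp add: matrix_vector_mult_def) (rule sum.swap)
      also have "\<dots> = (\<Sum>i\<in>UNIV. ?a $ i * real (length (?V i)))"
        by (simp add: block_matrix_nth sum_count_list_UNIV flip: sum_distrib_right of_nat_sum)
           (simp add: mult.commute)
      finally show ?thesis .
    qed
    have long: "\<bar>real L * real (count_list (?V i) j) - real (length (?V i)) * c\<bar>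
        \<le> real (length (?V i)) * C + (real L)\<^sup>2" for i
    proof (rule balance_long)
      fix U assume U: "sublist U (?V i)" "length U = L"
      have "U \<in> fac n" using U block_in_fac[OF m(1)] fac_sublist by blast
      then show "\<bar>real (count_list U j) - c\<bar> \<le> C"
        using bal[of k] assms U(2) unfolding balanced_def language_eq_fac c_def L_def n_def by blast
    qed (use C_pos L count_le_length in \<open>auto simp: c_def L_def\<close>)
    have "real L * un n $ j - s * c
        = (\<Sum>i\<in>UNIV. ?a $ i * (real L * real (count_list (?V i) j) - real (length (?V i)) * c))"
      using A_un[OF m(1)]
      by (simp add: s_eq matrix_vector_mult_def block_matrix_nth sum_subtractf sum_distrib_left
          sum_distrib_right right_diff_distrib flip: A_un[OF m(1)]) (simp add: mult_ac)
    also have "\<bar>\<dots>\<bar> \<le> (\<Sum>i\<in>UNIV. ?a $ i * (real (length (?V i)) * C + (real L)\<^sup>2))"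
      using long un_pos[THEN less_imp_le]
      by (intro order_trans[OF sum_abs] sum_mono) (simp add: abs_mult mult_left_mono)
    also have "\<dots> = s * C + (\<Sum>i\<in>UNIV. ?a $ i) * (real L)\<^sup>2"
      by (simp add: s_eq sum.distrib distrib_left sum_distrib_right mult.assoc)
    also have "(\<Sum>i\<in>UNIV. ?a $ i) \<le> s / K"
    proof -
      have "(\<Sum>i\<in>UNIV. ?a $ i * K) \<le> s"
        unfolding s_eq using len un_pos[THEN less_imp_le] by (intro sum_mono mult_left_mono) auto
      then show ?thesis using K by (simp add: pos_le_divide_eq sum_distrib_right)
    qed
    finally have "\<bar>real L * un n $ j - s * c\<bar> \<le> s * C + s / K * (real L)\<^sup>2"
      by (simp add: mult_right_mono)
    moreover have "un n $ j = s * ut n $ j" using un_eq[of n] s_def by (metis vector_scaleR_component real_scaleR_def)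
    ultimately have "\<bar>s * (real L * ut n $ j - c)\<bar> \<le> s * (C + (real L)\<^sup>2 / K)"
      by (simp add: algebra_simps)
    then have "s * \<bar>real L * ut n $ j - c\<bar> \<le> s * (C + (real L)\<^sup>2 / K)"
      using s by (simp only: abs_mult abs_of_pos)
    then show ?thesis using s by simp
  qed
  have "\<bar>real L * ut n $ j - c\<bar> \<le> C + e" if "e > 0" for e
    using bound[of "(real L)\<^sup>2 / e"] that L by simp
  then have "\<bar>real L * ut n $ j - c\<bar> \<le> C" by (rule field_le_epsilon)
  then show ?thesis by (simp add: L_def c_def n_def abs_minus_commute)
qed

lemma proj_ab_nth:
  "proj n (ab w) $ j = real (count_list w j) - real (length w) * ut n $ j"
  by (simp add: proj_def inner_one_ab ab_nth)

lemma fac_Nk_bounded: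
  assumes "w \<in> fac (Nk k)" shows "norm (proj (Nk k) (ab w)) \<le> real CARD('a) * C"
proof -
  have "norm (proj (Nk k) (ab w)) \<le> (\<Sum>j\<in>UNIV. \<bar>proj (Nk k) (ab w) $ j\<bar>)"
    by (rule norm_le_l1_cart)
  also have "\<dots> \<le> (\<Sum>j\<in>(UNIV::'a set). C)"
    using fac_balance[OF assms] by (intro sum_mono) (simp add: proj_ab_nth)
  finally show ?thesis by simp
qed

lemma proj_length_bound: "norm (proj n (ab w)) \<le> 2 * real (length w)"
proof -
  have "norm (real (length w) *\<^sub>R ut n) \<le> real (length w)"
    using norm_ut_le[of n] by (simp add: mult_left_le)
  then show ?thesis
    unfolding proj_def inner_one_ab using norm_ab_le[of w]
    by (intro order_trans[OF norm_triangle_ineq4]) linarith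
qed

lemma pre_split:
  assumes "n \<le> m" "pre n w"
  obtains q j p' r where "pre m q" "w = bs n m q @ p'" "bs n m [j] = p' @ r" "pre m (q @ [j])"
proof (cases w rule: rev_cases)
  case Nil
  obtain a where "pre m [a]" using pre_extend[OF pre_Nil] by (metis append_Nil)
  then show ?thesis using that[of "[]" "[]" a "bs n m [a]"] pre_Nil Nil substitution_Nil[OF subst_bs]
    by simp
next
  case (snoc p i)
  obtain q j p' r where *: "pre m (q @ [j])" "p = bs n m q @ p'" "bs n m [j] = p' @ i # r"
    using pre_desubst[OF assms(1)] assms(2) snoc by metis
  show ?thesis
    using * snoc pre_prefix[OF *(1)] by (intro that[of q "p' @ [i]" j r]) auto
qed

text \<open>The bound at a balanced level \<open>Nk n\<close> above \<open>n\<close> is carried down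
  by the fixed matrix \<open>A n m\<close>; what remains is a prefix of the image of one letter, of
  bounded length. The bound depends on \<open>n\<close>.\<close>

lemma pre_bounded: "\<exists>K. \<forall>w. pre n w \<longrightarrow> norm (proj n (ab w)) \<le> K"
proof -
  define m where "m = Nk n"
  have nm: "n \<le> m" using nk_ge[of n] by (simp add: m_def)
  define e where "e = (\<Sum>i\<in>UNIV. norm (proj n (A n m *v axis i 1)))"
  define L where "L = (\<Sum>j\<in>UNIV. length (bs n m [j]))"
  have e: "norm (proj n (A n m *v axis i 1)) \<le> e" for i
    unfolding e_def by (intro member_le_sum) auto
  then have e0: "0 \<le> e" by (meson norm_ge_zero order_trans)
  have "norm (proj n (ab w)) \<le> real CARD('a) * e * (real CARD('a) * C) + 2 * real L" if w: "pre n w" for w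
  proof -
    obtain q j p' r where q: "pre m q" "w = bs n m q @ p'" "bs n m [j] = p' @ r"
      using pre_split[OF nm w] by metis
    have "length p' \<le> length (bs n m [j])" using q(3) by simp
    also have "\<dots> \<le> L" unfolding L_def by (intro member_le_sum) auto
    finally have p': "norm (proj n (ab p')) \<le> 2 * real L"
      using proj_length_bound[of n p'] by linarith
    have "norm (proj n (A n m *v ab q)) \<le> real CARD('a) * e * norm (proj m (ab q))"
      using linear_axis_bound[OF linear_proj_A e] proj_A[OF nm] by metis
    also have "\<dots> \<le> real CARD('a) * e * (real CARD('a) * C)"
      using fac_Nk_bounded[of q n] pre_imp_fac[OF q(1)] e0 by (intro mult_left_mono) (auto simp: m_def)
    finally show ?thesis
      using p' unfolding q(2) ab_append ab_bs proj_add
      by (intro norm_triangle_mono)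
  qed
  then show ?thesis by blast
qed

text \<open>A factor is the difference of two prefixes.\<close>

lemma fac_bounded_of_pre:
  assumes "\<And>w. pre n w \<Longrightarrow> norm (proj n (ab w)) \<le> K" "V \<in> fac n"
  shows "norm (proj n (ab V)) \<le> 2 * K"
proof -
  obtain p r where w: "pre n (p @ V @ r)" using assms(2) unfolding fac_def sublist_def by blast
  have "pre n p" "pre n (p @ V)" using pre_prefix[OF w] by auto
  then have "norm (proj n (ab (p @ V)) - proj n (ab p)) \<le> K + K"
    by (intro order_trans[OF norm_triangle_ineq4] add_mono assms(1))
  then show ?thesis by (simp add: ab_append proj_add)
qed

lemma fac_bounded: "\<exists>K>0. \<forall>V\<in>fac n. norm (proj n (ab V)) \<le> K"
proof -
  obtain K where "\<And>w. pre n w \<Longrightarrow> norm (proj n (ab w)) \<le> K" using pre_bounded by blast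
  then have "\<forall>V\<in>fac n. norm (proj n (ab V)) \<le> max 1 (2 * K)"
    using fac_bounded_of_pre by (meson max.coboundedI2)
  then show ?thesis by (intro exI[of _ "max 1 (2 * K)"]) auto
qed

end

section \<open>Contraction along the recurrent levels\<close>

definition int_vec :: "real ^ 'a::finite \<Rightarrow> bool" where
  "int_vec x \<longleftrightarrow> (\<forall>i. x $ i \<in> \<int>)"

lemma int_vec_add: "int_vec x \<Longrightarrow> int_vec y \<Longrightarrow> int_vec (x + y)"
  and int_vec_diff: "int_vec x \<Longrightarrow> int_vec y \<Longrightarrow> int_vec (x - y)"
  by (auto simp: int_vec_def)

lemma int_vec_ab: "int_vec (ab w)"
  by (auto simp: int_vec_def ab_nth)

lemma int_vec_inner: "int_vec x \<Longrightarrow> int_vec y \<Longrightarrow> x \<bullet> y \<in> \<int>"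
  unfolding inner_vec_def int_vec_def by (intro Ints_sum) simp

lemma finite_int_vec_ball: "finite {x :: real ^ 'a::finite. int_vec x \<and> norm x \<le> K}"
proof -
  define I where "I = real_of_int ` {- \<lceil>K\<rceil>..\<lceil>K\<rceil>}"
  have "x \<in> vec_lambda ` (UNIV \<rightarrow>\<^sub>E I)" if x: "int_vec x" "norm x \<le> K" for x :: "real ^ 'a"
  proof -
    have "x $ i \<in> I" for i
    proof -
      obtain z where z: "x $ i = real_of_int z" using x(1) by (auto simp: int_vec_def elim: Ints_cases)
      have "\<bar>x $ i\<bar> \<le> K" using x(2) component_le_norm_cart order_trans by blast
      then have "z \<in> {- \<lceil>K\<rceil>..\<lceil>K\<rceil>}" unfolding z by (simp add: abs_le_iff) linarith
      then show ?thesis unfolding z I_def by blast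
    qed
    then show ?thesis by (intro image_eqI[of _ _ "vec_nth x"]) auto
  qed
  moreover have "finite (vec_lambda ` (UNIV \<rightarrow>\<^sub>E I) :: (real ^ 'a) set)"
    by (intro finite_imageI finite_PiE) (auto simp: I_def)
  ultimately show ?thesis by (auto intro: finite_subset)
qed

lemma char_polynomial_entry:
  fixes M :: "'b::comm_ring_1 ^ 'a::finite ^ 'a"
  shows "(mat [:0, 1:] - (\<chi> i j. [:M $ i $ j:])) $ i $ j
    = (if i = j then [:- (M $ i $ i), 1:] else [:- (M $ i $ j):])"
  by (simp add: mat_def)

text \<open>In the Leibniz expansion only the identity multiplies all the linear diagonal entries;
  any other permutation picks a constant entry and stays below the top degree.\<close>

lemma coeff_char_polynomial_CARD:
  fixes M :: "'b::idom ^ 'a::finite ^ 'a"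
  shows "coeff (char_polynomial M) CARD('a) = 1"
proof -
  define P where "P = mat [:0, 1:] - (\<chi> i j. [:M $ i $ j:])"
  have P: "P $ i $ j = (if i = j then [:- (M $ i $ i), 1:] else [:- (M $ i $ j):])" for i j
    unfolding P_def by (rule char_polynomial_entry)
  have "coeff (of_int (sign p) * (\<Prod>i\<in>UNIV. P $ i $ p i)) CARD('a) = (if p = id then 1 else 0)"
    for p :: "'a \<Rightarrow> 'a"
  proof (cases "p = id")
    case True
    have "degree (\<Prod>i\<in>(UNIV::'a set). [:- (M $ i $ i), 1:]) = CARD('a)"
      by (subst degree_prod_eq_sum_degree) auto
    moreover have "lead_coeff (\<Prod>i\<in>(UNIV::'a set). [:- (M $ i $ i), 1:]) = 1"
      by (simp add: lead_coeff_prod)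
    ultimately show ?thesis using True by (simp add: P sign_id)
  next
    case False
    then obtain i0 where i0: "p i0 \<noteq> i0" by fastforce
    have "degree (of_int (sign p) * (\<Prod>i\<in>UNIV. P $ i $ p i)) \<le> degree (\<Prod>i\<in>UNIV. P $ i $ p i)"
      using degree_mult_le[of "of_int (sign p)" "\<Prod>i\<in>UNIV. P $ i $ p i"] by simp
    also have "\<dots> \<le> (\<Sum>i\<in>UNIV. degree (P $ i $ p i))"
      using degree_prod_sum_le[of UNIV "\<lambda>i. P $ i $ p i"] by (simp add: comp_def)
    also have "\<dots> < (\<Sum>i\<in>(UNIV::'a set). 1)"
      by (rule sum_strict_mono_ex1) (use i0 in \<open>auto simp: P intro!: exI[of _ i0]\<close>)
    finally have "degree (of_int (sign p) * (\<Prod>i\<in>UNIV. P $ i $ p i)) < CARD('a)" by simp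
    then show ?thesis using False by (simp add: coeff_eq_0)
  qed
  then have "coeff (char_polynomial M) CARD('a)
      = (\<Sum>p | p permutes (UNIV::'a set). if p = id then 1 else 0)"
    unfolding char_polynomial_def P_def[symmetric] det_def coeff_sum by simp
  also have "\<dots> = 1" by (simp add: sum.delta permutes_id)
  finally show ?thesis .
qed

lemma poly_char_polynomial:
  fixes M :: "'b::comm_ring_1 ^ 'a::finite ^ 'a"
  shows "poly (char_polynomial M) x = det (mat x - M)"
proof -
  have "poly ((mat [:0, 1:] - (\<chi> i j. [:M $ i $ j:])) $ i $ j) x = (mat x - M) $ i $ j" for i j
    unfolding char_polynomial_entry by (simp add: mat_def)
  moreover have "poly (of_int (sign p)) x = of_int (sign p)" for p :: "'a \<Rightarrow> 'a"
    by (simp add: sign_def)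
  ultimately show ?thesis
    unfolding char_polynomial_def det_def poly_sum poly_mult poly_prod by simp
qed

text \<open>A nonzero fixed vector would make 1 a root and split off a linear factor, impossible for
  an irreducible polynomial of degree at least 2.\<close>

lemma irreducible_char_polynomial_no_fixed_vector:
  fixes M :: "'b::field ^ 'a::finite ^ 'a"
  assumes "irreducible (char_polynomial M)" "2 \<le> CARD('a)" "x v* M = x"
  shows "x = 0"
proof -
  have "poly (char_polynomial M) 1 \<noteq> 0"
  proof
    assume "poly (char_polynomial M) 1 = 0"
    then obtain q where q: "char_polynomial M = [:- 1, 1:] * q"
      by (metis dvdE poly_eq_0_iff_dvd)
    have "\<not> [:- 1, 1::'b:] dvd 1" by (simp add: is_unit_iff_degree)
    then have "q dvd 1" using irreducibleD[OF assms(1) q] by blast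
    then have "degree (char_polynomial M) \<le> 1"
      using degree_mult_le[of "[:- 1, 1:]" q] by (cases "q = 0") (auto simp: q is_unit_iff_degree)
    moreover have "CARD('a) \<le> degree (char_polynomial M)"
      using coeff_char_polynomial_CARD[of M] by (intro le_degree) simp
    ultimately show False using assms(2) by simp
  qed
  then have "invertible (transpose (mat 1 - M))"
    by (simp add: poly_char_polynomial invertible_det_nz det_transpose)
  then have inj: "inj ((*v) (transpose (mat 1 - M)))" by (rule inj_matrix_vector_mult)
  have "transpose (mat 1 - M) *v x = x - transpose M *v x"
    by (simp add: matrix_vector_mult_def transpose_def mat_def vec_eq_iff left_diff_distrib
        sum_subtractf if_distrib[of "\<lambda>y. y * _"] cong: if_cong)
  also have "\<dots> = transpose (mat 1 - M) *v 0"
    using assms(3) by simp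
  finally show ?thesis using inj by (metis injD)
qed

lemma letter_enumeration:
  obtains b :: "nat \<Rightarrow> 'a::finite" and g where "\<And>j. g j < CARD('a)" "\<And>j. b (g j) = j"
    "bij_betw b {..<CARD('a)} UNIV"
proof -
  obtain b where b: "bij_betw b {..<CARD('a)} (UNIV :: 'a set)"
    using ex_bij_betw_nat_finite[of "UNIV :: 'a set"] by (auto simp: atLeast0LessThan)
  show thesis
    using bij_betw_the_inv_into[OF b] f_the_inv_into_f_bij_betw[OF b]
    by (intro that[of "the_inv_into {..<CARD('a)} b" b] b) (auto simp: bij_betw_def)
qed

text \<open>By Dirichlet's theorem a real normal vector has a multiple close to an integer vector, and
  an integer smaller than \<open>1\<close> in absolute value is \<open>0\<close>.\<close>

lemma span_int_vecs_eq_UNIV: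
  fixes T :: "(real ^ 'a::finite) set"
  assumes int: "\<And>t. t \<in> T \<Longrightarrow> int_vec t"
    and orth: "\<And>x. int_vec x \<Longrightarrow> (\<And>t. t \<in> T \<Longrightarrow> x \<bullet> t = 0) \<Longrightarrow> x = 0"
  shows "span T = UNIV"
proof (rule ccontr)
  assume "span T \<noteq> UNIV"
  then obtain a0 where a0: "a0 \<noteq> 0" "\<And>x. x \<in> span T \<Longrightarrow> a0 \<bullet> x = 0"
    using span_not_UNIV_orthogonal by blast
  obtain j0 where j0: "a0 $ j0 \<noteq> 0" using a0(1) by (auto simp: vec_eq_iff)
  \<comment> \<open>With the coordinate at \<open>j0\<close> scaled to 1, the integer vector
    approximating a positive multiple \<open>q\<close> of \<open>a\<close> cannot be 0.\<close>
  define a where "a = a0 /\<^sub>R (a0 $ j0)"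
  have a: "a $ j0 = 1" "\<And>x. x \<in> span T \<Longrightarrow> a \<bullet> x = 0"
    using j0 a0(2) by (auto simp: a_def)
  obtain T' where T': "T' \<subseteq> T" "independent T'" "T \<subseteq> span T'"
    using maximal_independent_subset by blast
  have fin: "finite T'" using T'(2) independent_imp_finite by blast
  \<comment> \<open>Errors below \<open>1 / N\<close> in all coordinates change the inner product
    with each of the finitely many \<open>t\<close> in \<open>T'\<close> by less than 1.\<close>
  define N where "N = nat \<lceil>\<Sum>t\<in>T'. \<Sum>j\<in>UNIV. \<bar>t $ j\<bar>\<rceil> + 1"
  have N_pos: "0 < N" by (simp add: N_def)
  have N: "(\<Sum>j\<in>UNIV. \<bar>t $ j\<bar>) < real N" if "t \<in> T'" for t :: "real ^ 'a"
  proof -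
    have "(\<Sum>j\<in>UNIV. \<bar>t $ j\<bar>) \<le> (\<Sum>t\<in>T'. \<Sum>j\<in>UNIV. \<bar>t $ j\<bar>)"
      using that fin by (intro member_le_sum) (auto intro: sum_nonneg)
    then show ?thesis unfolding N_def by linarith
  qed
  obtain b g where g: "\<And>j::'a. g j < CARD('a)" "\<And>j. b (g j) = j" using letter_enumeration by metis
  obtain q p where q: "0 < q" "\<And>i. i < CARD('a) \<Longrightarrow> \<bar>of_int q * a $ b i - of_int (p i)\<bar> < 1 / real N"
    using Dirichlet_approx_simult[of N "CARD('a)" "\<lambda>i. a $ b i"] N_pos by metis
  define x :: "real ^ 'a" where "x = (\<chi> j. of_int (p (g j)))"
  have x: "\<bar>of_int q * a $ j - x $ j\<bar> < 1 / real N" for j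
    using q(2)[OF g(1)[of j]] by (simp add: x_def g(2))
  have xint: "int_vec x" by (simp add: int_vec_def x_def)
  have orth': "x \<bullet> t = 0" if t: "t \<in> T'" for t
  proof -
    have "x \<bullet> t = (x - of_int q *\<^sub>R a) \<bullet> t"
      using a(2)[of t] t T'(1) span_superset by (auto simp: inner_diff_left)
    also have "\<bar>\<dots>\<bar> \<le> (\<Sum>j\<in>UNIV. \<bar>(x - of_int q *\<^sub>R a) $ j * t $ j\<bar>)"
      by (simp add: inner_vec_def)
    also have "\<dots> \<le> (\<Sum>j\<in>UNIV. 1 / real N * \<bar>t $ j\<bar>)"
    proof (rule sum_mono)
      fix j
      have "\<bar>x $ j - of_int q * a $ j\<bar> \<le> 1 / real N" using x[of j] by (simp add: abs_minus_commute)
      from mult_right_mono[OF this, of "\<bar>t $ j\<bar>"]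
      show "\<bar>(x - of_int q *\<^sub>R a) $ j * t $ j\<bar> \<le> 1 / real N * \<bar>t $ j\<bar>" by (simp add: abs_mult)
    qed
    also have "\<dots> < 1"
      using N[OF t] by (simp add: N_def flip: sum_distrib_left sum_divide_distrib)
    finally have "\<bar>x \<bullet> t\<bar> < 1" .
    moreover have "x \<bullet> t \<in> \<int>" using int_vec_inner[OF xint int] t T'(1) by blast
    ultimately show ?thesis by (metis Ints_nonzero_abs_less1)
  qed
  have "x \<bullet> t = 0" if "t \<in> T" for t
  proof -
    have "t \<in> span T'" using T'(3) that by blast
    then show ?thesis
      by (induction rule: span_induct_alt) (simp_all add: inner_add_right orth')
  qed
  then have "x = 0" using orth xint by blast
  then have "real_of_int q < 1 / real N" using x[of j0] a(1) q(1) by simp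
  also have "\<dots> \<le> 1" by (simp add: N_def)
  finally show False using q(1) by simp
qed

text \<open>Take the stretch from the first to the last occurrence of \<open>i\<close>;
  \<open>w\<close> may contain \<open>i\<close> again, so these returns can be arbitrarily
  long.\<close>

lemma long_return:
  assumes "c + 2 \<le> count_list V i"
  shows "\<exists>w. sublist (i # w @ [i]) V \<and> c \<le> length w"
proof -
  have "i \<in> set V" using assms by (metis count_notin not_less_eq_eq zero_le add_2_eq_Suc')
  then obtain p r where p: "V = p @ i # r" "i \<notin> set p" by (meson split_list_first)
  have r: "c + 1 \<le> count_list r i" using assms p by (simp add: count_list_append)
  then have "i \<in> set r" by (metis count_notin not_less_eq_eq zero_le Suc_eq_plus1)
  then obtain w s where w: "r = w @ i # s" "i \<notin> set s" by (meson split_list_last)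
  have "c \<le> count_list w i" using r w by (simp add: count_list_append)
  then have "c \<le> length w" using count_le_length order_trans by metis
  moreover have "sublist (i # w @ [i]) V"
    unfolding sublist_def using p(1) w(1) by (intro exI[of _ p] exI[of _ s]) simp
  ultimately show ?thesis by blast
qed

context price
begin

lemma inner_ut_0: "x \<bullet> u = 0 \<Longrightarrow> x \<bullet> ut 0 = 0"
  by (simp add: ut_def un_0)

lemma inner_proj_0: "x \<bullet> u = 0 \<Longrightarrow> x \<bullet> proj 0 y = x \<bullet> y"
  by (simp add: proj_def inner_diff_right inner_ut_0)

lemma inner_fac_bounded:
  assumes "f \<bullet> u = 0" shows "\<exists>K. \<forall>V\<in>fac 0. \<bar>f \<bullet> ab V\<bar> \<le> K"
proof -
  obtain K where K: "\<And>V. V \<in> fac 0 \<Longrightarrow> norm (proj 0 (ab V)) \<le> K"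
    using fac_bounded by blast
  have "\<bar>f \<bullet> ab V\<bar> \<le> norm f * K" if "V \<in> fac 0" for V
  proof -
    have "\<bar>f \<bullet> ab V\<bar> = \<bar>f \<bullet> proj 0 (ab V)\<bar>"
      by (simp add: inner_proj_0[OF assms])
    also have "\<dots> \<le> norm f * norm (proj 0 (ab V))" by (rule Cauchy_Schwarz_ineq2)
    also have "\<dots> \<le> norm f * K" using K[OF that] by (intro mult_left_mono) auto
    finally show ?thesis .
  qed
  then show ?thesis by blast
qed

text \<open>If \<open>x\<close> is an integer vector orthogonal to \<open>u\<close>, the integer vectors \<open>x v* A 0 n\<close> are bounded,
  so one of them, \<open>y\<close>, recurs; then \<open>y\<close> is a left eigenvector of some \<open>A m n\<close> for the
  eigenvalue \<open>1\<close>.\<close>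

lemma rational_independence:
  assumes x: "int_vec x" "x \<bullet> u = 0" shows "x = 0"
proof (rule ccontr)
  assume nz: "x \<noteq> 0"
  obtain K where K: "\<And>V. V \<in> fac 0 \<Longrightarrow> \<bar>x \<bullet> ab V\<bar> \<le> K"
    using inner_fac_bounded[OF x(2)] by blast
  define y where "y n = x v* A 0 n" for n
  have y_nth: "y n $ i = x \<bullet> ab (bs 0 n [i])" for n i
  proof -
    have "y n $ i = y n \<bullet> axis i 1" by (simp add: inner_axis)
    then show ?thesis unfolding y_def by (simp add: dot_lmul_matrix A_column)
  qed
  have "int_vec (y n)" for n
    using int_vec_inner[OF x(1) int_vec_ab] by (simp add: int_vec_def y_nth)
  moreover have "norm (y n) \<le> real CARD('a) * K" for n
  proof -
    have "norm (y n) \<le> (\<Sum>i\<in>UNIV. \<bar>y n $ i\<bar>)" by (rule norm_le_l1_cart)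
    also have "\<dots> \<le> (\<Sum>i\<in>(UNIV::'a set). K)"
      using K block_in_fac by (intro sum_mono) (auto simp: y_nth)
    finally show ?thesis by simp
  qed
  ultimately have "range y \<subseteq> {z. int_vec z \<and> norm z \<le> real CARD('a) * K}" by auto
  then have "finite (range y)" using finite_int_vec_ball finite_subset by blast
  then obtain m where m: "infinite {n \<in> UNIV. y n = y m}"
    using pigeonhole_infinite[of "UNIV :: nat set" y] by auto
  obtain M where M: "\<And>n. n \<ge> M \<Longrightarrow> irreducible (char_polynomial (block_matrix \<sigma> m n :: rat ^ 'a ^ 'a))"
    using irred[of m] by (auto simp: eventually_sequentially)
  obtain n where n: "n \<ge> max m M" "y n = y m"
    using m unfolding infinite_nat_iff_unbounded_le by blast
  have "y n = y m v* A m n"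
    unfolding y_def using A_split[of 0 m n] n(1) by (simp add: vector_matrix_mul_assoc)
  then have fix_y: "y m v* A m n = y m" using n(2) by simp
  have "y m \<noteq> 0"
  proof
    assume "y m = 0"
    then have "transpose (A 0 m) *v x = transpose (A 0 m) *v 0" by (simp add: y_def)
    moreover have "invertible (transpose (A 0 m))"
      using A_invertible by (simp add: invertible_det_nz det_transpose)
    ultimately show False using nz inj_matrix_vector_mult by (metis injD)
  qed
  define z where "z i = \<lfloor>y m $ i\<rfloor>" for i
  have z: "y m $ i = of_int (z i)" for i
    using \<open>\<And>n. int_vec (y n)\<close>[of m] by (simp add: z_def int_vec_def)
  \<comment> \<open>The equation is moved to \<open>rat\<close>, because (I) concerns irreducibility
    over the rationals; over the reals the polynomial may factor.\<close>
  define yr :: "rat ^ 'a" where "yr = (\<chi> i. of_int (z i))"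
  have "(\<Sum>i\<in>UNIV. z i * int (count_list (bs m n [j]) i)) = z j" for j
  proof -
    have "(\<Sum>i\<in>UNIV. y m $ i * A m n $ i $ j) = y m $ j"
      using fix_y by (metis (no_types, lifting) vec_lambda_beta vector_matrix_mult_def sum.cong mult.commute)
    then have "real_of_int (\<Sum>i\<in>UNIV. z i * int (count_list (bs m n [j]) i)) = real_of_int (z j)"
      by (simp add: z block_matrix_nth)
    then show ?thesis by (simp only: of_int_eq_iff)
  qed
  then have "rat_of_int (\<Sum>i\<in>UNIV. z i * int (count_list (bs m n [j]) i)) = rat_of_int (z j)" for j
    by simp
  then have "yr v* block_matrix \<sigma> m n = yr"
    by (simp add: yr_def vec_eq_iff vector_matrix_mult_def block_matrix_nth mult.commute)
  moreover have "n \<ge> M" using n(1) by simp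
  ultimately have "yr = 0"
    using irreducible_char_polynomial_no_fixed_vector[OF M two_letters] by blast
  then have "y m = 0" by (simp add: yr_def vec_eq_iff z)
  then show False using \<open>y m \<noteq> 0\<close> by simp
qed

section \<open>Comparison of the levels \<open>nk k\<close> with level 0\<close>

lemma length_bs: "length (bs n m w) = (\<Sum>j\<in>UNIV. length (bs n m [j]) * count_list w j)"
proof -
  have "length (bs n m w) = (\<Sum>i\<in>UNIV. \<Sum>j\<in>UNIV. count_list (bs n m [j]) i * count_list w j)"
    unfolding sum_count_list_UNIV[symmetric, of "bs n m w"] count_list_substitution[OF subst_bs, of n m w] ..
  also have "\<dots> = (\<Sum>j\<in>UNIV. length (bs n m [j]) * count_list w j)"
    by (subst sum.swap) (simp add: sum_count_list_UNIV flip: sum_distrib_right)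
  finally show ?thesis .
qed

text \<open>The entries of \<open>B\<close> lie between 1 and \<beta>, so any two columns of a
  nonnegative product ending in \<open>B\<close> are comparable up to the factor \<beta>.\<close>

definition \<beta> :: real where "\<beta> = (\<Sum>i\<in>UNIV. \<Sum>j\<in>UNIV. B $ i $ j)"

lemma B_le_\<beta>: "B $ i $ j \<le> \<beta>"
proof -
  have nn: "0 \<le> B $ i $ j" for i j using B_pos[of i j] by simp
  have "B $ i $ j \<le> (\<Sum>j\<in>UNIV. B $ i $ j)" by (intro member_le_sum) (auto simp: nn)
  also have "\<dots> \<le> \<beta>" unfolding \<beta>_def by (intro member_le_sum) (auto simp: nn intro: sum_nonneg)
  finally show ?thesis .
qed

lemma \<beta>_ge_1: "1 \<le> \<beta>"
  using B_ge_1[of undefined undefined] B_le_\<beta>[of undefined undefined] by linarith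

lemma length_comparable:
  "real (length (bs 0 (lk k) [i])) \<le> \<beta> * real (length (bs 0 (lk k) [j]))"
proof -
  have len: "real (length (bs 0 (lk k) [i])) = (\<Sum>p\<in>UNIV. real (length (bs 0 (lk k - h) [p])) * B $ p $ i)" for i
    using length_bs[of 0 "lk k - h" "bs (lk k - h) (lk k) [i]"]
    by (simp add: block_matrix_nth flip: block_B[of k] block_subst_split_app[of 0 "lk k - h" "lk k" \<sigma>])
  have "B $ p $ i \<le> \<beta> * B $ p $ j" for p
    using mult_mono[OF B_le_\<beta>[of p i] B_ge_1[of p j]] \<beta>_ge_1 B_pos[of p i] by simp
  then have "real (length (bs 0 (lk k) [i])) \<le> (\<Sum>p\<in>UNIV. real (length (bs 0 (lk k - h) [p])) * (\<beta> * B $ p $ j))"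
    unfolding len by (intro sum_mono mult_left_mono) auto
  then show ?thesis unfolding len[of j] by (simp add: sum_distrib_left mult_ac)
qed

lemma bs_recurrent: "b \<le> lk k \<Longrightarrow> bs (nk k + a) (nk k + b) = bs a b"
proof (cases "a \<le> b")
  case True
  assume "b \<le> lk k"
  with True show ?thesis
    using recurrence[of "a + _" k] by (intro block_subst_cong) (auto simp: add.assoc)
qed (simp add: block_subst_empty)

lemma A_recurrent: "b \<le> lk k \<Longrightarrow> A (nk k + a) (nk k + b) = A a b"
  by (simp add: vec_eq_iff block_matrix_nth bs_recurrent)

lemma A_nk_Nk: "A (nk k) (Nk k) = A 0 (lk k)"
  using A_recurrent[of "lk k" k 0] by simp

lemma one_le_length_bs: "1 \<le> real (length (bs n m [j]))"
  using length_substitution_ge[OF subst_bs, of "[j]"] by simp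

text \<open>By (R), \<open>un (nk k)\<close> is a positive combination of the columns of
  \<open>A 0 (lk k)\<close>. Each column has projection at most \<eta>, while its coordinate sum is
  the length of an image; these lengths are comparable, so the frequencies differ by at most \<beta>
  * \<eta> over such a length.\<close>

lemma ut_nk_close:
  assumes \<eta>: "\<And>i. norm (proj 0 (A 0 (lk k) *v axis i 1)) \<le> \<eta>"
  shows "norm (ut (nk k) - ut 0) * real (length (bs 0 (lk k) [j])) \<le> \<beta> * \<eta>"
proof -
  define a where "a = un (Nk k)"
  define s where "s = 1 \<bullet> un (nk k)"
  define t where "t i = real (length (bs 0 (lk k) [i]))" for i
  have \<eta>0: "0 \<le> \<eta>" using \<eta> norm_ge_zero order_trans by metis
  have s: "0 < s" using sum_un_pos by (simp add: s_def)
  have eq: "un (nk k) = (\<Sum>i\<in>UNIV. a $ i *\<^sub>R (A 0 (lk k) *v axis i 1))"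
  proof -
    have "un (nk k) = A 0 (lk k) *v a" using A_un[of "nk k" "Nk k"] by (simp add: A_nk_Nk a_def)
    also have "\<dots> = A 0 (lk k) *v (\<Sum>i\<in>UNIV. a $ i *\<^sub>R axis i 1)"
      using basis_expansion[of a] by (simp add: scalar_mult_eq_scaleR)
    finally show ?thesis
      by (simp add: linear_sum[OF matrix_vector_mul_linear] matrix_vector_mult_scaleR)
  qed
  have s_eq: "s = (\<Sum>i\<in>UNIV. a $ i * t i)"
    unfolding s_def eq by (simp add: inner_sum_right A_column inner_one_ab t_def)
  have "proj 0 (un (nk k)) = s *\<^sub>R (ut (nk k) - ut 0)"
    unfolding proj_def s_def[symmetric] using un_eq[of "nk k"] by (simp add: s_def scaleR_diff_right)
  then have "s * norm (ut (nk k) - ut 0) = norm (proj 0 (un (nk k)))" using s by simp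
  also have "proj 0 (un (nk k)) = (\<Sum>i\<in>UNIV. a $ i *\<^sub>R proj 0 (A 0 (lk k) *v axis i 1))"
    unfolding eq by (simp add: linear_sum[OF linear_proj] proj_scale)
  also have "norm \<dots> \<le> (\<Sum>i\<in>UNIV. a $ i * \<eta>)"
    using \<eta> un_pos[THEN less_imp_le, of "Nk k"]
    by (intro sum_norm_le) (auto simp: a_def intro!: mult_left_mono)
  finally have 1: "s * norm (ut (nk k) - ut 0) * t j \<le> (\<Sum>i\<in>UNIV. a $ i * \<eta>) * t j"
    by (intro mult_right_mono) (auto simp: t_def)
  also have "\<dots> = \<eta> * (\<Sum>i\<in>UNIV. a $ i * t j)" by (simp add: sum_distrib_left sum_distrib_right mult_ac)
  also have "\<dots> \<le> \<eta> * (\<Sum>i\<in>UNIV. a $ i * (\<beta> * t i))"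
    using \<eta>0 un_pos[THEN less_imp_le, of "Nk k"]
    by (intro mult_left_mono sum_mono) (auto simp: a_def t_def length_comparable)
  also have "\<dots> = s * (\<beta> * \<eta>)" by (simp add: s_eq sum_distrib_left sum_distrib_right mult_ac)
  finally show ?thesis using s by (simp add: mult.assoc t_def)
qed

lemma proj_change: "proj n x = proj 0 x - (1 \<bullet> x) *\<^sub>R (ut n - ut 0)"
  by (simp add: proj_def scaleR_diff_right)

text \<open>Changing the projection costs the height \<open>1 \<bullet> x\<close> times the
  difference of frequencies, which stays below \<beta> * \<eta> up to the length of an image from
  level \<open>lk k\<close>.\<close>

lemma proj_nk_le:
  assumes \<eta>: "\<And>i. norm (proj 0 (A 0 (lk k) *v axis i 1)) \<le> \<eta>"
    and "\<bar>1 \<bullet> x\<bar> \<le> real (length (bs 0 (lk k) [j]))"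
  shows "norm (proj (nk k) x) \<le> norm (proj 0 x) + \<beta> * \<eta>"
proof -
  have "norm (proj (nk k) x) \<le> norm (proj 0 x) + \<bar>1 \<bullet> x\<bar> * norm (ut (nk k) - ut 0)"
    unfolding proj_change[of "nk k"] by (intro order_trans[OF norm_triangle_ineq4]) simp
  also have "\<bar>1 \<bullet> x\<bar> * norm (ut (nk k) - ut 0) \<le> norm (ut (nk k) - ut 0) * real (length (bs 0 (lk k) [j]))"
    using assms(2) by (subst mult.commute) (intro mult_left_mono, auto)
  also have "\<dots> \<le> \<beta> * \<eta>" by (rule ut_nk_close[OF \<eta>])
  finally show ?thesis by simp
qed

text \<open>A prefix at level \<open>nk k + l\<close> need not be one at level \<open>l\<close>.
  Desubstituted to the balanced level \<open>Nk k\<close>, it splits into the image of a prefix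
  \<open>q\<close> of discrepancy bounded through \<open>C\<close>, contracted by
  \<open>A 0 (lk k)\<close>, and a word \<open>p'\<close> inside a block shared with the original
  sequence, to which the level 0 bound \<epsilon> applies.\<close>

lemma pre_nk_image_le:
  assumes \<eta>: "\<And>i. norm (proj 0 (A 0 (lk k) *v axis i 1)) \<le> \<eta>"
    and l: "l \<le> lk k"
    and \<epsilon>: "\<And>V. V \<in> fac l \<Longrightarrow> norm (proj 0 (A 0 l *v ab V)) \<le> \<epsilon>"
    and w: "pre (nk k + l) w"
  shows "norm (proj (nk k) (A 0 l *v ab w))
    \<le> real CARD('a) * (\<eta> + \<beta> * \<eta>) * (real CARD('a) * C) + (\<epsilon> + \<beta> * \<eta>)"
proof -
  have "nk k + l \<le> Nk k" using l by simp
  from pre_split[OF this w] obtain q j p' r where q: "pre (Nk k) q"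
    "w = bs (nk k + l) (Nk k) q @ p'" "bs (nk k + l) (Nk k) [j] = p' @ r" .
  have bs_eq: "bs (nk k + l) (Nk k) = bs l (lk k)" using bs_recurrent[of "lk k" k l] by simp
  have \<eta>0: "0 \<le> \<eta>" using \<eta> norm_ge_zero order_trans by metis
  have e: "norm (proj (nk k) (A 0 (lk k) *v axis i 1)) \<le> \<eta> + \<beta> * \<eta>" for i
    using proj_nk_le[OF \<eta>, of "A 0 (lk k) *v axis i 1" i] \<eta>[of i]
    by (simp add: A_column inner_one_ab)
  have "norm (proj (nk k) (A 0 (lk k) *v ab q))
      = norm (proj (nk k) (A 0 (lk k) *v proj (Nk k) (ab q)))"
    using proj_A[of "nk k" "Nk k"] by (simp add: A_nk_Nk)
  also have "\<dots> \<le> real CARD('a) * (\<eta> + \<beta> * \<eta>) * norm (proj (Nk k) (ab q))"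
    by (rule linear_axis_bound[OF linear_proj_A e])
  also have "\<dots> \<le> real CARD('a) * (\<eta> + \<beta> * \<eta>) * (real CARD('a) * C)"
    using fac_Nk_bounded[OF pre_imp_fac[OF q(1)]] \<eta>0 \<beta>_ge_1 by (intro mult_left_mono) auto
  finally have 1: "norm (proj (nk k) (A 0 (lk k) *v ab q))
      \<le> real CARD('a) * (\<eta> + \<beta> * \<eta>) * (real CARD('a) * C)" .
  have p': "sublist p' (bs l (lk k) [j])" using q(3) by (simp add: bs_eq)
  have "length (bs 0 l p') \<le> length (bs 0 (lk k) [j])"
    using sublist_length_le[OF substitution_sublist[OF subst_bs p', of 0 l]] l
    by (simp add: block_subst_split_app[of 0 l "lk k"])
  then have "norm (proj (nk k) (A 0 l *v ab p')) \<le> norm (proj 0 (A 0 l *v ab p')) + \<beta> * \<eta>"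
    by (intro proj_nk_le[OF \<eta>, of _ j]) (simp add: inner_one_ab flip: ab_bs)
  moreover have "p' \<in> fac l" using p' fac_sublist block_in_fac[OF l] by blast
  ultimately have 2: "norm (proj (nk k) (A 0 l *v ab p')) \<le> \<epsilon> + \<beta> * \<eta>"
    using \<epsilon> by fastforce
  have "A 0 l *v ab w = A 0 (lk k) *v ab q + A 0 l *v ab p'"
    using A_split_app[of 0 l "lk k"] l
    by (simp add: q(2) bs_eq ab_append ab_bs matrix_vector_right_distrib)
  then show ?thesis using 1 2 by (simp add: proj_add norm_triangle_mono)
qed

text \<open>The case \<open>l = 0\<close> of the previous estimate, with the level 0 discrepancy
  bound for both \<eta> and \<epsilon>: the point is uniformity in \<open>k\<close>.\<close>

lemma fac_nk_bounded: "\<exists>K>0. \<forall>k. \<forall>V\<in>fac (nk k). norm (proj (nk k) (ab V)) \<le> K"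
proof -
  obtain K where K: "0 < K" "\<And>V. V \<in> fac 0 \<Longrightarrow> norm (proj 0 (ab V)) \<le> K"
    using fac_bounded by blast
  define K' where "K' = real CARD('a) * (K + \<beta> * K) * (real CARD('a) * C) + (K + \<beta> * K)"
  have "norm (proj (nk k) (ab w)) \<le> K'" if "pre (nk k) w" for k w
    using pre_nk_image_le[of k K 0 K w] K(2) block_in_fac[of 0 "lk k"] that
    by (simp add: A_self A_column K'_def)
  then have "norm (proj (nk k) (ab V)) \<le> 2 * K'" if "V \<in> fac (nk k)" for k V
    using that fac_bounded_of_pre by blast
  moreover have "0 < K'" unfolding K'_def using K(1) \<beta>_ge_1 C_pos
    by (intro add_nonneg_pos add_pos_pos mult_nonneg_nonneg mult_pos_pos add_nonneg_nonneg) auto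
  ultimately show ?thesis by (intro exI[of _ "2 * K'"]) auto
qed

text \<open>A factor \<open>V\<close> almost maximizing \<open>f\<close> occurs in the image of a letter \<open>i\<close>. If \<open>i\<close> returns
  after \<open>i w\<close>, there is a factor that begins and ends with \<open>V\<close> at distance the image of \<open>i w\<close>, and
  by maximality this image cannot increase \<open>f\<close> by much.\<close>

lemma return_image_le:
  assumes f: "f \<bullet> u = 0" and "0 < e"
  shows "\<exists>N. \<forall>n\<ge>N. \<forall>i w. i # w @ [i] \<in> fac n \<longrightarrow> f \<bullet> (A 0 n *v ab (i # w)) \<le> e"
proof -
  obtain K where K: "\<And>V. V \<in> fac 0 \<Longrightarrow> \<bar>f \<bullet> ab V\<bar> \<le> K"
    using inner_fac_bounded[OF f] by blast
  define S where "S = Sup ((\<lambda>V. f \<bullet> ab V) ` fac 0)"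
  have bdd: "bdd_above ((\<lambda>V. f \<bullet> ab V) ` fac 0)"
    by (rule bdd_aboveI2[of _ _ K]) (use K in \<open>fastforce simp: abs_le_iff\<close>)
  have S: "f \<bullet> ab V \<le> S" if "V \<in> fac 0" for V
    unfolding S_def using that bdd by (intro cSUP_upper)
  have "fac 0 \<noteq> {}" using letter_in_fac by blast
  then obtain V where V: "V \<in> fac 0" "S - e < f \<bullet> ab V"
    using less_cSUP_iff[of "fac 0" "\<lambda>V. f \<bullet> ab V" "S - e"] bdd \<open>0 < e\<close> S_def by auto
  obtain N where N: "\<And>n a. n \<ge> N \<Longrightarrow> sublist V (bs 0 n [a])" using fac_in_block[OF V(1)] by blast
  have "f \<bullet> (A 0 n *v ab (i # w)) \<le> e" if n: "n \<ge> N" and w: "i # w @ [i] \<in> fac n" for n i w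
  proof -
    obtain P Q where PQ: "bs 0 n [i] = P @ V @ Q" using N[OF n, of i] by (auto simp: sublist_def)
    have eq: "bs 0 n (i # w) = P @ V @ Q @ bs 0 n w"
      using substitution_Cons[OF subst_bs, of 0 n i w] PQ by simp
    have "bs 0 n (i # w @ [i]) = P @ (V @ Q @ bs 0 n w @ P @ V) @ Q"
      using substitution_append[OF subst_bs, of 0 n "i # w" "[i]"] eq PQ by simp
    then have "sublist (V @ Q @ bs 0 n w @ P @ V) (bs 0 n (i # w @ [i]))"
      by (metis sublist_appendI)
    then have "V @ Q @ bs 0 n w @ P @ V \<in> fac 0"
      using fac_subst[OF le0 w] fac_sublist by blast
    from S[OF this] have "f \<bullet> ab (bs 0 n (i # w)) + f \<bullet> ab V \<le> S"
      unfolding eq ab_append inner_add_right by linarith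
    then show ?thesis using V(2) by (simp add: ab_bs)
  qed
  then show ?thesis by blast
qed

lemma return_image_small:
  assumes "0 < e"
  shows "\<exists>N. \<forall>n\<ge>N. \<forall>i w. i # w @ [i] \<in> fac n \<longrightarrow> \<bar>proj 0 (A 0 n *v ab (i # w)) $ j\<bar> \<le> e"
proof -
  \<comment> \<open>\<open>f\<close> reads off coordinate \<open>j\<close> of \<open>proj 0\<close>,
    so it vanishes on \<open>u\<close>; the one-sided estimate is used for \<open>f\<close> and for
    \<open>- f\<close>.\<close>
  define f :: "real ^ 'a" where "f = axis j 1 - ut 0 $ j *\<^sub>R 1"
  have f: "f \<bullet> x = proj 0 x $ j" for x
    by (simp add: f_def inner_diff_left inner_axis' proj_def mult.commute)
  have "f \<bullet> u = 0" using proj_un[of 0] by (simp add: f un_0)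
  then have "(- f) \<bullet> u = 0" by simp
  obtain N1 where N1: "\<And>n i w. n \<ge> N1 \<Longrightarrow> i # w @ [i] \<in> fac n \<Longrightarrow> f \<bullet> (A 0 n *v ab (i # w)) \<le> e"
    using return_image_le[OF \<open>f \<bullet> u = 0\<close> assms] by blast
  obtain N2 where N2: "\<And>n i w. n \<ge> N2 \<Longrightarrow> i # w @ [i] \<in> fac n \<Longrightarrow> (- f) \<bullet> (A 0 n *v ab (i # w)) \<le> e"
    using return_image_le[OF \<open>(- f) \<bullet> u = 0\<close> assms] by blast
  show ?thesis
    using N1 N2 by (intro exI[of _ "max N1 N2"]) (force simp: f inner_minus_left abs_le_iff)
qed

text \<open>\<open>V\<close> occurs in the images of letters under a fixed initial block, and this
  block reappears at every \<open>nk k\<close> with \<open>k\<close> large.\<close>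

lemma fac_recurrent:
  assumes "V \<in> fac 0" shows "\<exists>k0. \<forall>k\<ge>k0. V \<in> fac (nk k)"
proof -
  obtain m where m: "\<And>a. sublist V (bs 0 m [a])" using fac_in_block[OF assms] by blast
  have "V \<in> fac (nk k)" if "k \<ge> m" for k
  proof -
    have "bs (nk k) (nk k + m) [undefined] = bs 0 m [undefined]"
      using bs_recurrent[of m k 0] that lk_ge[of k] by simp
    then show ?thesis using m fac_sublist block_in_fac[of "nk k" "nk k + m"] by (metis le_add1)
  qed
  then show ?thesis by blast
qed

text \<open>Long returns differ from a multiple of \<open>ut 0\<close> by a bounded vector. An
  integer vector orthogonal to all returns is therefore orthogonal to \<open>u\<close>, hence
  zero.\<close>

lemma span_returns: "span {ab (i # w) | w. i # w @ [i] \<in> fac 0} = UNIV"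
proof (rule span_int_vecs_eq_UNIV)
  fix x assume x: "int_vec x" "\<And>t. t \<in> {ab (i # w) | w. i # w @ [i] \<in> fac 0} \<Longrightarrow> x \<bullet> t = 0"
  obtain K where K: "\<And>V. V \<in> fac 0 \<Longrightarrow> norm (proj 0 (ab V)) \<le> K"
    using fac_bounded by blast
  have bound: "\<bar>x \<bullet> ut 0\<bar> * real c \<le> norm x * K" for c
  proof -
    obtain m where m: "real (c + 2) \<le> A 0 m $ i $ i" using A_eventually_ge[of 0 "real (c + 2)"] by blast
    then have "c + 2 \<le> count_list (bs 0 m [i]) i" by (simp only: block_matrix_nth of_nat_le_iff)
    then obtain w where w: "sublist (i # w @ [i]) (bs 0 m [i])" "c \<le> length w"
      using long_return by metis
    have w_fac: "i # w @ [i] \<in> fac 0" using w(1) block_in_fac fac_sublist by blast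
    then have "i # w \<in> fac 0" using fac_sublist by (metis append_Cons prefixI prefix_imp_sublist)
    have "x \<bullet> ab (i # w) = 0" using x(2) w_fac by blast
    then have "x \<bullet> proj 0 (ab (i # w)) = - (real (length (i # w)) * (x \<bullet> ut 0))"
      unfolding proj_def inner_one_ab by (simp add: inner_diff_right)
    then have "real (length (i # w)) * \<bar>x \<bullet> ut 0\<bar> = \<bar>x \<bullet> proj 0 (ab (i # w))\<bar>"
      by (simp only: abs_minus_cancel abs_mult abs_of_nat)
    also have "\<dots> \<le> norm x * norm (proj 0 (ab (i # w)))" by (rule Cauchy_Schwarz_ineq2)
    also have "\<dots> \<le> norm x * K" using K[OF \<open>i # w \<in> fac 0\<close>] by (intro mult_left_mono) auto
    finally have "real (length (i # w)) * \<bar>x \<bullet> ut 0\<bar> \<le> norm x * K" .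
    moreover have "real c * \<bar>x \<bullet> ut 0\<bar> \<le> real (length (i # w)) * \<bar>x \<bullet> ut 0\<bar>"
      using w(2) by (intro mult_right_mono) auto
    ultimately show ?thesis by (simp add: mult.commute)
  qed
  have "x \<bullet> ut 0 = 0"
  proof (rule ccontr)
    assume "x \<bullet> ut 0 \<noteq> 0"
    then obtain c :: nat where "norm x * K < real c * \<bar>x \<bullet> ut 0\<bar>"
      using reals_Archimedean3 by (metis zero_less_abs_iff)
    then show False using bound[of c] by (simp add: mult.commute)
  qed
  then have "x \<bullet> u = 0" using un_eq[of 0] by (metis inner_scaleR_right mult_zero_right un_0)
  then show "x = 0" using rational_independence x(1) by blast
qed (auto intro: int_vec_ab)

text \<open>The vectors with this property form a subspace. A return of level 0 is again a return at
  the levels \<open>nk k\<close>, so \<open>return_image_small\<close> puts it into the subspace,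
  and returns span.\<close>

lemma proj_A_nk_tendsto: "(\<lambda>k. proj 0 (A 0 (nk k) *v x)) \<longlonglongrightarrow> 0"
proof -
  define X where "X = {x. (\<lambda>k. proj 0 (A 0 (nk k) *v x)) \<longlonglongrightarrow> 0}"
  define i :: 'a where "i = undefined"
  have "subspace X"
    unfolding subspace_def X_def
    by (auto simp: matrix_vector_right_distrib proj_add matrix_vector_mult_scaleR proj_scale
        intro!: tendsto_eq_intros)
  moreover have "ab (i # w) \<in> X" if w: "i # w @ [i] \<in> fac 0" for w
  proof -
    obtain k0 where k0: "\<And>k. k \<ge> k0 \<Longrightarrow> i # w @ [i] \<in> fac (nk k)" using fac_recurrent[OF w] by blast
    have "(\<lambda>k. proj 0 (A 0 (nk k) *v ab (i # w)) $ j) \<longlonglongrightarrow> 0 $ j" for j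
    proof (rule LIMSEQ_I)
      fix e :: real assume "0 < e"
      then have "0 < e / 2" by simp
      from return_image_small[OF this] obtain N where N: "\<And>n w. n \<ge> N \<Longrightarrow> i # w @ [i] \<in> fac n \<Longrightarrow>
          \<bar>proj 0 (A 0 n *v ab (i # w)) $ j\<bar> \<le> e / 2" by blast
      have "norm (proj 0 (A 0 (nk k) *v ab (i # w)) $ j - 0 $ j) < e" if "k \<ge> max k0 N" for k
        using N[of "nk k" w] k0[of k] that nk_ge[of k] \<open>0 < e\<close> by simp
      then show "\<exists>no. \<forall>k\<ge>no. norm (proj 0 (A 0 (nk k) *v ab (i # w)) $ j - 0 $ j) < e"
        by blast
    qed
    then show ?thesis unfolding X_def by (auto intro: vec_tendstoI)
  qed
  ultimately have "span {ab (i # w) | w. i # w @ [i] \<in> fac 0} \<subseteq> X"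
    by (intro span_minimal) auto
  then show ?thesis using span_returns[of i] by (auto simp: X_def)
qed

text \<open>The contraction of the basis vectors becomes uniform over all factors, as their
  discrepancies at the levels \<open>nk k\<close> have a common bound.\<close>

lemma fac_nk_image_small:
  assumes "0 < \<epsilon>"
  shows "\<exists>k0. \<forall>k\<ge>k0. \<forall>V\<in>fac (nk k). norm (proj 0 (A 0 (nk k) *v ab V)) \<le> \<epsilon>"
proof -
  obtain K where K: "0 < K" "\<And>k V. V \<in> fac (nk k) \<Longrightarrow> norm (proj (nk k) (ab V)) \<le> K"
    using fac_nk_bounded by blast
  define e where "e = \<epsilon> / (real CARD('a) * K)"
  have e: "0 < e" using assms K(1) by (simp add: e_def)
  have "\<forall>\<^sub>F k in sequentially. \<forall>i\<in>(UNIV::'a set). norm (proj 0 (A 0 (nk k) *v axis i 1)) < e"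
    using tendstoD[OF proj_A_nk_tendsto e]
    by (intro eventually_ball_finite) (auto simp: dist_norm)
  then obtain k0 where k0: "\<And>k i. k \<ge> k0 \<Longrightarrow> norm (proj 0 (A 0 (nk k) *v axis i 1)) < e"
    by (auto simp: eventually_sequentially)
  have "norm (proj 0 (A 0 (nk k) *v ab V)) \<le> \<epsilon>" if "k \<ge> k0" "V \<in> fac (nk k)" for k V
  proof -
    have "norm (proj 0 (A 0 (nk k) *v ab V))
        = norm (proj 0 (A 0 (nk k) *v proj (nk k) (ab V)))"
      using proj_A[of 0 "nk k"] by simp
    also have "\<dots> \<le> real CARD('a) * e * norm (proj (nk k) (ab V))"
      using k0[OF that(1)] by (intro linear_axis_bound[OF linear_proj_A]) (auto intro: less_imp_le)
    also have "\<dots> \<le> real CARD('a) * e * K"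
      using K(2)[OF that(2)] e by (intro mult_left_mono) auto
    also have "\<dots> = \<epsilon>" using K(1) by (simp add: e_def)
    finally show ?thesis .
  qed
  then show ?thesis by blast
qed

text \<open>From the subsequence to all large \<open>n\<close>: a column of \<open>A 0 n\<close> is
  the \<open>A 0 (nk k)\<close> image of the abelianization of a factor of level
  \<open>nk k\<close>.\<close>

lemma column_small:
  assumes "0 < \<epsilon>" shows "\<exists>N. \<forall>n\<ge>N. \<forall>i. norm (proj 0 (A 0 n *v axis i 1)) \<le> \<epsilon>"
proof -
  obtain k where k: "\<And>V. V \<in> fac (nk k) \<Longrightarrow> norm (proj 0 (A 0 (nk k) *v ab V)) \<le> \<epsilon>"
    using fac_nk_image_small[OF assms] by blast
  have "norm (proj 0 (A 0 n *v axis i 1)) \<le> \<epsilon>" if "n \<ge> nk k" for n i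
    using k[OF block_in_fac[OF that]] A_split_app[of 0 "nk k" n] that
    by (simp add: A_column flip: ab_bs)
      (simp add: ab_bs A_split_app[of 0 "nk k" n])
  then show ?thesis by blast
qed

lemma column_lk_small:
  assumes "0 < \<epsilon>" shows "\<exists>k0. \<forall>k\<ge>k0. \<forall>i. norm (proj 0 (A 0 (lk k) *v axis i 1)) \<le> \<epsilon>"
  using column_small[OF assms] lk_ge by (meson order_trans)

lemma ut_nk_tendsto: "(\<lambda>k. ut (nk k)) \<longlonglongrightarrow> ut 0"
proof (rule LIMSEQ_I)
  fix e :: real assume e: "0 < e"
  have b: "0 < \<beta>" using \<beta>_ge_1 by simp
  define \<eta> where "\<eta> = e / (2 * \<beta>)"
  have "0 < \<eta>" using e b by (simp add: \<eta>_def)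
  then obtain k0 where k0: "\<And>k i. k \<ge> k0 \<Longrightarrow> norm (proj 0 (A 0 (lk k) *v axis i 1)) \<le> \<eta>"
    using column_lk_small by blast
  have "norm (ut (nk k) - ut 0) < e" if "k \<ge> k0" for k
  proof -
    have "norm (ut (nk k) - ut 0) * 1 \<le> norm (ut (nk k) - ut 0) * real (length (bs 0 (lk k) [undefined]))"
      using one_le_length_bs by (intro mult_left_mono) auto
    also have "\<dots> \<le> \<beta> * \<eta>" by (rule ut_nk_close[OF k0[OF that]])
    also have "\<dots> = e / 2" using b by (simp add: \<eta>_def)
    finally show ?thesis using e by simp
  qed
  then show "\<exists>no. \<forall>k\<ge>no. norm (ut (nk k) - ut 0) < e" by blast
qed

text \<open>A single depth \<open>l\<close> at which pieces are small both in the original sequence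
  and in its shifts by \<open>nk k\<close>, for all large \<open>k\<close>.\<close>

lemma uniform_small_level:
  assumes "0 < \<epsilon>"
  obtains l k0 where "\<And>V. V \<in> fac l \<Longrightarrow> norm (proj 0 (A 0 l *v ab V)) \<le> \<epsilon>"
    and "\<And>k. k \<ge> k0 \<Longrightarrow> l \<le> lk k"
    and "\<And>k w. k \<ge> k0 \<Longrightarrow> pre (nk k + l) w \<Longrightarrow> norm (proj (nk k) (A 0 l *v ab w)) \<le> \<epsilon>"
proof -
  have "0 < \<epsilon> / 2" using assms by simp
  then obtain K where K: "\<And>V. V \<in> fac (nk K) \<Longrightarrow> norm (proj 0 (A 0 (nk K) *v ab V)) \<le> \<epsilon> / 2"
    using fac_nk_image_small by blast
  \<comment> \<open>\<open>c\<close> collects the coefficients of \<eta> in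
    \<open>pre_nk_image_le\<close>; the other half of \<epsilon> is left for the level 0
    contribution.\<close>
  define c where "c = real CARD('a) * (1 + \<beta>) * (real CARD('a) * C) + \<beta>"
  have c: "0 < c" unfolding c_def using \<beta>_ge_1 C_pos
    by (intro add_nonneg_pos mult_nonneg_nonneg) auto
  define \<eta> where "\<eta> = \<epsilon> / (2 * c)"
  have \<eta>: "0 < \<eta>" "c * \<eta> = \<epsilon> / 2" using assms c by (auto simp: \<eta>_def)
  obtain k1 where k1: "\<And>k i. k \<ge> k1 \<Longrightarrow> norm (proj 0 (A 0 (lk k) *v axis i 1)) \<le> \<eta>"
    using column_lk_small[OF \<eta>(1)] by blast
  show thesis
  proof (rule that[of "nk K" "max k1 (nk K)"])
    show "norm (proj 0 (A 0 (nk K) *v ab V)) \<le> \<epsilon>" if "V \<in> fac (nk K)" for V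
      using K[OF that] assms by simp
    show le: "nk K \<le> lk k" if "k \<ge> max k1 (nk K)" for k
      using lk_ge[of k] that by simp
    show "norm (proj (nk k) (A 0 (nk K) *v ab w)) \<le> \<epsilon>"
      if "k \<ge> max k1 (nk K)" "pre (nk k + nk K) w" for k w
    proof -
      have "norm (proj (nk k) (A 0 (nk K) *v ab w))
        \<le> real CARD('a) * (\<eta> + \<beta> * \<eta>) * (real CARD('a) * C) + (\<epsilon> / 2 + \<beta> * \<eta>)"
        using k1 that K le by (intro pre_nk_image_le) auto
      also have "\<dots> = c * \<eta> + \<epsilon> / 2" by (simp add: c_def algebra_simps)
      finally show ?thesis using \<eta>(2) by simp
    qed
  qed
qed

end

section \<open>Cylinders and coverings\<close>

lemma det_Ints:
  fixes M :: "real ^ 'a::finite ^ 'a"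
  assumes "\<And>i j. M $ i $ j \<in> \<int>" shows "det M \<in> \<int>"
  unfolding det_def using assms by (intro Ints_sum Ints_mult Ints_prod) auto

text \<open>Cramer's rule with denominator 1 or -1.\<close>

lemma int_vec_preimage:
  fixes M :: "real ^ 'a::finite ^ 'a"
  assumes "\<And>i j. M $ i $ j \<in> \<int>" "\<bar>det M\<bar> = 1" "int_vec x"
  shows "\<exists>y. int_vec y \<and> M *v y = x"
proof -
  define y :: "real ^ 'a" where
    "y = (\<chi> k. det (\<chi> i j. if j = k then x $ i else M $ i $ j) / det M)"
  have "M *v y = x" using cramer[of M y x] assms(2) by (auto simp: y_def)
  moreover have "y $ k \<in> \<int>" for k
  proof -
    have "det (\<chi> i j. if j = k then x $ i else M $ i $ j) \<in> \<int>"
      using assms by (intro det_Ints) (auto simp: int_vec_def)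
    moreover have "det M = 1 \<or> det M = - 1" using assms(2) by linarith
    ultimately show ?thesis by (auto simp: y_def)
  qed
  ultimately show ?thesis by (auto simp: int_vec_def)
qed

lemma closure_finite_UN: "finite I \<Longrightarrow> closure (\<Union>i\<in>I. f i) = (\<Union>i\<in>I. closure (f i))"
  by (induction I rule: finite_induct) auto

context price
begin

section \<open>Cylinders, their subdivision and covering degrees\<close>

definition vn :: "nat \<Rightarrow> real ^ 'a" where "vn n = v v* A 0 n"

definition cyl :: "nat \<Rightarrow> 'a \<Rightarrow> (real ^ 'a) set" where
  "cyl n i = closure {ab p + t *\<^sub>R un n | p t. pre n (p @ [i])}"

text \<open>The occurrences of \<open>i\<close> in images of letters \<open>j\<close>, i.e. the
  edges of the prefix graph along which a cylinder is subdivided.\<close>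

definition pieces :: "nat \<Rightarrow> nat \<Rightarrow> 'a \<Rightarrow> ('a list \<times> 'a) set" where
  "pieces n m i = {(P, j). \<exists>r. bs n m [j] = P @ i # r}"

text \<open>The faces \<open>(x, i)\<close> of a discrete hyperplane: \<open>x\<close> is at height
  at least \<open>c\<close>, and one step back in direction \<open>i\<close> is below
  \<open>c\<close>.\<close>

definition Gam :: "nat \<Rightarrow> real \<Rightarrow> ((real ^ 'a) \<times> 'a) set" where
  "Gam n c = {(x, i). int_vec x \<and> c \<le> vn n \<bullet> x \<and> vn n \<bullet> x < c + vn n $ i}"

text \<open>The faces whose translated cylinders contain \<open>z\<close>; the cardinality is the
  covering degree.\<close>

definition Cov :: "nat \<Rightarrow> real \<Rightarrow> real ^ 'a \<Rightarrow> ((real ^ 'a) \<times> 'a) set" where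
  "Cov n c z = {(x, i). (x, i) \<in> Gam n c \<and> z - x \<in> cyl n i}"

lemma vn_0: "vn 0 = v"
  by (simp add: vn_def block_matrix_empty)

lemma vn_inner: "vn n \<bullet> x = v \<bullet> (A 0 n *v x)"
  by (simp add: vn_def dot_lmul_matrix)

lemma vn_inner_A: "n \<le> m \<Longrightarrow> vn n \<bullet> (A n m *v x) = vn m \<bullet> x"
  using A_split_app[of 0 n m x] by (simp add: vn_inner)

lemma vn_nth: "n \<le> m \<Longrightarrow> vn m $ j = vn n \<bullet> ab (bs n m [j])"
  using vn_inner_A[of n m "axis j 1"] by (simp add: A_column inner_axis)

lemma v_inner_ab_nonneg: "0 \<le> v \<bullet> ab w"
  unfolding inner_vec_def using v_nonneg by (intro sum_nonneg) (simp add: ab_nth)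

lemma vn_nonneg: "0 \<le> vn n $ i"
  using vn_nth[of 0 n i] v_inner_ab_nonneg by (simp add: vn_0)

lemma v_pos_letter: "\<exists>i. 0 < v $ i"
  using v_nonneg v_nonzero by (metis order_neq_le_trans vec_eq_iff zero_index)

lemma v_inner_u_pos: "0 < v \<bullet> u"
proof -
  obtain i where i: "0 < v $ i" using v_pos_letter by blast
  have "0 < v $ i * u $ i" using i un_pos[of 0 i] by (simp add: un_0)
  also have "\<dots> \<le> v \<bullet> u"
    unfolding inner_vec_def using v_nonneg un_pos[THEN less_imp_le, of 0]
    by (simp add: un_0 member_le_sum[of i UNIV "\<lambda>i. v $ i * u $ i"])
  finally show ?thesis .
qed

lemma vn_inner_un: "vn n \<bullet> un n = v \<bullet> u"
  by (simp add: vn_inner A_un_0)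

lemma vn_inner_ut_pos: "0 < vn n \<bullet> ut n"
  using vn_inner_un[of n] v_inner_u_pos sum_un_pos[of n] by (simp add: ut_def)

lemma finite_pieces: "finite (pieces n m i)"
proof -
  have "pieces n m i \<subseteq> (\<Union>j. {P. prefix P (bs n m [j])}) \<times> UNIV"
    by (auto simp: pieces_def prefix_def)
  moreover have "finite (\<Union>j. {P. prefix P (bs n m [j])})"
    by (simp flip: set_prefixes_eq)
  ultimately show ?thesis by (meson finite_SigmaI finite_subset finite)
qed

text \<open>Desubstitution and resubstitution give this equation for the generating sets, the axes
  matching by \<open>A n m *v un m = un n\<close>. Closure commutes with the finite union and with
  injective affine maps.\<close>

lemma cyl_eq:
  assumes "n \<le> m"
  shows "cyl n i = (\<Union>(P, j)\<in>pieces n m i. (\<lambda>x. ab P + A n m *v x) ` cyl m j)"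
proof -
  define S where "S n i = {ab p + t *\<^sub>R un n | p t. pre n (p @ [i])}" for n i
  define T where "T Pj = (\<lambda>x. ab (fst Pj) + A n m *v x) ` S m (snd Pj)" for Pj :: "'a list \<times> 'a"
  have S: "cyl n i = closure (S n i)" for n i by (simp add: cyl_def S_def)
  have "S n i = (\<Union>Pj\<in>pieces n m i. T Pj)"
  proof (intro subset_antisym subsetI)
    fix x assume "x \<in> S n i"
    then obtain p t where p: "x = ab p + t *\<^sub>R un n" "pre n (p @ [i])"
      by (auto simp: S_def)
    obtain q j p' r where q: "pre m (q @ [j])" "p = bs n m q @ p'" "bs n m [j] = p' @ i # r"
      using pre_desubst[OF assms p(2)] .
    have "x = ab p' + A n m *v (ab q + t *\<^sub>R un m)"
      by (simp add: p(1) q(2) ab_append ab_bs matrix_vector_right_distrib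
          matrix_vector_mult_scaleR A_un[OF assms])
    moreover have "ab q + t *\<^sub>R un m \<in> S m j" using q(1) by (auto simp: S_def)
    moreover have "(p', j) \<in> pieces n m i" using q(3) by (auto simp: pieces_def)
    ultimately show "x \<in> (\<Union>Pj\<in>pieces n m i. T Pj)" by (force simp: T_def)
  next
    fix x assume "x \<in> (\<Union>Pj\<in>pieces n m i. T Pj)"
    then obtain P j r q t where *: "bs n m [j] = P @ i # r" "pre m (q @ [j])"
      "x = ab P + A n m *v (ab q + t *\<^sub>R un m)"
      by (auto simp: pieces_def T_def S_def)
    have "x = ab (bs n m q @ P) + t *\<^sub>R un n"
      by (simp add: *(3) ab_append ab_bs matrix_vector_right_distrib
          matrix_vector_mult_scaleR A_un[OF assms])
    moreover have "pre n ((bs n m q @ P) @ [i])" using pre_resubst[OF assms *(2,1)] by simp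
    ultimately show "x \<in> S n i" unfolding S_def by blast
  qed
  then have "cyl n i = (\<Union>Pj\<in>pieces n m i. closure (T Pj))"
    by (simp add: S closure_finite_UN finite_pieces)
  moreover have "closure (T (P, j)) = (\<lambda>x. ab P + A n m *v x) ` cyl m j" for P j
  proof -
    have "T (P, j) = (+) (ab P) ` ((*v) (A n m) ` S m j)"
      by (simp add: T_def image_image)
    moreover have "closure ((*v) (A n m) ` S m j) = (*v) (A n m) ` cyl m j"
      using closure_injective_linear_image[OF matrix_vector_mul_linear, of "A n m" "S m j"]
        inj_matrix_vector_mult[OF A_invertible] by (simp add: S)
    ultimately have "closure (T (P, j)) = (+) (ab P) ` ((*v) (A n m) ` cyl m j)"
      by (simp only: closure_translation)
    then show ?thesis by (simp add: image_image)
  qed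
  then have "closure (T Pj) = (\<lambda>x. ab (fst Pj) + A n m *v x) ` cyl m (snd Pj)" for Pj
    by (metis prod.collapse)
  ultimately show ?thesis by (simp add: case_prod_beta')
qed

lemma closed_cyl: "closed (cyl n i)"
  by (simp add: cyl_def)

lemma cyl_translate: "x \<in> cyl n i \<Longrightarrow> x + t *\<^sub>R un n \<in> cyl n i"
proof -
  define S where "S = {ab p + t *\<^sub>R un n | p t. pre n (p @ [i])}"
  assume "x \<in> cyl n i"
  then have "x \<in> closure S" by (simp add: cyl_def S_def)
  then have "t *\<^sub>R un n + x \<in> closure ((+) (t *\<^sub>R un n) ` S)" by (auto simp: closure_translation)
  moreover have "(+) (t *\<^sub>R un n) ` S \<subseteq> S"
  proof clarify
    fix x assume "x \<in> S"
    then obtain p s where "x = ab p + s *\<^sub>R un n" "pre n (p @ [i])" by (auto simp: S_def)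
    then have "t *\<^sub>R un n + x = ab p + (t + s) *\<^sub>R un n \<and> pre n (p @ [i])"
      by (simp add: algebra_simps)
    then show "t *\<^sub>R un n + x \<in> S" unfolding S_def by blast
  qed
  ultimately have "t *\<^sub>R un n + x \<in> closure S" using closure_mono by blast
  then show ?thesis by (simp add: cyl_def S_def add.commute)
qed

lemma mem_cyl: "pre n (p @ [i]) \<Longrightarrow> ab p + t *\<^sub>R un n \<in> cyl n i"
  unfolding cyl_def by (rule subsetD[OF closure_subset]) blast

text \<open>A linear map that vanishes on the axis sees only the prefixes, and the bound is a closed
  condition.\<close>

lemma cyl_linear_bound:
  fixes g :: "real ^ 'a \<Rightarrow> real ^ 'a"
  assumes "linear g" "g (un n) = 0" "\<And>p. pre n (p @ [i]) \<Longrightarrow> norm (g (ab p)) \<le> K"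
    and "x \<in> cyl n i"
  shows "norm (g x) \<le> K"
proof -
  have "continuous_on UNIV (\<lambda>x. norm (g x))"
    using assms(1) by (intro continuous_intros linear_continuous_on linear_conv_bounded_linear[THEN iffD1])
  then have "closed {x. norm (g x) \<le> K}"
    by (intro closed_Collect_le continuous_on_const)
  moreover have "{ab p + t *\<^sub>R un n | p t. pre n (p @ [i])} \<subseteq> {x. norm (g x) \<le> K}"
    using assms(3) by (auto simp: linear_add[OF assms(1)] linear_scale[OF assms(1)] assms(2))
  ultimately show ?thesis using assms(4) closure_minimal unfolding cyl_def by blast
qed

lemma cyl_proj_bound:
  assumes "\<And>V. V \<in> fac n \<Longrightarrow> norm (proj n (ab V)) \<le> K" "x \<in> cyl n i"
  shows "norm (proj n x) \<le> K"
proof (rule cyl_linear_bound[OF linear_proj proj_un _ assms(2)])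
  fix p assume "pre n (p @ [i])"
  then have "p \<in> fac n" using pre_prefix[of n "p @ [i]" p] pre_imp_fac by simp
  then show "norm (proj n (ab p)) \<le> K" by (rule assms(1))
qed

definition \<kappa> :: real where "\<kappa> = 1 + norm (1 :: real ^ 'a)"

lemma norm_proj_le: "norm (proj n x) \<le> \<kappa> * norm x"
proof -
  have "norm (proj n x) \<le> norm x + \<bar>1 \<bullet> x\<bar> * norm (ut n)"
    unfolding proj_def by (intro order_trans[OF norm_triangle_ineq4]) simp
  also have "\<bar>1 \<bullet> x\<bar> * norm (ut n) \<le> (norm (1 :: real ^ 'a) * norm x) * 1"
    using norm_ut_le Cauchy_Schwarz_ineq2 by (intro mult_mono) auto
  finally show ?thesis by (simp add: \<kappa>_def algebra_simps)
qed

lemma \<kappa>_pos: "0 < \<kappa>"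
  by (simp add: \<kappa>_def add_pos_nonneg)

lemma cyl_approx:
  assumes "x \<in> cyl n i" "0 < \<epsilon>"
  obtains p where "pre n (p @ [i])" "norm (proj n (x - ab p)) < \<epsilon>"
proof -
  have "0 < \<epsilon> / \<kappa>" using assms(2) \<kappa>_pos by simp
  then obtain p t where p: "pre n (p @ [i])" "dist (ab p + t *\<^sub>R un n) x < \<epsilon> / \<kappa>"
    using assms(1) unfolding cyl_def closure_approachable by blast
  have "proj n (x - ab p) = proj n (x - (ab p + t *\<^sub>R un n))"
    by (simp add: proj_diff proj_add proj_scale)
  also have "norm \<dots> \<le> \<kappa> * norm (x - (ab p + t *\<^sub>R un n))" by (rule norm_proj_le)
  also have "\<dots> < \<kappa> * (\<epsilon> / \<kappa>)"
    using p(2) \<kappa>_pos by (intro mult_strict_left_mono) (auto simp: dist_norm norm_minus_commute)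
  finally show thesis using that[OF p(1)] \<kappa>_pos by simp
qed

text \<open>The projection loses only the position along the axis, which any functional positive on
  the axis recovers. This makes the intersection of a cylinder with a slab bounded.\<close>

lemma norm_le_of_proj:
  assumes "0 < k" "k \<le> w \<bullet> ut n" "norm (proj n x) \<le> P" "\<bar>w \<bullet> x\<bar> \<le> Q"
  shows "norm x \<le> P + (Q + norm w * P) / k"
proof -
  define s where "s = 1 \<bullet> x"
  have x: "x = proj n x + s *\<^sub>R ut n" unfolding s_def by (rule proj_decomp)
  have "w \<bullet> x = w \<bullet> proj n x + s * (w \<bullet> ut n)"
    by (subst x) (simp add: inner_add_right)
  then have "\<bar>s\<bar> * (w \<bullet> ut n) = \<bar>w \<bullet> x - w \<bullet> proj n x\<bar>"
    using assms(1,2) by (simp add: abs_mult)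
  also have "\<dots> \<le> \<bar>w \<bullet> x\<bar> + \<bar>w \<bullet> proj n x\<bar>" by (rule abs_triangle_ineq4)
  also have "\<bar>w \<bullet> proj n x\<bar> \<le> norm w * norm (proj n x)" by (rule Cauchy_Schwarz_ineq2)
  also have "\<dots> \<le> norm w * P" using assms(3) by (intro mult_left_mono) auto
  finally have "\<bar>s\<bar> * (w \<bullet> ut n) \<le> Q + norm w * P" using assms(4) by linarith
  moreover have "\<bar>s\<bar> * k \<le> \<bar>s\<bar> * (w \<bullet> ut n)" using assms(2) by (intro mult_left_mono) auto
  ultimately have "\<bar>s\<bar> \<le> (Q + norm w * P) / k" using assms(1) by (simp add: pos_le_divide_eq)
  moreover have "norm x \<le> norm (proj n x) + \<bar>s\<bar> * norm (ut n)"
    by (subst x) (intro order_trans[OF norm_triangle_ineq], simp)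
  moreover have "\<bar>s\<bar> * norm (ut n) \<le> \<bar>s\<bar> * 1" using norm_ut_le by (intro mult_left_mono) auto
  ultimately show ?thesis using assms(3) by linarith
qed

lemma finite_near:
  "finite {(x, i). int_vec x \<and> \<bar>vn n \<bullet> x\<bar> \<le> Q \<and> (\<exists>z. norm z \<le> R \<and> z - x \<in> cyl n i)}"
proof -
  obtain K where K: "\<And>V. V \<in> fac n \<Longrightarrow> norm (proj n (ab V)) \<le> K"
    using fac_bounded by blast
  define P where "P = \<kappa> * R + K"
  define X where "X = {x :: real ^ 'a. int_vec x \<and> norm x \<le> P + (Q + norm (vn n) * P) / (vn n \<bullet> ut n)}"
  have "x \<in> X" if x: "int_vec x" "\<bar>vn n \<bullet> x\<bar> \<le> Q" "norm z \<le> R" "z - x \<in> cyl n i" for x z i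
  proof -
    have "proj n x = proj n z - proj n (z - x)" by (simp add: proj_diff)
    then have "norm (proj n x) \<le> norm (proj n z) + norm (proj n (z - x))"
      by (metis norm_triangle_ineq4)
    also have "\<dots> \<le> \<kappa> * R + K"
      using cyl_proj_bound[OF K x(4)] norm_proj_le[of n z] x(3) \<kappa>_pos
      by (intro add_mono) (auto intro: order_trans mult_left_mono)
    finally have "norm (proj n x) \<le> P" by (simp add: P_def)
    then show ?thesis
      using norm_le_of_proj[OF vn_inner_ut_pos order_refl] x by (simp add: X_def)
  qed
  then have "{(x, i). int_vec x \<and> \<bar>vn n \<bullet> x\<bar> \<le> Q \<and> (\<exists>z. norm z \<le> R \<and> z - x \<in> cyl n i)} \<subseteq> X \<times> UNIV"
    by auto
  moreover have "finite X" unfolding X_def by (rule finite_int_vec_ball)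
  ultimately show ?thesis by (meson finite_SigmaI finite_subset finite)
qed

lemma Gam_bound: "(x, i) \<in> Gam n c \<Longrightarrow> \<bar>vn n \<bullet> x\<bar> \<le> \<bar>c\<bar> + (\<Sum>i\<in>UNIV. vn n $ i)"
  using member_le_sum[of i UNIV "\<lambda>i. vn n $ i"] vn_nonneg[of n]
  by (auto simp: Gam_def sum_nonneg abs_le_iff)

lemma finite_Gam_near: "finite {(x, i). (x, i) \<in> Gam n c \<and> (\<exists>z. norm z \<le> R \<and> z - x \<in> cyl n i)}"
  by (rule finite_subset[OF _ finite_near[of n "\<bar>c\<bar> + (\<Sum>i\<in>UNIV. vn n $ i)" R]])
    (use Gam_bound in \<open>auto simp: Gam_def\<close>)

lemma finite_Cov: "finite (Cov n c z)"
  by (rule finite_subset[OF _ finite_Gam_near[of n c "norm z"]]) (auto simp: Cov_def)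

text \<open>A face \<open>(x, i)\<close> at level 0 is sent to the level \<open>n\<close> face of
  the piece containing the point: \<open>P @ [i]\<close> is a prefix of the image of
  \<open>j\<close>, and \<open>x + ab P\<close> has an integer preimage by unimodularity.\<close>

lemma card_Cov_le: "card (Cov 0 c (A 0 n *v y)) \<le> card (Cov n c y)"
proof (rule card_le_if_inj_on_rel[where r = "\<lambda>(x, i) (y', j). \<exists>P r. bs 0 n [j] = P @ i # r
      \<and> A 0 n *v y' = x + ab P"])
  show "finite (Cov n c y)" by (rule finite_Cov)
next
  fix a assume a: "a \<in> Cov 0 c (A 0 n *v y)"
  obtain x i where [simp]: "a = (x, i)" by (cases a)
  have x: "int_vec x" "c \<le> v \<bullet> x" "v \<bullet> x < c + v $ i" and cyl: "A 0 n *v y - x \<in> cyl 0 i"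
    using a by (auto simp: Cov_def Gam_def vn_0)
  obtain P j r w where P: "bs 0 n [j] = P @ i # r" "w \<in> cyl n j"
    "A 0 n *v y - x = ab P + A 0 n *v w"
    using cyl unfolding cyl_eq[OF le0, of i n] by (auto simp: pieces_def)
  obtain y' where y': "int_vec y'" "A 0 n *v y' = x + ab P"
    using int_vec_preimage[OF _ abs_det_A int_vec_add[OF x(1) int_vec_ab]]
    by (metis Ints_of_nat block_matrix_nth)
  have "A 0 n *v y = A 0 n *v (y' + w)"
    using P(3) y'(2) by (simp add: matrix_vector_right_distrib algebra_simps)
  then have "y - y' = w" using A_inj by (metis add_diff_cancel_left')
  then have "y - y' \<in> cyl n j" using P(2) by simp
  moreover have "vn n \<bullet> y' = v \<bullet> x + v \<bullet> ab P"
    by (simp add: vn_inner y'(2) inner_add_right)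
  moreover have "vn n $ j = v \<bullet> ab P + v $ i + v \<bullet> ab r"
    using vn_nth[of 0 n j]
    by (simp add: vn_0 P(1) ab_append ab_Cons inner_add_right inner_axis)
  ultimately have "(y', j) \<in> Cov n c y"
    using x y'(1) v_inner_ab_nonneg[of P] v_inner_ab_nonneg[of r]
    by (auto simp: Cov_def Gam_def)
  then show "\<exists>b. b \<in> Cov n c y \<and> (case a of (x, i) \<Rightarrow> \<lambda>(y', j). \<exists>P r. bs 0 n [j] = P @ i # r
      \<and> A 0 n *v y' = x + ab P) b"
    using P(1) y'(2) by (intro exI[of _ "(y', j)"]) auto
next
  fix a1 a2 b
  assume a: "a1 \<in> Cov 0 c (A 0 n *v y)" "a2 \<in> Cov 0 c (A 0 n *v y)"
    and "(case a1 of (x, i) \<Rightarrow> \<lambda>(y', j). \<exists>P r. bs 0 n [j] = P @ i # r \<and> A 0 n *v y' = x + ab P) b"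
    and "(case a2 of (x, i) \<Rightarrow> \<lambda>(y', j). \<exists>P r. bs 0 n [j] = P @ i # r \<and> A 0 n *v y' = x + ab P) b"
  then obtain x i x' i' y' j P r P' r' where [simp]: "a1 = (x, i)" "a2 = (x', i')" "b = (y', j)"
    and P: "bs 0 n [j] = P @ i # r" "A 0 n *v y' = x + ab P"
    and P': "bs 0 n [j] = P' @ i' # r'" "A 0 n *v y' = x' + ab P'"
    by (cases a1, cases a2, cases b) auto
  have G: "c \<le> v \<bullet> x" "v \<bullet> x < c + v $ i" "c \<le> v \<bullet> x'" "v \<bullet> x' < c + v $ i'"
    using a by (auto simp: Cov_def Gam_def vn_0)
  \<comment> \<open>Injectivity: along the image of one letter the height \<open>c\<close> is
    crossed only once. If \<open>P2\<close> extended \<open>P1 @ [i1]\<close>, then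
    \<open>x1\<close> would be at least one step \<open>i1\<close> above \<open>x2\<close>, hence at
    height \<open>c + v $ i1\<close> or more.\<close>
  have le: "length P2 \<le> length P1"
    if "P1 @ i1 # r1 = P2 @ i2 # r2" "x1 + ab P1 = x2 + ab P2"
      "v \<bullet> x1 < c + v $ i1" "c \<le> v \<bullet> x2" for P1 P2 r1 r2 :: "'a list" and i1 i2 x1 x2
  proof (rule ccontr)
    assume "\<not> ?thesis"
    then have "length P1 < length P2" by simp
    moreover have "prefix (P1 @ [i1]) (P2 @ i2 # r2)"
      unfolding that(1)[symmetric] by (simp add: prefix_def)
    ultimately have "prefix (P1 @ [i1]) P2"
      using prefix_length_prefix[of "P1 @ [i1]" "P2 @ i2 # r2" P2] by simp
    then obtain s where s: "P2 = P1 @ i1 # s" by (auto simp: prefix_def)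
    have "x1 = x2 + (axis i1 1 + ab s)"
      using that(2) by (simp add: s ab_append ab_Cons algebra_simps)
    then have "v \<bullet> x1 = v \<bullet> x2 + v $ i1 + v \<bullet> ab s"
      by (simp add: inner_add_right inner_axis)
    then show False using that(3,4) v_inner_ab_nonneg[of s] by linarith
  qed
  have "length P = length P'"
  proof (rule antisym)
    show "length P \<le> length P'"
      by (rule le[of P' i' r' P i r x' x]) (use P P' G in simp_all)
    show "length P' \<le> length P"
      by (rule le[of P i r P' i' r' x x']) (use P P' G in simp_all)
  qed
  then have "P = P'" "i = i'" using P(1) P'(1) by auto
  then show "a1 = a2" using P(2) P'(2) by simp
qed

section \<open>Approximation along the axis and the covering property\<close>

lemma norm_less_of_components:
  fixes x :: "real ^ 'a"
  assumes "\<And>j. \<bar>x $ j\<bar> < e / real CARD('a)" shows "norm x < e"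
proof -
  have "norm x \<le> (\<Sum>j\<in>UNIV. \<bar>x $ j\<bar>)" by (rule norm_le_l1_cart)
  also have "\<dots> < (\<Sum>j\<in>(UNIV :: 'a set). e / real CARD('a))"
    using assms by (intro sum_strict_mono) auto
  finally show ?thesis by simp
qed

lemma int_vec_near_ray:
  assumes "0 < e" obtains x t where "int_vec x" "norm (x - t *\<^sub>R u) < e" "M \<le> v \<bullet> x"
proof -
  obtain b g where g: "\<And>j::'a. g j < CARD('a)" "\<And>j. b (g j) = j" using letter_enumeration by metis
  \<comment> \<open>Already \<open>q = 1\<close> gives height at least \<open>M\<close>, after
    allowing for the error \<open>norm v * e\<close>.\<close>
  define T where "T = (\<bar>M\<bar> + norm v * e) / (v \<bullet> u)"
  have T: "0 \<le> T" "T * (v \<bullet> u) = \<bar>M\<bar> + norm v * e"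
    using v_inner_u_pos assms by (auto simp: T_def)
  obtain N :: nat where N: "1 / real N < e / real CARD('a)" "0 < N"
    using assms real_arch_inverse[of "e / real CARD('a)"] by (auto simp: inverse_eq_divide)
  obtain q p where q: "0 < q" "\<And>i. i < CARD('a) \<Longrightarrow> \<bar>of_int q * (T * u $ b i) - of_int (p i)\<bar> < 1 / real N"
    using Dirichlet_approx_simult[of N "CARD('a)" "\<lambda>i. T * u $ b i"] N(2) by metis
  define x :: "real ^ 'a" where "x = (\<chi> j. of_int (p (g j)))"
  have near: "norm (x - (of_int q * T) *\<^sub>R u) < e"
  proof (rule norm_less_of_components)
    fix j show "\<bar>(x - (of_int q * T) *\<^sub>R u) $ j\<bar> < e / real CARD('a)"
      using q(2)[OF g(1)[of j]] N(1) by (simp add: x_def g(2) abs_minus_commute mult.assoc)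
  qed
  have "v \<bullet> x = of_int q * (T * (v \<bullet> u)) + v \<bullet> (x - (of_int q * T) *\<^sub>R u)"
    by (simp add: inner_diff_right)
  moreover have "\<bar>v \<bullet> (x - (of_int q * T) *\<^sub>R u)\<bar> \<le> norm v * e"
    using near by (intro order_trans[OF Cauchy_Schwarz_ineq2] mult_left_mono) auto
  moreover have "1 * (T * (v \<bullet> u)) \<le> of_int q * (T * (v \<bullet> u))"
    using q(1) T(1) v_inner_u_pos by (intro mult_right_mono mult_nonneg_nonneg) auto
  ultimately have "M \<le> v \<bullet> x" using T(2) by linarith
  moreover have "int_vec x" by (simp add: int_vec_def x_def)
  ultimately show thesis using that near by blast
qed

text \<open>Kronecker's theorem in continuous time: as the coordinates of \<open>u\<close> are
  rationally independent, the line spanned by \<open>u\<close> is dense modulo integer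
  vectors.\<close>

lemma int_vec_near_line:
  assumes "0 < e" obtains x t where "int_vec x" "norm (z - x - t *\<^sub>R u) < e"
proof -
  obtain b g where g: "\<And>j::'a. g j < CARD('a)" "\<And>j. b (g j) = j"
    and b: "bij_betw b {..<CARD('a)} UNIV" using letter_enumeration by metis
  \<comment> \<open>Independence is formulated for the set of values, so the coordinates must also
    be distinct; this is \<open>rational_independence\<close> for a difference of two basis
    vectors.\<close>
  have inj_u: "i = j" if "u $ i = u $ j" for i j
  proof (rule ccontr)
    assume "i \<noteq> j"
    define x :: "real ^ 'a" where "x = axis i 1 - axis j 1"
    have "int_vec x" by (auto simp: x_def int_vec_def axis_def)
    moreover have "x \<bullet> u = 0" using that by (simp add: x_def inner_diff_left inner_axis')
    ultimately have "x = 0" by (rule rational_independence)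
    then have "x $ i = 0" by simp
    then show False using \<open>i \<noteq> j\<close> by (simp add: x_def axis_def)
  qed
  let ?th = "\<lambda>i. u $ b i"
  have inj: "inj_on ?th {..<CARD('a)}"
    using b inj_u by (auto simp: inj_on_def bij_betw_def)
  interpret Z: module "\<lambda>r. (*) (real_of_int r)"
    by unfold_locales (auto simp: algebra_simps)
  have "Z.independent (?th ` {..<CARD('a)})"
  proof
    assume "Z.dependent (?th ` {..<CARD('a)})"
    then obtain f k where f: "k \<in> ?th ` {..<CARD('a)}" "f k \<noteq> 0"
      "(\<Sum>k\<in>?th ` {..<CARD('a)}. real_of_int (f k) * k) = 0"
      by (subst (asm) Z.dependent_finite) auto
    define x :: "real ^ 'a" where "x = (\<chi> j. of_int (f (u $ j)))"
    have "x \<bullet> u = (\<Sum>j\<in>UNIV. real_of_int (f (u $ j)) * u $ j)" by (simp add: x_def inner_vec_def)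
    also have "\<dots> = (\<Sum>i<CARD('a). real_of_int (f (?th i)) * ?th i)"
      by (rule sum.reindex_bij_betw[OF b, symmetric])
    also have "\<dots> = 0" using f(3) by (simp add: sum.reindex[OF inj])
    finally have "x = 0" by (intro rational_independence) (auto simp: int_vec_def x_def)
    then have "f (u $ j) = 0" for j by (simp add: x_def vec_eq_iff)
    then show False using f(1,2) by auto
  qed
  then obtain t p where tp: "\<And>i. i < CARD('a) \<Longrightarrow> \<bar>t * ?th i - of_int (p i) - (- z $ b i)\<bar> < e / real CARD('a)"
    using Kronecker_thm_1[of ?th "CARD('a)" "e / real CARD('a)" "\<lambda>i. - z $ b i"] inj assms
    by (metis divide_pos_pos of_nat_0_less_iff zero_less_card_finite)
  define x :: "real ^ 'a" where "x = (\<chi> j. of_int (p (g j)))"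
  have "norm (z - x - (- t) *\<^sub>R u) < e"
  proof (rule norm_less_of_components)
    fix j show "\<bar>(z - x - (- t) *\<^sub>R u) $ j\<bar> < e / real CARD('a)"
      using tp[OF g(1)[of j]] by (simp add: x_def g(2) algebra_simps)
  qed
  moreover have "int_vec x" by (simp add: int_vec_def x_def)
  ultimately show thesis using that by blast
qed

text \<open>An integer point close to the line through \<open>z\<close> may lie too low. Adding an
  integer point close to the ray of \<open>u\<close> raises it and hardly moves it off the
  line.\<close>

lemma half_space_dense:
  assumes "0 < e" obtains x t where "int_vec x" "c \<le> v \<bullet> x" "norm (z - (x + t *\<^sub>R u)) < e"
proof -
  have e2: "0 < e / 2" using assms by simp
  obtain x1 t1 where 1: "int_vec x1" "norm (z - x1 - t1 *\<^sub>R u) < e / 2"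
    using int_vec_near_line[OF e2] .
  obtain x2 t2 where 2: "int_vec x2" "norm (x2 - t2 *\<^sub>R u) < e / 2" "c - v \<bullet> x1 \<le> v \<bullet> x2"
    using int_vec_near_ray[OF e2] .
  have eq: "z - (x1 + x2 + (t1 - t2) *\<^sub>R u) = (z - x1 - t1 *\<^sub>R u) - (x2 - t2 *\<^sub>R u)"
    by (simp add: algebra_simps)
  have "norm (z - (x1 + x2 + (t1 - t2) *\<^sub>R u)) < e"
    unfolding eq using norm_triangle_ineq4[of "z - x1 - t1 *\<^sub>R u" "x2 - t2 *\<^sub>R u"] 1(2) 2(2) by linarith
  moreover have "int_vec (x1 + x2)" using 1 2 int_vec_add by blast
  moreover have "c \<le> v \<bullet> (x1 + x2)" using 2(3) by (simp add: inner_add_right)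
  ultimately show thesis using that by blast
qed

lemma prefix_crossing:
  assumes "0 \<le> s" "s < v \<bullet> ab w"
  shows "\<exists>p i. prefix (p @ [i]) w \<and> v \<bullet> ab p \<le> s \<and> s < v \<bullet> ab (p @ [i])"
  using assms(2)
proof (induction w rule: rev_induct)
  case Nil
  then show ?case using assms(1) by simp
next
  case (snoc a w)
  show ?case
  proof (cases "s < v \<bullet> ab w")
    case True
    then show ?thesis using snoc.IH by (metis prefix_append)
  next
    case False
    then show ?thesis using snoc.prems by (intro exI[of _ w] exI[of _ a]) simp
  qed
qed

text \<open>Descend from \<open>x\<close> along a prefix of a limit word until the next letter would
  lead below height \<open>c\<close>.\<close>

lemma half_space_decomposition:
  assumes "int_vec x" "c \<le> v \<bullet> x"
  obtains y i p where "(y, i) \<in> Gam 0 c" "pre 0 (p @ [i])" "x = y + ab p"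
proof -
  obtain i0 where i0: "0 < v $ i0" using v_pos_letter by blast
  \<comment> \<open>Coordinates of \<open>v\<close> may vanish, so the height gained is guaranteed
    by \<open>K\<close> occurrences of a letter \<open>i0\<close> of positive weight.\<close>
  define K where "K = (v \<bullet> x - c + 1) / v $ i0"
  obtain m where m: "\<And>i j. K \<le> A 0 m $ i $ j" using A_eventually_ge[of 0 K] by blast
  obtain a where a: "pre m [a]" using pre_extend[OF pre_Nil] by (metis append_Nil)
  have "v \<bullet> x - c + 1 = v $ i0 * K" using i0 by (simp add: K_def)
  also have "\<dots> \<le> v $ i0 * A 0 m $ i0 $ a" using m i0 by (intro mult_left_mono) auto
  also have "\<dots> \<le> v \<bullet> ab (bs 0 m [a])"
    unfolding inner_vec_def using v_nonneg
      member_le_sum[of i0 UNIV "\<lambda>i. v $ i * ab (bs 0 m [a]) $ i"]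
    by (simp add: ab_nth block_matrix_nth)
  finally have "v \<bullet> x - c < v \<bullet> ab (bs 0 m [a])" by simp
  with assms(2) obtain p i where p: "prefix (p @ [i]) (bs 0 m [a])"
    "v \<bullet> ab p \<le> v \<bullet> x - c" "v \<bullet> x - c < v \<bullet> ab (p @ [i])"
    using prefix_crossing[of "v \<bullet> x - c" "bs 0 m [a]"] by auto
  have "pre 0 (p @ [i])" using pre_prefix[OF pre_subst[OF le0 a] p(1)] .
  moreover have "(x - ab p, i) \<in> Gam 0 c"
    using p(2,3) int_vec_diff[OF assms(1) int_vec_ab]
    by (auto simp: Gam_def vn_0 inner_diff_right ab_append ab_Cons
        inner_add_right inner_axis)
  ultimately show thesis using that[of "x - ab p" i p] by simp
qed

text \<open>By local finiteness the covered points near \<open>z\<close> form a closed set, and they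
  include all nearby points \<open>x + t *\<^sub>R u\<close> with \<open>x\<close> an integer vector
  at height at least \<open>c\<close>, which are dense.\<close>

lemma Cov_nonempty: "Cov 0 c z \<noteq> {}"
proof
  assume empty: "Cov 0 c z = {}"
  define F where "F = {(x, i). (x, i) \<in> Gam 0 c \<and> (\<exists>y. norm y \<le> norm z + 1 \<and> y - x \<in> cyl 0 i)}"
  define U where "U = (\<Union>(x, i)\<in>F. (+) x ` cyl 0 i)"
  have "finite F" unfolding F_def by (rule finite_Gam_near)
  then have "closed U" unfolding U_def using closed_cyl closed_translation by (intro closed_UN) auto
  moreover have "z \<notin> U"
  proof
    assume "z \<in> U"
    then obtain x i y where "(x, i) \<in> F" "y \<in> cyl 0 i" "z = x + y" by (auto simp: U_def)
    then have "(x, i) \<in> Cov 0 c z" by (auto simp: Cov_def F_def)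
    then show False using empty by simp
  qed
  ultimately obtain e where e: "0 < e" "\<And>y. dist y z < e \<Longrightarrow> y \<notin> U"
    by (metis Compl_iff closed_def open_dist)
  have "0 < min e 1" using e(1) by simp
  from half_space_dense[OF this] obtain x t where x: "int_vec x" "c \<le> v \<bullet> x"
    "norm (z - (x + t *\<^sub>R u)) < min e 1" .
  obtain y i p where y: "(y, i) \<in> Gam 0 c" "pre 0 (p @ [i])" "x = y + ab p"
    using half_space_decomposition[OF x(1,2)] .
  have mem: "ab p + t *\<^sub>R u \<in> cyl 0 i" using mem_cyl[OF y(2), of t] by (simp add: un_0)
  have "norm (x + t *\<^sub>R u) \<le> norm z + 1"
    using x(3) norm_triangle_ineq2[of "x + t *\<^sub>R u" z] by (simp add: norm_minus_commute)
  then have "(y, i) \<in> F" using y(1) mem unfolding F_def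
    by (auto intro!: exI[of _ "x + t *\<^sub>R u"] simp: y(3))
  then have "x + t *\<^sub>R u \<in> U" using mem unfolding U_def
    by (auto intro!: bexI[of _ "(y, i)"] simp: y(3) image_iff algebra_simps)
  then show False using e(2) x(3) by (simp add: dist_norm norm_minus_commute)
qed

end

section \<open>Interior pieces\<close>

lemma countable_int_vec: "countable {x :: real ^ 'a::finite. int_vec x}"
proof -
  have "{x :: real ^ 'a. int_vec x} \<subseteq> (\<Union>n::nat. {x. int_vec x \<and> norm x \<le> real n})"
  proof clarify
    fix x :: "real ^ 'a" assume "int_vec x"
    moreover obtain n where "norm x \<le> real n" using real_arch_simple[of "norm x"] by blast
    ultimately show "x \<in> (\<Union>n::nat. {x. int_vec x \<and> norm x \<le> real n})" by blast
  qed
  moreover have "countable (\<Union>n::nat. {x :: real ^ 'a. int_vec x \<and> norm x \<le> real n})"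
    by (rule countable_UN) (auto intro: countable_finite finite_int_vec_ball)
  ultimately show ?thesis by (rule countable_subset)
qed

context price
begin

lemma ut_nk_eventually_close:
  assumes "0 < e" shows "\<exists>k0. \<forall>k\<ge>k0. norm (ut (nk k) - ut 0) < e"
  using LIMSEQ_D[OF ut_nk_tendsto assms] .

lemma scaled_ut_nk_close:
  assumes "0 < e" shows "\<exists>k0. \<forall>k\<ge>k0. norm (ut (nk k) - ut 0) * M \<le> e"
proof -
  have "0 < e / (\<bar>M\<bar> + 1)" using assms by simp
  then obtain k0 where k0: "\<And>k. k \<ge> k0 \<Longrightarrow> norm (ut (nk k) - ut 0) < e / (\<bar>M\<bar> + 1)"
    using ut_nk_eventually_close by blast
  have "norm (ut (nk k) - ut 0) * M \<le> e" if "k \<ge> k0" for k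
  proof -
    have "norm (ut (nk k) - ut 0) * M \<le> norm (ut (nk k) - ut 0) * (\<bar>M\<bar> + 1)"
      by (intro mult_left_mono) auto
    also have "\<dots> \<le> e / (\<bar>M\<bar> + 1) * (\<bar>M\<bar> + 1)"
      using k0[OF that] by (intro mult_right_mono) auto
    also have "\<dots> = e" by simp
    finally show ?thesis .
  qed
  then show ?thesis by blast
qed

lemma abs_inner_one_le: "\<bar>1 \<bullet> (x :: real ^ 'a)\<bar> \<le> \<kappa> * norm x"
proof -
  have "\<bar>1 \<bullet> x\<bar> \<le> norm (1 :: real ^ 'a) * norm x" by (rule Cauchy_Schwarz_ineq2)
  also have "\<dots> \<le> \<kappa> * norm x" by (intro mult_right_mono) (auto simp: \<kappa>_def)
  finally show ?thesis .
qed

lemma add_ut_in_cyl: "pre n (p @ [i]) \<Longrightarrow> ab p + s *\<^sub>R ut n \<in> cyl n i"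
  using mem_cyl[of n p i "s / (1 \<bullet> un n)"] by (simp add: ut_def divide_inverse)

lemma cyl_translate_ut: "x \<in> cyl n i \<Longrightarrow> x + s *\<^sub>R ut n \<in> cyl n i"
  using cyl_translate[of x n i "s / (1 \<bullet> un n)"] by (simp add: ut_def divide_inverse)

text \<open>Write a prefix at level \<open>nk k\<close> as the image of a prefix \<open>q\<close>
  followed by \<open>p'\<close>. Both the image of \<open>q\<close> and that of a replacement
  \<open>q0\<close> from level \<open>l\<close> are near the axis, and \<open>p'\<close> lies in a
  common block; only the axis has moved slightly.\<close>

lemma cyl_nk_near:
  assumes "0 < \<epsilon>"
  shows "\<exists>k0. \<forall>k\<ge>k0. \<forall>i. \<forall>y\<in>cyl (nk k) i. norm y \<le> Q \<longrightarrow> (\<exists>y'\<in>cyl 0 i. norm (y - y') < \<epsilon>)"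
proof -
  \<comment> \<open>Five error terms of size at most \<open>e\<close>, with one to spare.\<close>
  define e where "e = \<epsilon> / 6"
  have e: "0 < e" using assms by (simp add: e_def)
  obtain l k1 where small: "\<And>V. V \<in> fac l \<Longrightarrow> norm (proj 0 (A 0 l *v ab V)) \<le> e"
    and l: "\<And>k. k \<ge> k1 \<Longrightarrow> l \<le> lk k"
    and small': "\<And>k w. k \<ge> k1 \<Longrightarrow> pre (nk k + l) w \<Longrightarrow> norm (proj (nk k) (A 0 l *v ab w)) \<le> e"
    using uniform_small_level[OF e] by metis
  define L where "L = (\<Sum>j\<in>UNIV. real (length (bs 0 l [j])))"
  obtain k2 where k2: "\<And>k. k \<ge> k2 \<Longrightarrow> norm (ut (nk k) - ut 0) * L \<le> e"
    using scaled_ut_nk_close[OF e] by blast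
  obtain k3 where k3: "\<And>k. k \<ge> k3 \<Longrightarrow> norm (ut (nk k) - ut 0) * (\<kappa> * Q) \<le> e"
    using scaled_ut_nk_close[OF e] by blast
  have "\<exists>y'\<in>cyl 0 i. norm (y - y') < \<epsilon>"
    if k: "k \<ge> max k1 (max k2 k3)" and y: "y \<in> cyl (nk k) i" "norm y \<le> Q" for k i y
  proof -
    obtain p where p: "pre (nk k) (p @ [i])" "norm (proj (nk k) (y - ab p)) < e"
      using cyl_approx[OF y(1) e] .
    have lk: "l \<le> lk k" using l k by simp
    have bs_eq: "bs (nk k) (nk k + l) = bs 0 l" using bs_recurrent[OF lk, of 0] by simp
    obtain q j p' r where q: "pre (nk k + l) (q @ [j])" "p = bs 0 l q @ p'" "bs 0 l [j] = p' @ i # r"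
      using pre_desubst[OF le_add1 p(1), of l] unfolding bs_eq .
    obtain q0 where q0: "pre l (q0 @ [j])" using pre_letter by blast
    define p0 where "p0 = bs 0 l q0 @ p'"
    have p0: "pre 0 (p0 @ [i])" using pre_resubst[OF le0 q0 q(3)] by (simp add: p0_def)
    \<comment> \<open>The point over \<open>p0\<close> with the same coordinate sum as
      \<open>y\<close>.\<close>
    define y' where "y' = ab p0 + (1 \<bullet> y - 1 \<bullet> ab p0) *\<^sub>R ut 0"
    have "y' \<in> cyl 0 i" unfolding y'_def by (rule add_ut_in_cyl[OF p0])
    moreover have "norm (y - y') < \<epsilon>"
    proof -
      define \<delta> where "\<delta> = ut (nk k) - ut 0"
      have len: "real (length p') \<le> L"
      proof -
        have "real (length p') \<le> real (length (bs 0 l [j]))" using q(3) by simp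
        also have "\<dots> \<le> L" unfolding L_def by (rule member_le_sum) auto
        finally show ?thesis .
      qed
      have y_eq: "y = proj (nk k) (y - ab p) + proj (nk k) (ab p) + (1 \<bullet> y) *\<^sub>R ut (nk k)"
        using proj_decomp[of y "nk k"] by (simp add: proj_diff)
      have y'_eq: "y' = proj 0 (ab p0) + (1 \<bullet> y) *\<^sub>R ut 0"
        by (simp add: y'_def proj_def algebra_simps)
      have "proj (nk k) (ab p) = proj (nk k) (A 0 l *v ab q)
          + (proj 0 (ab p') - real (length p') *\<^sub>R \<delta>)"
        by (simp add: q(2) ab_append proj_add ab_bs \<delta>_def
            proj_change[of "nk k" "ab p'"] inner_one_ab)
      moreover have "proj 0 (ab p0) = proj 0 (A 0 l *v ab q0) + proj 0 (ab p')"
        by (simp add: p0_def ab_append proj_add ab_bs)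
      ultimately have "y - y' = proj (nk k) (y - ab p) + proj (nk k) (A 0 l *v ab q)
          - proj 0 (A 0 l *v ab q0) - real (length p') *\<^sub>R \<delta> + (1 \<bullet> y) *\<^sub>R \<delta>"
        by (subst y_eq, subst y'_eq) (simp add: \<delta>_def scaleR_diff_right)
      then have "norm (y - y') \<le> norm (proj (nk k) (y - ab p)) + norm (proj (nk k) (A 0 l *v ab q))
          + norm (proj 0 (A 0 l *v ab q0)) + norm (real (length p') *\<^sub>R \<delta>) + norm ((1 \<bullet> y) *\<^sub>R \<delta>)"
        by (simp only:) (intro order_trans[OF norm_triangle_ineq] add_mono order_refl
            order_trans[OF norm_triangle_ineq4])
      moreover have "norm (proj (nk k) (A 0 l *v ab q)) \<le> e"
        using small'[of k q] k pre_prefix[OF q(1), of q] by simp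
      moreover have "norm (proj 0 (A 0 l *v ab q0)) \<le> e"
        using small[OF pre_imp_fac] pre_prefix[OF q0, of q0] by simp
      moreover have "norm (real (length p') *\<^sub>R \<delta>) \<le> e"
      proof -
        have "norm (real (length p') *\<^sub>R \<delta>) = norm \<delta> * real (length p')" by simp
        also have "\<dots> \<le> norm \<delta> * L" using len by (intro mult_left_mono) auto
        also have "\<dots> \<le> e" using k2 k by (simp add: \<delta>_def)
        finally show ?thesis .
      qed
      moreover have "norm ((1 \<bullet> y) *\<^sub>R \<delta>) \<le> e"
      proof -
        have "\<bar>1 \<bullet> y\<bar> \<le> \<kappa> * Q"
          using abs_inner_one_le[of y] y(2) \<kappa>_pos by (meson mult_left_mono less_imp_le order_trans)
        then have "norm ((1 \<bullet> y) *\<^sub>R \<delta>) \<le> norm \<delta> * (\<kappa> * Q)"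
          using mult_left_mono[of "\<bar>1 \<bullet> y\<bar>" "\<kappa> * Q" "norm \<delta>"] by (simp add: mult.commute)
        also have "\<dots> \<le> e" using k3 k by (simp add: \<delta>_def)
        finally show ?thesis .
      qed
      ultimately show ?thesis using p(2) e by (simp add: e_def)
    qed
    ultimately show ?thesis by blast
  qed
  then show ?thesis by blast
qed

lemma vn_nonzero: "vn n \<noteq> 0"
  using vn_inner_un[of n] v_inner_u_pos by auto

definition vt :: "nat \<Rightarrow> real ^ 'a" where "vt n = vn n /\<^sub>R infnorm (vn n)"

lemma infnorm_vn_pos: "0 < infnorm (vn n)"
  using infnorm_pos_lt vn_nonzero by blast

lemma vt_tendsto: "(\<lambda>k. vt (nk k)) \<longlonglongrightarrow> v"
  using v_limit by (simp add: vt_def vn_def Let_def)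

lemma Gam_scaled:
  "(x, i) \<in> Gam n (c * infnorm (vn n)) \<longleftrightarrow> int_vec x \<and> c \<le> vt n \<bullet> x \<and> vt n \<bullet> x < c + vt n $ i"
  using infnorm_vn_pos[of n] by (simp add: Gam_def vt_def field_simps)

lemma v_inner_ut_0_pos: "0 < v \<bullet> ut 0"
  using vn_inner_ut_pos[of 0] by (simp add: vn_0)

text \<open>For a generic offset \<open>c\<close>, failing to be a face is an open condition in the
  normal vector: the lower inequality fails strictly, and the upper one too, as
  \<open>v \<bullet> (x - axis i 1)\<close> cannot equal \<open>c\<close>.\<close>

lemma eventually_Gam_limit:
  assumes c: "\<And>x. int_vec x \<Longrightarrow> v \<bullet> x \<noteq> c" and x: "int_vec x"
  shows "\<forall>\<^sub>F k in sequentially. (x, i) \<in> Gam (nk k) (c * infnorm (vn (nk k))) \<longrightarrow> (x, i) \<in> Gam 0 c"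
proof -
  have "\<forall>\<^sub>F k in sequentially. c \<le> vt (nk k) \<bullet> x \<longrightarrow> c \<le> v \<bullet> x"
  proof (cases "c \<le> v \<bullet> x")
    case False
    have "(\<lambda>k. vt (nk k) \<bullet> x) \<longlonglongrightarrow> v \<bullet> x" by (intro tendsto_intros vt_tendsto)
    from order_tendstoD(2)[OF this, of c] show ?thesis using False by (auto elim!: eventually_mono)
  qed simp
  moreover have "\<forall>\<^sub>F k in sequentially. vt (nk k) \<bullet> x < c + vt (nk k) $ i \<longrightarrow> v \<bullet> x < c + v $ i"
  proof (cases "v \<bullet> x < c + v $ i")
    case False
    have eq: "w \<bullet> (x - axis i 1) = w \<bullet> x - w $ i" for w :: "real ^ 'a"
      by (simp add: inner_diff_right inner_axis)
    have "int_vec (x - axis i 1)"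
      using int_vec_diff[OF x, of "axis i 1"] by (simp add: int_vec_def axis_def)
    then have "c < v \<bullet> (x - axis i 1)" using c False by (force simp: eq)
    moreover have "(\<lambda>k. vt (nk k) \<bullet> (x - axis i 1)) \<longlonglongrightarrow> v \<bullet> (x - axis i 1)"
      by (intro tendsto_intros vt_tendsto)
    ultimately have "\<forall>\<^sub>F k in sequentially. c < vt (nk k) \<bullet> (x - axis i 1)"
      by (simp add: order_tendstoD(1))
    then show ?thesis by (rule eventually_mono) (simp add: eq)
  qed simp
  ultimately show ?thesis
    by eventually_elim (simp only: Gam_scaled, simp add: Gam_def vn_0)
qed

text \<open>At a point \<open>z0\<close> of minimal covering degree, perturbing the point and the
  level to \<open>nk k\<close> with \<open>k\<close> large cannot bring in new faces, and by
  minimality and refinement it cannot lose any. So each face covering \<open>z0\<close> covers a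
  whole ball, with the same radius at all these levels.\<close>

lemma exclusive_ball:
  obtains y i0 r k0 where "y \<in> cyl 0 i0" "0 < v $ i0" "0 < r"
    "\<And>k. k \<ge> k0 \<Longrightarrow> ball y r \<subseteq> cyl (nk k) i0"
proof -
  obtain c1 z0 where min: "\<And>c z. card (Cov 0 c1 z0) \<le> card (Cov 0 c z)"
  proof -
    obtain w where "\<And>w'. card (Cov 0 (fst w) (snd w)) \<le> card (Cov 0 (fst w') (snd w'))"
      using ex_has_least_nat[of "\<lambda>_. True" _ "\<lambda>w. card (Cov 0 (fst w) (snd w))"] by blast
    then show thesis using that[of "fst w" "snd w"] by (metis fst_conv snd_conv)
  qed
  define m where "m = card (Cov 0 c1 z0)"
  define Q where "Q = \<bar>c1\<bar> + 1 + (\<Sum>i\<in>UNIV. v $ i)"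
  define F1 where "F1 = {(x, i). int_vec x \<and> \<bar>vn 0 \<bullet> x\<bar> \<le> Q \<and> (\<exists>z. norm z \<le> norm z0 \<and> z - x \<in> cyl 0 i)}"
  define V where "V = {a \<in> (\<lambda>(x, i). v \<bullet> x) ` F1. a < c1}"
  have "finite V" unfolding V_def F1_def using finite_near by simp
  \<comment> \<open>No face relevant near \<open>z0\<close> has a height strictly between
    \<open>a\<close> and \<open>c1\<close>. Lowering the offset into this gap adds no face at
    \<open>z0\<close>, so the degree remains minimal.\<close>
  define a where "a = Max (insert (c1 - 1) V)"
  have a: "a < c1" "c1 - 1 \<le> a" "\<And>b. b \<in> V \<Longrightarrow> b \<le> a"
    using \<open>finite V\<close> by (auto simp: a_def V_def)
  \<comment> \<open>Generic offsets exist in the gap, as integer vectors attain only countably many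
    heights.\<close>
  have "uncountable ({a<..<c1} - (\<lambda>x. v \<bullet> x) ` {x. int_vec x})"
    using a(1) countable_int_vec by (intro uncountable_minus_countable) (auto simp: uncountable_open_interval)
  then have "{a<..<c1} - (\<lambda>x. v \<bullet> x) ` {x. int_vec x} \<noteq> {}" by (metis countable_empty)
  then obtain c where "c \<in> {a<..<c1}" and nc: "c \<notin> (\<lambda>x. v \<bullet> x) ` {x. int_vec x}" by blast
  moreover from nc have "v \<bullet> x \<noteq> c" if "int_vec x" for x using that by blast
  ultimately have c: "a < c" "c < c1" "\<And>x. int_vec x \<Longrightarrow> v \<bullet> x \<noteq> c" by auto
  define F where "F = Cov 0 c z0"
  have "F \<subseteq> Cov 0 c1 z0"
  proof clarify
    fix x i assume xi: "(x, i) \<in> F"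
    then have x: "int_vec x" "c \<le> v \<bullet> x" "v \<bullet> x < c + v $ i" "z0 - x \<in> cyl 0 i"
      by (auto simp: F_def Cov_def Gam_def vn_0)
    have "\<bar>v \<bullet> x\<bar> \<le> \<bar>c\<bar> + (\<Sum>i\<in>UNIV. v $ i)"
      using Gam_bound[of x i 0 c] xi by (simp add: F_def Cov_def vn_0)
    then have "\<bar>v \<bullet> x\<bar> \<le> Q" using c a by (simp add: Q_def)
    then have "(x, i) \<in> F1" using x by (auto simp: F1_def vn_0)
    have "c1 \<le> v \<bullet> x"
    proof (rule ccontr)
      assume "\<not> ?thesis"
      then have "v \<bullet> x \<in> V" using \<open>(x, i) \<in> F1\<close> by (force simp: V_def)
      then show False using a(3) c(1) x(2) by fastforce
    qed
    then show "(x, i) \<in> Cov 0 c1 z0" using x c by (auto simp: Cov_def Gam_def vn_0)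
  qed
  then have "card F \<le> m" unfolding m_def using finite_Cov by (rule card_mono[rotated])
  then have card_F: "card F = m" using min[of c z0] by (simp add: F_def m_def)
  have fin_F: "finite F" unfolding F_def by (rule finite_Cov)
  have "F \<noteq> {}" unfolding F_def by (rule Cov_nonempty)
  then obtain x0 i0 where xi0: "(x0, i0) \<in> F" by auto

  define F2 where "F2 = {(x, i). (x, i) \<in> Gam 0 c \<and> (\<exists>z. norm z \<le> norm z0 + 1 \<and> z - x \<in> cyl 0 i)}"
  define U where "U = (\<Union>(x, i)\<in>F2 - F. (+) x ` cyl 0 i)"
  have "finite F2" unfolding F2_def by (rule finite_Gam_near)
  then have "closed U" unfolding U_def using closed_cyl closed_translation by (intro closed_UN) auto
  moreover have "z0 \<notin> U"
  proof
    assume "z0 \<in> U"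
    then obtain x i y where "(x, i) \<in> F2" "(x, i) \<notin> F" "y \<in> cyl 0 i" "z0 = x + y" by (auto simp: U_def)
    then show False by (auto simp: F2_def F_def Cov_def)
  qed
  ultimately obtain e where e: "0 < e" "\<And>y. dist y z0 < e \<Longrightarrow> y \<notin> U"
    by (metis Compl_iff closed_def open_dist)
  define r where "r = min e 1 / 4"
  have r: "0 < r" "4 * r \<le> e" "4 * r \<le> 1" using e(1) by (auto simp: r_def)
  have in_F: "(x, i) \<in> F" if "(x, i) \<in> Gam 0 c" "y \<in> cyl 0 i" "norm (x + y - z0) < 2 * r" for x i y
  proof (rule ccontr)
    assume "(x, i) \<notin> F"
    have "norm (x + y) \<le> norm z0 + 1" using that(3) r norm_triangle_ineq2[of "x + y" z0] by simp
    then have "(x, i) \<in> F2" using that by (auto simp: F2_def intro!: exI[of _ "x + y"])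
    then have "x + y \<in> U" using \<open>(x, i) \<notin> F\<close> that(2) unfolding U_def by (auto intro!: bexI[of _ "(x, i)"])
    then show False using e(2)[of "x + y"] that(3) r by (simp add: dist_norm)
  qed

  obtain K where K: "0 < K" "\<And>k V. V \<in> fac (nk k) \<Longrightarrow> norm (proj (nk k) (ab V)) \<le> K"
    using fac_nk_bounded by blast
  define P where "P = \<kappa> * (norm z0 + 1) + K"
  have P: "0 \<le> P" using K(1) \<kappa>_pos by (simp add: P_def add_nonneg_nonneg)
  define k' where "k' = (v \<bullet> ut 0) / 2"
  have k': "0 < k'" "k' < v \<bullet> ut 0" using v_inner_ut_0_pos by (auto simp: k'_def)
  \<comment> \<open>A bound, independent of \<open>k\<close>, for the faces of level
    \<open>nk k\<close> that cover points near \<open>z0\<close>; only the finitely many integer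
    vectors in \<open>X\<close> have to be followed to the limit.\<close>
  define R where "R = P + (\<bar>c\<bar> + (norm v + 1) + (norm v + 1) * P) / k'"
  define X where "X = {x :: real ^ 'a. int_vec x \<and> norm x \<le> R}"
  have "finite X" unfolding X_def by (rule finite_int_vec_ball)

  have "\<forall>\<^sub>F k in sequentially. \<forall>x\<in>X. \<forall>i\<in>UNIV.
      (x, i) \<in> Gam (nk k) (c * infnorm (vn (nk k))) \<longrightarrow> (x, i) \<in> Gam 0 c"
    using eventually_Gam_limit[OF c(3)]
    by (intro eventually_ball_finite ballI \<open>finite X\<close> finite) (simp add: X_def)
  moreover have "\<forall>\<^sub>F k in sequentially. k' < vt (nk k) \<bullet> ut (nk k)"
  proof -
    have "(\<lambda>k. vt (nk k) \<bullet> ut (nk k)) \<longlonglongrightarrow> v \<bullet> ut 0" by (intro tendsto_intros vt_tendsto ut_nk_tendsto)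
    then show ?thesis using k'(2) by (rule order_tendstoD(1))
  qed
  moreover have "\<forall>\<^sub>F k in sequentially. norm (vt (nk k)) < norm v + 1"
  proof -
    have "(\<lambda>k. norm (vt (nk k))) \<longlonglongrightarrow> norm v" by (intro tendsto_intros vt_tendsto)
    then show ?thesis by (rule order_tendstoD(2)) simp
  qed
  moreover obtain k1 where k1: "\<And>k i y. k \<ge> k1 \<Longrightarrow> y \<in> cyl (nk k) i \<Longrightarrow> norm y \<le> norm z0 + 1 + R \<Longrightarrow>
      \<exists>y'\<in>cyl 0 i. norm (y - y') < r"
    using cyl_nk_near[OF r(1), of "norm z0 + 1 + R"] by blast
  then have "\<forall>\<^sub>F k in sequentially. \<forall>i y. y \<in> cyl (nk k) i \<longrightarrow> norm y \<le> norm z0 + 1 + R \<longrightarrow>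
      (\<exists>y'\<in>cyl 0 i. norm (y - y') < r)"
    unfolding eventually_sequentially by blast
  ultimately have "\<forall>\<^sub>F k in sequentially. ball (z0 - x0) r \<subseteq> cyl (nk k) i0"
  proof eventually_elim
    case (elim k)
    \<comment> \<open>The offset is scaled together with \<open>vn\<close>, so that in terms of
      \<open>vt\<close> it stays \<open>c\<close>.\<close>
    define ck where "ck = c * infnorm (vn (nk k))"
    have sub: "Cov (nk k) ck z \<subseteq> F" if z: "norm (z - z0) < r" for z
    proof clarify
      fix x i assume "(x, i) \<in> Cov (nk k) ck z"
      then have x: "(x, i) \<in> Gam (nk k) ck" "z - x \<in> cyl (nk k) i" by (auto simp: Cov_def)
      have x': "int_vec x" "c \<le> vt (nk k) \<bullet> x" "vt (nk k) \<bullet> x < c + vt (nk k) $ i"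
        using x(1) by (simp_all add: ck_def Gam_scaled)
      have zn: "norm z \<le> norm z0 + 1" using z r norm_triangle_ineq2[of z z0] by simp
      have "norm (proj (nk k) x) = norm (proj (nk k) z - proj (nk k) (z - x))" by (simp add: proj_diff)
      also have "\<dots> \<le> norm (proj (nk k) z) + norm (proj (nk k) (z - x))" by (rule norm_triangle_ineq4)
      also have "norm (proj (nk k) z) \<le> \<kappa> * (norm z0 + 1)"
        using \<kappa>_pos by (intro order_trans[OF norm_proj_le mult_left_mono[OF zn]]) simp
      also have "norm (proj (nk k) (z - x)) \<le> K" by (rule cyl_proj_bound[OF K(2) x(2)])
      finally have px: "norm (proj (nk k) x) \<le> P" by (simp add: P_def)
      have "\<bar>vt (nk k) $ i\<bar> \<le> norm v + 1"
        using component_le_norm_cart[of "vt (nk k)" i] elim(3) by simp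
      then have vx: "\<bar>vt (nk k) \<bullet> x\<bar> \<le> \<bar>c\<bar> + (norm v + 1)"
        using x'(2,3) norm_ge_zero[of v] by linarith
      have "norm x \<le> P + (\<bar>c\<bar> + (norm v + 1) + norm (vt (nk k)) * P) / k'"
        using norm_le_of_proj[OF k'(1) less_imp_le[OF elim(2)] px vx] .
      also have "\<dots> \<le> R" unfolding R_def
        using elim(3) P k'(1) by (intro add_left_mono divide_right_mono mult_right_mono) auto
      finally have xR: "norm x \<le> R" .
      then have G: "(x, i) \<in> Gam 0 c" using elim(1) x(1) x'(1) by (auto simp: X_def ck_def)
      have "norm (z - x) \<le> norm z0 + 1 + R" using zn xR norm_triangle_ineq4[of z x] by simp
      then obtain y' where y': "y' \<in> cyl 0 i" "norm (z - x - y') < r" using elim(4) x(2) by blast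
      have "x + y' - z0 = (z - z0) - (z - x - y')" by simp
      then have "norm (x + y' - z0) < 2 * r"
        using z y'(2) norm_triangle_ineq4[of "z - z0" "z - x - y'"] by simp
      then show "(x, i) \<in> F" using in_F[OF G y'(1)] by blast
    qed
    show ?case
    proof
      fix y assume y: "y \<in> ball (z0 - x0) r"
      define z where "z = x0 + y"
      have "norm (z - z0) < r"
        using y norm_minus_commute[of "z0 - x0" y] by (simp add: z_def dist_norm algebra_simps)
      then have "Cov (nk k) ck z \<subseteq> F" by (rule sub)
      \<comment> \<open>The offset \<open>ck\<close> differs from \<open>c\<close> also when used at
        level 0, which is why the degree was minimized over all offsets.\<close>
      moreover have "card F \<le> card (Cov (nk k) ck z)"
        using min[of ck "A 0 (nk k) *v z"] card_Cov_le[of ck "nk k" z] by (simp add: card_F m_def)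
      ultimately have "Cov (nk k) ck z = F" using fin_F by (metis card_seteq)
      then have "z - x0 \<in> cyl (nk k) i0" using xi0 by (auto simp: Cov_def)
      then show "y \<in> cyl (nk k) i0" by (simp add: z_def)
    qed
  qed
  then obtain k0 where k0: "\<And>k. k \<ge> k0 \<Longrightarrow> ball (z0 - x0) r \<subseteq> cyl (nk k) i0"
    unfolding eventually_sequentially by blast
  have "z0 - x0 \<in> cyl 0 i0" "0 < v $ i0"
    using xi0 by (auto simp: F_def Cov_def Gam_def vn_0)
  then show thesis using that[OF _ _ r(1) k0] by blast
qed

text \<open>Invariance along the axis turns the ball into a tube, so closeness of the projections
  suffices.\<close>

lemma near_imp_interior:
  assumes "ball y r \<subseteq> cyl n i" "norm (proj n (x - y)) < r"
  shows "x \<in> interior (cyl n i)"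
proof -
  define s where "s = 1 \<bullet> (x - y)"
  show ?thesis
  proof (rule interiorI)
    show "open ((+) (s *\<^sub>R ut n) ` ball y r)" by (intro open_translation) simp
    have "dist y (x - s *\<^sub>R ut n) < r"
      using assms(2) by (simp add: proj_def s_def dist_norm norm_minus_commute algebra_simps)
    then show "x \<in> (+) (s *\<^sub>R ut n) ` ball y r"
      by (intro image_eqI[of _ _ "x - s *\<^sub>R ut n"]) auto
    show "(+) (s *\<^sub>R ut n) ` ball y r \<subseteq> cyl n i"
      using assms(1) cyl_translate_ut by (force simp: add.commute)
  qed
qed

text \<open>A small piece near the centre of the exclusive ball lies in the interior. Its letter
  \<open>j0\<close> occurs in the deeper images of all letters, so every letter \<open>j\<close> at
  depth \<open>l\<close> owns an interior piece, given by a \<open>P\<close> that does not depend on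
  \<open>k\<close>.\<close>

lemma interior_pieces:
  obtains l i0 k0 where "0 < v $ i0" "\<And>k. k \<ge> k0 \<Longrightarrow> l \<le> lk k"
    and "\<And>j. \<exists>P r. bs 0 l [j] = P @ i0 # r \<and> (\<forall>k\<ge>k0.
       (\<lambda>x. ab P + A 0 l *v x) ` cyl (nk k + l) j \<subseteq> interior (cyl (nk k) i0))"
proof -
  obtain y i0 r k1 where y: "y \<in> cyl 0 i0" "0 < v $ i0" "0 < r"
    and ball: "\<And>k. k \<ge> k1 \<Longrightarrow> ball y r \<subseteq> cyl (nk k) i0"
    using exclusive_ball by blast
  \<comment> \<open>The piece starts within \<open>2 * e\<close> of \<open>y\<close>, changing the
    projection costs \<open>e\<close>, and the piece itself has extent \<open>e\<close>: in total
    \<open>4 * e < r\<close>.\<close>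
  define e where "e = r / 5"
  have e: "0 < e" using y(3) by (simp add: e_def)
  obtain l0 k2 where small: "\<And>V. V \<in> fac l0 \<Longrightarrow> norm (proj 0 (A 0 l0 *v ab V)) \<le> e"
    and l0: "\<And>k. k \<ge> k2 \<Longrightarrow> l0 \<le> lk k"
    and small': "\<And>k w. k \<ge> k2 \<Longrightarrow> pre (nk k + l0) w \<Longrightarrow> norm (proj (nk k) (A 0 l0 *v ab w)) \<le> e"
    using uniform_small_level[OF e] by metis
  obtain p0 where p0: "pre 0 (p0 @ [i0])" "norm (proj 0 (y - ab p0)) < e"
    using cyl_approx[OF y(1) e] .
  obtain q0 j0 p' r' where q0: "pre l0 (q0 @ [j0])" "p0 = bs 0 l0 q0 @ p'" "bs 0 l0 [j0] = p' @ i0 # r'"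
    using pre_desubst[OF le0 p0(1)] .
  have "norm (proj 0 (A 0 l0 *v ab q0)) \<le> e"
    using small[OF pre_imp_fac] pre_prefix[OF q0(1), of q0] by simp
  moreover have "proj 0 (ab p' - y)
      = - proj 0 (y - ab p0) - proj 0 (A 0 l0 *v ab q0)"
    by (simp add: q0(2) ab_append ab_bs proj_add proj_diff)
  ultimately have p'_y: "norm (proj 0 (ab p' - y)) \<le> 2 * e"
    using p0(2) norm_triangle_ineq4[of "- proj 0 (y - ab p0)" "proj 0 (A 0 l0 *v ab q0)"]
    by simp
  obtain k3 where k3: "\<And>k. k \<ge> k3 \<Longrightarrow> norm (ut (nk k) - ut 0) * \<bar>1 \<bullet> (ab p' - y)\<bar> \<le> e"
    using scaled_ut_nk_close[OF e] by blast
  obtain l where l: "l0 \<le> l" "\<And>i j. 1 \<le> A l0 l $ i $ j" using A_eventually_ge_1 by blast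
  define k0 where "k0 = max (max k1 k2) (max k3 l)"
  have piece: "ab p' + A 0 l0 *v x \<in> interior (cyl (nk k) i0)"
    if k: "k \<ge> k0" and x: "x \<in> cyl (nk k + l0) j0" for k x
  proof (rule near_imp_interior)
    show "ball y r \<subseteq> cyl (nk k) i0" using ball k by (simp add: k0_def)
    have lk: "l0 \<le> lk k" using l0 k by (simp add: k0_def)
    have "norm (proj (nk k) (A 0 l0 *v x)) \<le> e"
    proof (rule cyl_linear_bound[OF linear_proj_A _ _ x])
      show "proj (nk k) (A 0 l0 *v un (nk k + l0)) = 0"
        using A_un[of "nk k" "nk k + l0"] A_recurrent[OF lk, of 0] by simp
      show "norm (proj (nk k) (A 0 l0 *v ab p)) \<le> e" if "pre (nk k + l0) (p @ [j0])" for p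
        using small'[of k p] k pre_prefix[OF that, of p] by (simp add: k0_def)
    qed
    moreover have "norm (proj (nk k) (ab p' - y)) \<le> 3 * e"
    proof -
      have "norm (proj (nk k) (ab p' - y)) \<le> norm (proj 0 (ab p' - y))
          + norm ((1 \<bullet> (ab p' - y)) *\<^sub>R (ut (nk k) - ut 0))"
        unfolding proj_change[of "nk k"] by (rule norm_triangle_ineq4)
      also have "norm ((1 \<bullet> (ab p' - y)) *\<^sub>R (ut (nk k) - ut 0)) \<le> e"
        using k3[of k] k by (simp add: k0_def mult.commute)
      finally show ?thesis using p'_y by simp
    qed
    moreover have "proj (nk k) (ab p' + A 0 l0 *v x - y)
        = proj (nk k) (ab p' - y) + proj (nk k) (A 0 l0 *v x)"
      by (simp add: proj_add proj_diff)
    ultimately have "norm (proj (nk k) (ab p' + A 0 l0 *v x - y)) \<le> 4 * e"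
      using norm_triangle_ineq[of "proj (nk k) (ab p' - y)" "proj (nk k) (A 0 l0 *v x)"]
      by simp
    then show "norm (proj (nk k) (ab p' + A 0 l0 *v x - y)) < r"
      using e by (simp add: e_def)
  qed
  show thesis
  proof (rule that[of i0 k0 l])
    show "0 < v $ i0" by (rule y(2))
    show le: "l \<le> lk k" if "k \<ge> k0" for k using that lk_ge[of k] by (simp add: k0_def)
    fix j
    obtain P r'' where P: "bs l0 l [j] = P @ j0 # r''" using letter_in_block[OF l(2)] by blast
    have "bs 0 l [j] = bs 0 l0 (P @ j0 # r'')" using block_subst_split_app[OF le0 l(1)] P by metis
    also have "\<dots> = (bs 0 l0 P @ p') @ i0 # (r' @ bs 0 l0 r'')"
      by (subst substitution_append[OF subst_bs], subst substitution_Cons[OF subst_bs]) (simp add: q0(3))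
    finally have eq: "bs 0 l [j] = (bs 0 l0 P @ p') @ i0 # (r' @ bs 0 l0 r'')" .
    have "ab (bs 0 l0 P @ p') + A 0 l *v x \<in> interior (cyl (nk k) i0)"
      if k: "k \<ge> k0" and x: "x \<in> cyl (nk k + l) j" for k x
    proof -
      have lk: "l \<le> lk k" using le k by blast
      have "bs (nk k + l0) (nk k + l) [j] = P @ j0 # r''" "A (nk k + l0) (nk k + l) = A l0 l"
        using P bs_recurrent[OF lk] A_recurrent[OF lk] by auto
      then have "ab P + A l0 l *v x \<in> cyl (nk k + l0) j0"
        using x cyl_eq[of "nk k + l0" "nk k + l" j0] l(1) by (force simp: pieces_def)
      from piece[OF k this] show ?thesis
        using A_split_app[OF le0 l(1)]
        by (simp add: ab_append ab_bs matrix_vector_right_distrib algebra_simps)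
    qed
    then show "\<exists>P r. bs 0 l [j] = P @ i0 # r \<and> (\<forall>k\<ge>k0.
       (\<lambda>x. ab P + A 0 l *v x) ` cyl (nk k + l) j \<subseteq> interior (cyl (nk k) i0))"
      using eq by blast
  qed
qed

end

section \<open>The measure of the boundary\<close>

text \<open>The change of variables formula of the library is stated for index types that are
  well-ordered; \<open>'a idx\<close> is a well-ordered copy of the finite type \<open>'a\<close>.\<close>

typedef 'a idx = "UNIV :: 'a set"
  morphisms of_idx to_idx by simp

lemmas of_to_idx = to_idx_inverse[OF UNIV_I] and to_of_idx = of_idx_inverse

lemma bij_of_idx: "bij of_idx"
  by (metis bij_betw_def inj_def of_to_idx surj_def to_of_idx)

instance idx :: (finite) finite
proof
  have "(UNIV :: 'a idx set) = to_idx ` UNIV" by (metis UNIV_I of_idx_inverse surj_def)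
  then show "finite (UNIV :: 'a idx set)" by (metis finite finite_imageI)
qed

instantiation idx :: (finite) wellorder
begin

definition less_eq_idx :: "'a idx \<Rightarrow> 'a idx \<Rightarrow> bool" where
  "less_eq_idx x y \<longleftrightarrow> to_nat (of_idx x) \<le> to_nat (of_idx y)"

definition less_idx :: "'a idx \<Rightarrow> 'a idx \<Rightarrow> bool" where
  "less_idx x y \<longleftrightarrow> to_nat (of_idx x) < to_nat (of_idx y)"

instance
proof
  fix x y z :: "'a idx"
  show "x < y \<longleftrightarrow> x \<le> y \<and> \<not> y \<le> x" by (auto simp: less_eq_idx_def less_idx_def)
  show "x \<le> x" by (simp add: less_eq_idx_def)
  show "x \<le> y \<Longrightarrow> y \<le> z \<Longrightarrow> x \<le> z" by (simp add: less_eq_idx_def)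
  show "x \<le> y \<Longrightarrow> y \<le> x \<Longrightarrow> x = y" by (simp add: less_eq_idx_def of_idx_inject)
  show "x \<le> y \<or> y \<le> x" by (auto simp: less_eq_idx_def)
next
  fix P :: "'a idx \<Rightarrow> bool" and a :: "'a idx"
  assume step: "\<And>x. (\<And>y. y < x \<Longrightarrow> P y) \<Longrightarrow> P x"
  show "P a"
  proof (induction "to_nat (of_idx a)" arbitrary: a rule: less_induct)
    case less
    then show ?case using step[of a] by (simp add: less_idx_def)
  qed
qed

end

section \<open>Lebesgue measure under unimodular integer matrices\<close>

definition relabel :: "real ^ 'a::finite \<Rightarrow> real ^ 'a idx" where
  "relabel x = (\<chi> k. x $ of_idx k)"

definition unlabel :: "real ^ 'a idx \<Rightarrow> real ^ 'a::finite" where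
  "unlabel x = (\<chi> i. x $ to_idx i)"

lemma unlabel_relabel: "unlabel (relabel x) = x" and relabel_unlabel: "relabel (unlabel y) = y"
  by (simp_all add: relabel_def unlabel_def of_to_idx to_of_idx)

lemma linear_relabel: "linear relabel" and linear_unlabel: "linear unlabel"
  by (auto intro!: linearI simp: relabel_def unlabel_def vec_eq_iff)

lemma prod_Basis_vec: "(\<Prod>b\<in>Basis. x \<bullet> b) = (\<Prod>i\<in>UNIV. (x :: real ^ 'n::finite) $ i)"
proof -
  have "(Basis :: (real ^ 'n) set) = range (\<lambda>i. axis i 1)" by (auto simp: Basis_vec_def)
  then have "(\<Prod>b\<in>Basis. x \<bullet> b) = (\<Prod>b\<in>range (\<lambda>i. axis i 1). x \<bullet> b)" by (rule arg_cong)
  also have "\<dots> = (\<Prod>i\<in>UNIV. x \<bullet> axis i 1)"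
    by (rule prod.reindex_cong[of "\<lambda>i. axis i 1"]) (auto simp: inj_def axis_eq_axis)
  finally show ?thesis by (simp add: inner_axis)
qed

lemma distr_lborel_relabel: "distr lborel borel relabel = (lborel :: (real ^ 'a::finite idx) measure)"
proof (rule lborel_eqI[symmetric])
  have [measurable]: "relabel \<in> borel_measurable borel"
    by (intro borel_measurable_continuous_onI linear_continuous_on
        linear_conv_bounded_linear[THEN iffD1] linear_relabel)
  fix l u :: "real ^ 'a idx"
  assume le: "\<And>b. b \<in> Basis \<Longrightarrow> l \<bullet> b \<le> u \<bullet> b"
  have le': "l $ k \<le> u $ k" for k
  proof -
    have "axis k 1 \<in> (Basis :: (real ^ 'a idx) set)" by (auto simp: Basis_vec_def)
    from le[OF this] show ?thesis by (simp add: inner_axis)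
  qed
  have "relabel -` box l u = box (unlabel l) (unlabel u)"
    by (auto simp: mem_box_cart relabel_def unlabel_def) (metis of_to_idx to_of_idx)+
  then have "emeasure (distr lborel borel relabel) (box l u) = emeasure lborel (box (unlabel l) (unlabel u))"
    by (simp add: emeasure_distr)
  also have "\<dots> = (\<Prod>b\<in>Basis. (unlabel u - unlabel l) \<bullet> b)"
    using le' by (intro emeasure_lborel_box) (auto simp: Basis_vec_def inner_axis unlabel_def)
  also have "(\<Prod>b\<in>Basis. (unlabel u - unlabel l) \<bullet> b) = (\<Prod>i\<in>UNIV. (u - l) $ to_idx i)"
    by (simp add: prod_Basis_vec unlabel_def)
  also have "\<dots> = (\<Prod>k\<in>UNIV. (u - l) $ k)"
    using prod.reindex_bij_betw[OF bij_of_idx, of "\<lambda>i. (u - l) $ to_idx i"] by (simp add: to_of_idx)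
  finally show "emeasure (distr lborel borel relabel) (box l u) = (\<Prod>b\<in>Basis. (u - l) \<bullet> b)"
    by (simp add: prod_Basis_vec)
qed simp

lemma relabel_image:
  assumes "S \<in> sets borel"
  shows "relabel ` S \<in> sets borel" "measure lebesgue (relabel ` S) = measure lebesgue S"
proof -
  have meas: "relabel \<in> borel_measurable borel" "unlabel \<in> borel_measurable borel"
    by (auto intro!: borel_measurable_continuous_onI linear_continuous_on
        linear_conv_bounded_linear[THEN iffD1] linear_relabel linear_unlabel)
  have "relabel ` S = unlabel -` S"
    by (auto simp: unlabel_relabel intro!: image_eqI[of _ relabel "unlabel _"]) (simp add: relabel_unlabel)
  then show S': "relabel ` S \<in> sets borel"
    using measurable_sets[OF meas(2) assms] by simp
  have "measure lborel (relabel ` S) = measure lborel (relabel -` relabel ` S)"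
    using measure_distr[of relabel lborel borel "relabel ` S"] meas(1) S'
    by (simp add: distr_lborel_relabel)
  also have "relabel -` relabel ` S = S" using unlabel_relabel by (metis inj_def inj_vimage_image_eq)
  finally show "measure lebesgue (relabel ` S) = measure lebesgue S"
    using S' assms by (simp add: measure_completion)
qed

lemma Ints_mult_eq_1_imp_abs: "(x::real) \<in> \<int> \<Longrightarrow> y \<in> \<int> \<Longrightarrow> x * y = 1 \<Longrightarrow> \<bar>x\<bar> = 1"
proof -
  assume *: "x \<in> \<int>" "y \<in> \<int>" "x * y = 1"
  then have "1 \<le> \<bar>x\<bar>" "1 \<le> \<bar>y\<bar>" by (auto intro!: Ints_nonzero_abs_ge1)
  moreover have "\<bar>x\<bar> * \<bar>y\<bar> = 1" using *(3) by (simp flip: abs_mult)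
  moreover have "\<bar>x\<bar> * 1 \<le> \<bar>x\<bar> * \<bar>y\<bar>" using calculation by (intro mult_left_mono) auto
  ultimately show "\<bar>x\<bar> = 1" by linarith
qed

lemma borel_linear_image:
  fixes M :: "real ^ 'a::finite ^ 'a"
  assumes "invertible M" "S \<in> sets borel" shows "(*v) M ` S \<in> sets borel"
proof -
  obtain N where N: "M ** N = mat 1" "N ** M = mat 1" using assms(1) unfolding invertible_def by blast
  have "(*v) M ` S = (*v) N -` S"
    using N by (auto simp: matrix_vector_mul_assoc intro!: image_eqI[of _ "(*v) M" "N *v _"])
  moreover have "(*v) N \<in> borel_measurable borel"
    by (intro borel_measurable_continuous_onI matrix_vector_mult_linear_continuous_on)
  ultimately show ?thesis using measurable_sets[of "(*v) N" borel borel S] assms(2) by simp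
qed

lemma measure_unimodular_image:
  fixes M :: "real ^ 'a::finite ^ 'a"
  assumes int: "\<And>i j. M $ i $ j \<in> \<int>" and det: "\<bar>det M\<bar> = 1"
    and S: "S \<in> sets borel" "bounded S"
  shows "measure lebesgue ((*v) M ` S) = measure lebesgue S"
proof -
  define M' :: "real ^ 'a idx ^ 'a idx" where "M' = (\<chi> k l. M $ of_idx k $ of_idx l)"
  have inv: "invertible M" using det by (metis abs_0 invertible_det_nz zero_neq_one)
  have "\<exists>y. int_vec y \<and> M *v y = axis j 1" for j
    by (intro int_vec_preimage int det) (auto simp: int_vec_def axis_def)
  then obtain Y where Y: "\<And>j. int_vec (Y j)" "\<And>j. M *v Y j = axis j 1" by metis
  \<comment> \<open>An integer right inverse: both determinants are integers with product 1, which
    gives the determinant of the relabelled matrix up to sign.\<close>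
  define N' :: "real ^ 'a idx ^ 'a idx" where "N' = (\<chi> k l. Y (of_idx l) $ of_idx k)"
  have "(M' ** N') $ k $ l = mat 1 $ k $ l" for k l
  proof -
    have "(M' ** N') $ k $ l = (\<Sum>m\<in>UNIV. M $ of_idx k $ of_idx m * Y (of_idx l) $ of_idx m)"
      by (simp add: matrix_matrix_mult_def M'_def N'_def)
    also have "\<dots> = (\<Sum>j\<in>UNIV. M $ of_idx k $ j * Y (of_idx l) $ j)"
      by (rule sum.reindex_bij_betw[OF bij_of_idx])
    also have "\<dots> = (M *v Y (of_idx l)) $ of_idx k" by (simp add: matrix_vector_mult_def)
    also have "\<dots> = mat 1 $ k $ l" by (simp add: Y(2) axis_def mat_def of_idx_inject)
    finally show ?thesis .
  qed
  then have "M' ** N' = mat 1" by (simp add: vec_eq_iff)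
  then have "det M' * det N' = 1" by (metis det_I det_mul)
  moreover have "det M' \<in> \<int>" "det N' \<in> \<int>"
    using int Y(1) by (auto intro!: det_Ints simp: M'_def N'_def int_vec_def)
  ultimately have det': "\<bar>det M'\<bar> = 1" using Ints_mult_eq_1_imp_abs by blast
  have rel: "relabel (M *v x) = M' *v relabel x" for x
  proof -
    have "(\<Sum>l\<in>UNIV. M $ of_idx k $ of_idx l * x $ of_idx l) = (\<Sum>j\<in>UNIV. M $ of_idx k $ j * x $ j)" for k
      by (rule sum.reindex_bij_betw[OF bij_of_idx])
    then show ?thesis by (simp add: relabel_def M'_def matrix_vector_mult_def vec_eq_iff)
  qed
  have "bounded (relabel ` S)"
    using S(2) linear_relabel by (intro bounded_linear_image) (simp_all add: linear_conv_bounded_linear)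
  then have lm: "relabel ` S \<in> lmeasurable"
    using relabel_image(1)[OF S(1)] by (intro bounded_set_imp_lmeasurable) auto
  have "measure lebesgue ((*v) M ` S) = measure lebesgue (relabel ` ((*v) M ` S))"
    using relabel_image(2) borel_linear_image[OF inv S(1)] by metis
  also have "relabel ` ((*v) M ` S) = (*v) M' ` (relabel ` S)" by (simp add: image_image rel)
  also have "measure lebesgue \<dots> = measure lebesgue (relabel ` S)"
    using measure_linear_image[OF matrix_vector_mul_linear lm, of M'] det' by simp
  finally show ?thesis using relabel_image(2)[OF S(1)] by simp
qed

lemma finite_occurrences: "finite {P. \<exists>r. w = P @ i # r}"
  by (rule finite_subset[of _ "set (prefixes w)"]) (auto simp: prefix_def)

lemma card_occurrences: "card {P. \<exists>r. w = P @ i # r} = count_list w i"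
proof (induction w)
  case (Cons a w)
  have eq: "{P. \<exists>r. a # w = P @ i # r}
      = (if a = i then {[]} else {}) \<union> (#) a ` {P. \<exists>r. w = P @ i # r}"
    by (auto simp: Cons_eq_append_conv)
  show ?case unfolding eq using Cons finite_occurrences[of w i] by (subst card_Un_disjoint) (auto simp: card_image)
qed simp

context price
begin

lemma sum_pieces:
  fixes f :: "'a \<Rightarrow> real"
  shows "(\<Sum>Pj\<in>pieces n m i. f (snd Pj)) = (\<Sum>j\<in>UNIV. A n m $ i $ j * f j)"
proof -
  have "pieces n m i = prod.swap ` (SIGMA j:UNIV. {P. \<exists>r. bs n m [j] = P @ i # r})"
    by (force simp: pieces_def)
  then have "(\<Sum>Pj\<in>pieces n m i. f (snd Pj))
      = (\<Sum>jP\<in>(SIGMA j:UNIV. {P. \<exists>r. bs n m [j] = P @ i # r}). f (fst jP))"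
    by (simp add: sum.reindex)
  also have "\<dots> = (\<Sum>j\<in>UNIV. \<Sum>P\<in>{P. \<exists>r. bs n m [j] = P @ i # r}. f j)"
    by (subst sum.Sigma) (auto simp: finite_occurrences case_prod_beta')
  finally show ?thesis by (simp add: card_occurrences block_matrix_nth)
qed

text \<open>Cylinders have infinite measure; a slab of width \<open>1\<close> for \<open>vn n\<close> cuts out a bounded part, and
  \<open>A n m\<close> carries the slabs of level \<open>m\<close> to those of level \<open>n\<close>.\<close>

definition bslab :: "nat \<Rightarrow> 'a \<Rightarrow> real \<Rightarrow> (real ^ 'a) set" where
  "bslab n i a = frontier (cyl n i) \<inter> {x. a \<le> vn n \<bullet> x \<and> vn n \<bullet> x < a + 1}"

definition bm :: "nat \<Rightarrow> 'a \<Rightarrow> real" where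
  "bm n i = measure lebesgue (bslab n i 0)"

lemma frontier_cyl_subset: "frontier (cyl n i) \<subseteq> cyl n i"
  by (simp add: frontier_subset_closed closed_cyl)

lemma cyl_slab_bounded: "bounded (cyl n i \<inter> {x. \<bar>vn n \<bullet> x\<bar> \<le> Q})"
proof -
  obtain K where K: "\<And>V. V \<in> fac n \<Longrightarrow> norm (proj n (ab V)) \<le> K"
    using fac_bounded by blast
  show ?thesis
    unfolding bounded_iff
    using norm_le_of_proj[OF vn_inner_ut_pos order_refl cyl_proj_bound[OF K]] by blast
qed

lemma bslab_borel: "bslab n i a \<in> sets borel"
proof -
  have "closed {x. a \<le> vn n \<bullet> x}" "open {x. vn n \<bullet> x < a + 1}"
    by (auto intro!: closed_Collect_le open_Collect_less continuous_intros)
  then have "{x. a \<le> vn n \<bullet> x} \<inter> {x. vn n \<bullet> x < a + 1} \<in> sets borel" by auto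
  moreover have "frontier (cyl n i) \<in> sets borel" by (simp add: borel_closed)
  ultimately show ?thesis unfolding bslab_def by (metis Collect_conj_eq sets.Int)
qed

lemma bslab_bounded: "bounded (bslab n i a)"
  by (rule bounded_subset[OF cyl_slab_bounded[of n i "\<bar>a\<bar> + 1"]])
    (use frontier_cyl_subset in \<open>auto simp: bslab_def\<close>)

lemma bslab_lmeasurable: "bslab n i a \<in> lmeasurable"
  using bslab_borel bslab_bounded by (intro bounded_set_imp_lmeasurable) auto

lemma frontier_cyl_translate:
  assumes "x \<in> frontier (cyl n i)" shows "x + t *\<^sub>R un n \<in> frontier (cyl n i)"
proof -
  have sub: "(+) (s *\<^sub>R un n) ` cyl n i \<subseteq> cyl n i" for s
    using cyl_translate[of _ n i s] by (auto simp: add.commute)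
  have "cyl n i \<subseteq> (+) (t *\<^sub>R un n) ` cyl n i"
  proof
    fix y assume "y \<in> cyl n i"
    then have "y + (- t) *\<^sub>R un n \<in> cyl n i" by (rule cyl_translate)
    then show "y \<in> (+) (t *\<^sub>R un n) ` cyl n i" by (rule rev_image_eqI) simp
  qed
  then have "(+) (t *\<^sub>R un n) ` cyl n i = cyl n i" using sub by blast
  then have "frontier (cyl n i) = (+) (t *\<^sub>R un n) ` frontier (cyl n i)"
    by (metis frontier_translation)
  then show ?thesis using assms by (metis add.commute image_eqI)
qed

text \<open>A translation along the axis preserves the frontier and moves one slab to
  another.\<close>

lemma measure_bslab: "measure lebesgue (bslab n i a) = bm n i"
proof -
  define t where "t = a / (v \<bullet> u)"
  have t: "vn n \<bullet> (t *\<^sub>R un n) = a" using v_inner_u_pos by (simp add: t_def vn_inner_un)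
  have "bslab n i a = (+) (t *\<^sub>R un n) ` bslab n i 0"
  proof (intro subset_antisym subsetI)
    fix x assume x: "x \<in> bslab n i a"
    have "x + (- t) *\<^sub>R un n \<in> frontier (cyl n i)"
      using x by (intro frontier_cyl_translate) (simp add: bslab_def)
    then have "x - t *\<^sub>R un n \<in> bslab n i 0"
      using x t by (auto simp: bslab_def inner_diff_right)
    then show "x \<in> (+) (t *\<^sub>R un n) ` bslab n i 0" by (rule rev_image_eqI) simp
  next
    fix x assume "x \<in> (+) (t *\<^sub>R un n) ` bslab n i 0"
    then obtain y where y: "y \<in> bslab n i 0" "x = y + t *\<^sub>R un n" by (auto simp: add.commute)
    then show "x \<in> bslab n i a"
      using frontier_cyl_translate[of y n i t] t by (auto simp: bslab_def inner_add_right)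
  qed
  then show ?thesis by (simp add: bm_def measure_translation)
qed

lemma bm_nonneg: "0 \<le> bm n i"
  by (simp add: bm_def)

text \<open>A frontier point lies in some piece. That piece is not in \<open>X\<close>, and the
  point is not interior to it, since the affine map of the piece is open.\<close>

lemma frontier_cyl_pieces:
  assumes "n \<le> m"
    and X: "\<And>P j. (P, j) \<in> X \<Longrightarrow> (\<lambda>x. ab P + A n m *v x) ` cyl m j \<subseteq> interior (cyl n i)"
  shows "frontier (cyl n i)
    \<subseteq> (\<Union>(P, j)\<in>pieces n m i - X. (\<lambda>x. ab P + A n m *v x) ` frontier (cyl m j))"
proof
  fix x assume x: "x \<in> frontier (cyl n i)"
  then have "x \<in> cyl n i" and not_int: "x \<notin> interior (cyl n i)"
    using frontier_cyl_subset by (auto simp: frontier_def)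
  then obtain P j y where y: "(P, j) \<in> pieces n m i" "y \<in> cyl m j" "x = ab P + A n m *v y"
    using cyl_eq[OF assms(1)] by blast
  define g where "g = (\<lambda>x. ab P + A n m *v x)"
  have "(P, j) \<notin> X" using X y not_int by blast
  moreover have "y \<notin> interior (cyl m j)"
  proof
    assume "y \<in> interior (cyl m j)"
    moreover have "open (g ` interior (cyl m j))"
    proof -
      have "surj ((*v) (A n m))"
        by (intro linear_injective_imp_surjective matrix_vector_mul_linear inj_matrix_vector_mult
            A_invertible) simp
      then have "open ((*v) (A n m) ` interior (cyl m j))"
        by (intro open_surjective_linear_image) auto
      then show ?thesis using open_translation[of "(*v) (A n m) ` interior (cyl m j)" "ab P"]
        by (simp add: image_image g_def)
    qed
    moreover have "g ` cyl m j \<subseteq> cyl n i" using cyl_eq[OF assms(1), of i] y(1) by (auto simp: g_def)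
    then have "g ` interior (cyl m j) \<subseteq> cyl n i" using interior_subset by blast
    ultimately have "x \<in> interior (cyl n i)"
      using y(3) unfolding g_def by (intro interiorI[of "g ` interior (cyl m j)"]) (auto simp: g_def)
    then show False using not_int by simp
  qed
  then have "y \<in> frontier (cyl m j)" using y(2) closed_cyl by (simp add: frontier_def)
  ultimately show "x \<in> (\<Union>(P, j)\<in>pieces n m i - X. (\<lambda>x. ab P + A n m *v x) ` frontier (cyl m j))"
    using y by blast
qed

lemma bm_le_pieces:
  assumes "n \<le> m"
    and X: "\<And>P j. (P, j) \<in> X \<Longrightarrow> (\<lambda>x. ab P + A n m *v x) ` cyl m j \<subseteq> interior (cyl n i)"
  shows "bm n i \<le> (\<Sum>Pj\<in>pieces n m i - X. bm m (snd Pj))"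
proof -
  define g where "g Pj x = ab (fst Pj) + A n m *v x" for Pj :: "'a list \<times> 'a" and x
  \<comment> \<open>The shift by \<open>ab (fst Pj)\<close> raises the height by
    \<open>vn n \<bullet> ab (fst Pj)\<close>, so the slab at level \<open>m\<close> starts lower by
    this amount.\<close>
  define Y where "Y Pj = bslab m (snd Pj) (- (vn n \<bullet> ab (fst Pj)))" for Pj
  have img: "g Pj ` Y Pj = (+) (ab (fst Pj)) ` ((*v) (A n m) ` Y Pj)" for Pj
    by (simp add: g_def image_image)
  have mY: "measure lebesgue (g Pj ` Y Pj) = bm m (snd Pj)" for Pj
    unfolding img measure_translation
    by (subst measure_unimodular_image[OF _ abs_det_A])
      (auto simp: Y_def bslab_borel bslab_bounded measure_bslab block_matrix_nth)
  have borel: "g Pj ` Y Pj \<in> sets borel" for Pj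
  proof -
    have "(*v) (A n m) ` Y Pj \<in> sets borel"
      by (intro borel_linear_image A_invertible) (simp add: Y_def bslab_borel)
    moreover have "(+) (ab (fst Pj)) ` T = (\<lambda>x. x - ab (fst Pj)) -` T" for T
      by (force simp: image_iff)
    moreover have "(\<lambda>x. x - ab (fst Pj)) \<in> borel_measurable borel" by measurable
    ultimately show ?thesis unfolding img
      using measurable_sets[of "\<lambda>x. x - ab (fst Pj)" borel borel] by simp
  qed
  have bdd: "bounded (g Pj ` Y Pj)" for Pj
    unfolding img
    by (intro bounded_translation bounded_linear_image matrix_vector_mul_bounded_linear) (simp add: Y_def bslab_bounded)
  have lm: "g Pj ` Y Pj \<in> lmeasurable" for Pj
    using borel bdd by (intro bounded_set_imp_lmeasurable) auto
  have "bslab n i 0 \<subseteq> (\<Union>Pj\<in>pieces n m i - X. g Pj ` Y Pj)"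
  proof
    fix x assume x: "x \<in> bslab n i 0"
    then have "x \<in> frontier (cyl n i)" by (simp add: bslab_def)
    then obtain P j y where y: "(P, j) \<in> pieces n m i - X" "y \<in> frontier (cyl m j)"
      "x = ab P + A n m *v y"
      using frontier_cyl_pieces[OF assms] by blast
    have "y \<in> Y (P, j)"
      using x y vn_inner_A[OF assms(1), of y] by (auto simp: bslab_def Y_def inner_add_right)
    then show "x \<in> (\<Union>Pj\<in>pieces n m i - X. g Pj ` Y Pj)"
      using y by (auto simp: g_def intro!: bexI[of _ "(P, j)"])
  qed
  then have "bm n i \<le> measure lebesgue (\<Union>Pj\<in>pieces n m i - X. g Pj ` Y Pj)"
    unfolding bm_def using lm finite_pieces
    by (intro measure_mono_fmeasurable fmeasurable.finite_UN) (auto intro: fmeasurableD bslab_lmeasurable)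
  also have "\<dots> \<le> (\<Sum>Pj\<in>pieces n m i - X. measure lebesgue (g Pj ` Y Pj))"
    using finite_pieces lm by (intro measure_UNION_le) (auto intro: fmeasurableD)
  finally show ?thesis by (simp add: mY)
qed

lemma bm_le: "n \<le> m \<Longrightarrow> bm n i \<le> (\<Sum>j\<in>UNIV. A n m $ i $ j * bm m j)"
  using bm_le_pieces[of n m "{}" i] by (simp add: sum_pieces)

lemma vn_nth_sum: "n \<le> m \<Longrightarrow> vn m $ j = (\<Sum>i\<in>UNIV. vn n $ i * A n m $ i $ j)"
  using vn_nth[of n m j] by (simp add: inner_vec_def ab_nth block_matrix_nth)

text \<open>Since \<open>vn n v* A n m = vn m\<close>, pairing \<open>bm_le\<close> with these
  weights gives \<open>total n \<le> total m\<close>.\<close>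

definition total :: "nat \<Rightarrow> real" where
  "total n = (\<Sum>i\<in>UNIV. vn n $ i * bm n i)"

lemma sum_vn_A: "n \<le> m \<Longrightarrow> (\<Sum>i\<in>UNIV. vn n $ i * (\<Sum>j\<in>UNIV. A n m $ i $ j * bm m j)) = total m"
proof -
  assume "n \<le> m"
  have "(\<Sum>i\<in>UNIV. vn n $ i * (\<Sum>j\<in>UNIV. A n m $ i $ j * bm m j))
      = (\<Sum>j\<in>UNIV. \<Sum>i\<in>UNIV. vn n $ i * A n m $ i $ j * bm m j)"
    by (simp add: sum_distrib_left mult.assoc) (rule sum.swap)
  then show ?thesis using vn_nth_sum[OF \<open>n \<le> m\<close>] by (simp add: total_def sum_distrib_right)
qed

lemma total_mono:
  assumes "n \<le> m" shows "total n \<le> total m"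
proof -
  have "total n \<le> (\<Sum>i\<in>UNIV. vn n $ i * (\<Sum>j\<in>UNIV. A n m $ i $ j * bm m j))"
    unfolding total_def using vn_nonneg by (intro sum_mono mult_left_mono bm_le assms) auto
  then show ?thesis by (simp add: sum_vn_A[OF assms])
qed

lemma total_nonneg: "0 \<le> total n"
  unfolding total_def using vn_nonneg bm_nonneg by (intro sum_nonneg) auto

text \<open>By (R) the block before level \<open>Nk k\<close> is also \<open>B\<close>.\<close>

lemma vn_Nk_comparable: "vn (Nk k) $ j \<le> \<beta> * vn (Nk k) $ j'"
proof -
  define m where "m = nk k + (lk k - h)"
  have "A m (Nk k) = B"
    unfolding m_def using A_recurrent[of "lk k" k "lk k - h"] block_B by simp
  then have eq: "vn (Nk k) $ j = (\<Sum>i\<in>UNIV. vn m $ i * B $ i $ j)" for j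
    using vn_nth_sum[of m "Nk k" j] by (simp add: m_def)
  have "B $ i $ j \<le> \<beta> * B $ i $ j'" for i
    using mult_mono[OF B_le_\<beta>[of i j] B_ge_1[of i j']] \<beta>_ge_1 B_pos[of i j] by simp
  then have "(\<Sum>i\<in>UNIV. vn m $ i * B $ i $ j) \<le> (\<Sum>i\<in>UNIV. vn m $ i * (\<beta> * B $ i $ j'))"
    using vn_nonneg by (intro sum_mono mult_left_mono) auto
  then show ?thesis unfolding eq by (simp add: sum_distrib_left mult_ac)
qed

text \<open>About \<open>V\<close> unit slabs of equal boundary measure are stacked. As the
  coordinates of \<open>vn\<close> are comparable, the stack up to height of order \<open>V\<close>
  fits into a ball whose radius does not depend on \<open>k\<close>.\<close>

lemma bm_Nk_le:
  assumes V: "V = (\<Sum>j\<in>UNIV. vn (Nk k) $ j)" and c: "0 < c" "c \<le> V"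
    and R: "R = real CARD('a) * C + (1 + 1 / c + real CARD('a) * C) * (real CARD('a) * \<beta>)"
  shows "bm (Nk k) i * V \<le> measure lebesgue (cball (0 :: real ^ 'a) R)"
proof -
  define n where "n = Nk k"
  \<comment> \<open>Rounding up costs at most the factor \<open>1 + 1 / c\<close>, as
    \<open>V\<close> is at least \<open>c\<close>.\<close>
  define q where "q = nat \<lceil>V\<rceil>"
  define P where "P = real CARD('a) * C"
  have P: "0 \<le> P" using C_pos by (simp add: P_def)
  have V0: "0 < V" using c by simp
  have q: "V \<le> real q" "real q \<le> V + 1" using V0 by (auto simp: q_def ceiling_correct)
  have q': "real q \<le> (1 + 1 / c) * V"
  proof -
    have "1 \<le> 1 / c * V" using c by simp
    then show ?thesis using q(2) by (simp add: distrib_right)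
  qed
  have disj: "pairwise (\<lambda>a b. disjnt (bslab n i (real a)) (bslab n i (real b))) {..<q}"
  proof -
    have "a = b" if "x \<in> bslab n i (real a)" "x \<in> bslab n i (real b)" for a b x
    proof -
      have "real a < real b + 1" "real b < real a + 1" using that by (auto simp: bslab_def)
      then show ?thesis by linarith
    qed
    then show ?thesis unfolding pairwise_def disjnt_iff by blast
  qed
  have sub: "(\<Union>a<q. bslab n i (real a)) \<subseteq> cball 0 R"
  proof clarify
    fix a x assume a: "a < q" and x: "x \<in> bslab n i (real a)"
    have "0 \<le> vn n \<bullet> x" "vn n \<bullet> x < real a + 1" using x by (auto simp: bslab_def)
    then have vx: "\<bar>vn n \<bullet> x\<bar> \<le> (1 + 1 / c) * V" using a q' by simp
    have "x \<in> cyl n i" using x frontier_cyl_subset by (auto simp: bslab_def)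
    then have px: "norm (proj n x) \<le> P"
      using cyl_proj_bound[OF fac_Nk_bounded] unfolding n_def P_def by blast
    have low: "V / (real CARD('a) * \<beta>) \<le> vn n \<bullet> ut n"
    proof -
      have "V \<le> real CARD('a) * (\<beta> * vn n $ j)" for j
        unfolding V using sum_bounded_above[of UNIV "\<lambda>i. vn (Nk k) $ i" "\<beta> * vn n $ j"] vn_Nk_comparable[of k _ j]
        by (simp add: n_def)
      then have "V / (real CARD('a) * \<beta>) \<le> vn n $ j" for j
        using \<beta>_ge_1 by (simp add: divide_le_eq mult_ac)
      then have "(\<Sum>j\<in>UNIV. V / (real CARD('a) * \<beta>) * ut n $ j) \<le> vn n \<bullet> ut n"
        unfolding inner_vec_def inner_real_def using ut_pos[THEN less_imp_le, of n]
        by (intro sum_mono mult_right_mono) auto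
      moreover have "(\<Sum>j\<in>UNIV. ut n $ j) = 1" using inner_one_ut[of n] by (simp add: inner_one_vec)
      ultimately show ?thesis unfolding sum_distrib_left[symmetric] by simp
    qed
    have nv: "norm (vn n) \<le> V"
      using norm_le_l1_cart[of "vn n"] vn_nonneg by (simp add: V n_def)
    have pos: "0 < V / (real CARD('a) * \<beta>)" using V0 \<beta>_ge_1 by simp
    have "norm x \<le> P + ((1 + 1 / c) * V + norm (vn n) * P) / (V / (real CARD('a) * \<beta>))"
      by (rule norm_le_of_proj[OF pos low px vx])
    also have "\<dots> \<le> P + ((1 + 1 / c) * V + V * P) / (V / (real CARD('a) * \<beta>))"
      using nv P pos by (intro add_left_mono divide_right_mono mult_right_mono) auto
    also have "\<dots> = R" using V0 by (simp add: R P_def field_simps)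
    finally show "x \<in> cball 0 R" by simp
  qed
  have "bm n i * V \<le> bm n i * real q" using q(1) bm_nonneg by (intro mult_left_mono) auto
  also have "\<dots> = (\<Sum>a<q. measure lebesgue (bslab n i (real a)))" by (simp add: measure_bslab)
  also have "\<dots> = measure lebesgue (\<Union>a<q. bslab n i (real a))"
    using disj bslab_lmeasurable by (intro measure_UNION'[symmetric]) auto
  also have "\<dots> \<le> measure lebesgue (cball (0 :: real ^ 'a) R)"
    using bslab_lmeasurable by (intro measure_mono_fmeasurable sub sets.finite_UN) (auto intro: fmeasurableD)
  finally show ?thesis by (simp add: n_def)
qed

lemma total_bounded: "\<exists>S. \<forall>n. total n \<le> S"
proof -
  obtain i0 where c: "0 < v $ i0" using v_pos_letter by blast
  define R where "R = real CARD('a) * C + (1 + 1 / (v $ i0) + real CARD('a) * C) * (real CARD('a) * \<beta>)"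
  define S where "S = measure lebesgue (cball (0 :: real ^ 'a) R)"
  have "total (Nk k) \<le> S" for k
  proof -
    define V where "V = (\<Sum>j\<in>UNIV. vn (Nk k) $ j)"
    obtain j where j: "1 \<le> A 0 (Nk k) $ i0 $ j" using A_row_nonzero by blast
    have "v $ i0 * 1 \<le> v $ i0 * A 0 (Nk k) $ i0 $ j" using j c by (intro mult_left_mono) auto
    also have "\<dots> \<le> vn (Nk k) $ j"
      unfolding vn_nth_sum[OF le0] vn_0 using v_nonneg A_nonneg by (intro member_le_sum) auto
    also have "\<dots> \<le> V" unfolding V_def using vn_nonneg by (intro member_le_sum) auto
    finally have V: "v $ i0 \<le> V" by simp
    have "V * total (Nk k) = (\<Sum>i\<in>UNIV. vn (Nk k) $ i * (bm (Nk k) i * V))"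
      by (simp add: total_def sum_distrib_left mult_ac)
    also have "\<dots> \<le> (\<Sum>i\<in>UNIV. vn (Nk k) $ i * S)"
      unfolding S_def using vn_nonneg by (intro sum_mono mult_left_mono bm_Nk_le[OF V_def c V R_def]) auto
    also have "\<dots> = V * S" by (simp add: V_def sum_distrib_right)
    finally show ?thesis using V c by simp
  qed
  moreover have "n \<le> Nk n" for n using nk_ge[of n] by simp
  ultimately have "total n \<le> S" for n using total_mono order_trans by metis
  then show ?thesis by blast
qed

text \<open>In the tile of \<open>i0\<close> at level \<open>nk k\<close> one piece per end letter
  is interior and drops out of the boundary estimate. This costs a fixed share \<delta> of the
  total, so the supremum \<open>S\<close> of the totals satisfies
  \<open>(1 + \<delta>) * S \<le> S\<close>.\<close>

lemma total_eq_0: "total n = 0"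
proof -
  obtain l i0 k0 where v: "0 < v $ i0" and l: "\<And>k. k \<ge> k0 \<Longrightarrow> l \<le> lk k"
    and int: "\<And>j. \<exists>P r. bs 0 l [j] = P @ i0 # r \<and> (\<forall>k\<ge>k0.
       (\<lambda>x. ab P + A 0 l *v x) ` cyl (nk k + l) j \<subseteq> interior (cyl (nk k) i0))"
    by (rule interior_pieces) (rule that; assumption)
  obtain P where P: "\<And>j. \<exists>r. bs 0 l [j] = P j @ i0 # r"
    and P_int: "\<And>j k. k \<ge> k0 \<Longrightarrow>
      (\<lambda>x. ab (P j) + A 0 l *v x) ` cyl (nk k + l) j \<subseteq> interior (cyl (nk k) i0)"
    using int by metis
  define X where "X = range (\<lambda>j. (P j, j))"
  define \<Lambda> where "\<Lambda> = 1 + (\<Sum>j\<in>UNIV. \<Sum>i\<in>UNIV. A 0 l $ i $ j)"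
  have \<Lambda>: "0 < \<Lambda>" unfolding \<Lambda>_def using A_nonneg by (intro add_pos_nonneg sum_nonneg) auto
  \<comment> \<open>The loss has weight \<open>vn (nk k) $ i0\<close>, at least
    \<open>v $ i0 / 2\<close> times the maximum norm by (E), whereas the weights at level
    \<open>nk k + l\<close> are at most \<Lambda> times that norm.\<close>
  define \<delta> where "\<delta> = v $ i0 / (2 * \<Lambda>)"
  have \<delta>: "0 < \<delta>" using v \<Lambda> by (simp add: \<delta>_def)
  have step: "total (nk k) + \<delta> * total (nk k + l) \<le> total (nk k + l)"
    if k: "k \<ge> k0" and vk: "v $ i0 / 2 < vt (nk k) $ i0" for k
  proof -
    define I where "I = infnorm (vn (nk k))"
    define \<Sigma> where "\<Sigma> = (\<Sum>j\<in>UNIV. bm (nk k + l) j)"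
    have I: "0 < I" unfolding I_def by (rule infnorm_vn_pos)
    have \<Sigma>: "0 \<le> \<Sigma>" unfolding \<Sigma>_def using bm_nonneg by (intro sum_nonneg) auto
    have bs_eq: "bs (nk k) (nk k + l) = bs 0 l" and A_eq: "A (nk k) (nk k + l) = A 0 l"
      using bs_recurrent[OF l[OF k], of 0] A_recurrent[OF l[OF k], of 0] by simp_all
    have sub: "X \<subseteq> pieces (nk k) (nk k + l) i0"
      using P by (auto simp: X_def pieces_def bs_eq)
    have "bm (nk k) i0 \<le> (\<Sum>Pj\<in>pieces (nk k) (nk k + l) i0 - X. bm (nk k + l) (snd Pj))"
      by (rule bm_le_pieces) (use P_int[OF k] in \<open>auto simp: X_def A_eq\<close>)
    also have "\<dots> = (\<Sum>Pj\<in>pieces (nk k) (nk k + l) i0. bm (nk k + l) (snd Pj)) - (\<Sum>Pj\<in>X. bm (nk k + l) (snd Pj))"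
      using finite_pieces sub by (rule sum_diff)
    also have "(\<Sum>Pj\<in>X. bm (nk k + l) (snd Pj)) = \<Sigma>"
      unfolding X_def \<Sigma>_def by (subst sum.reindex) (auto simp: inj_def)
    finally have loss: "bm (nk k) i0 \<le> (\<Sum>j\<in>UNIV. A (nk k) (nk k + l) $ i0 $ j * bm (nk k + l) j) - \<Sigma>"
      by (simp add: sum_pieces)
    have "total (nk k) \<le> (\<Sum>i\<in>UNIV. vn (nk k) $ i * ((\<Sum>j\<in>UNIV. A (nk k) (nk k + l) $ i $ j * bm (nk k + l) j)
        - (if i = i0 then \<Sigma> else 0)))"
      unfolding total_def using loss vn_nonneg bm_le[of "nk k" "nk k + l"]
      by (intro sum_mono mult_left_mono) auto
    also have "\<dots> = total (nk k + l) - vn (nk k) $ i0 * \<Sigma>"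
    proof -
      have "vn (nk k) $ i * (x - (if i = i0 then \<Sigma> else 0))
          = vn (nk k) $ i * x - (if i = i0 then vn (nk k) $ i0 * \<Sigma> else 0)" for i x
        by (simp add: right_diff_distrib)
      then show ?thesis using sum_vn_A[of "nk k" "nk k + l"] by (simp only: sum_subtractf) simp
    qed
    finally have 1: "total (nk k) \<le> total (nk k + l) - vn (nk k) $ i0 * \<Sigma>" .
    have "vn (nk k + l) $ j \<le> I * \<Lambda>" for j
    proof -
      have "vn (nk k + l) $ j = (\<Sum>i\<in>UNIV. vn (nk k) $ i * A 0 l $ i $ j)"
        using vn_nth_sum[of "nk k" "nk k + l" j] by (simp add: A_eq)
      also have "\<dots> \<le> (\<Sum>i\<in>UNIV. I * A 0 l $ i $ j)"
        using component_le_infnorm_cart[of "vn (nk k)"] A_nonneg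
        by (intro sum_mono mult_right_mono) (auto simp: I_def intro: order_trans[OF abs_ge_self])
      also have "\<dots> = I * (\<Sum>i\<in>UNIV. A 0 l $ i $ j)" by (simp add: sum_distrib_left)
      also have "(\<Sum>i\<in>UNIV. A 0 l $ i $ j) \<le> (\<Sum>j\<in>UNIV. \<Sum>i\<in>UNIV. A 0 l $ i $ j)"
        using A_nonneg by (intro member_le_sum sum_nonneg) auto
      also have "\<dots> \<le> \<Lambda>" by (simp add: \<Lambda>_def)
      finally show ?thesis using I by simp
    qed
    then have "total (nk k + l) \<le> (\<Sum>j\<in>UNIV. I * \<Lambda> * bm (nk k + l) j)"
      unfolding total_def using bm_nonneg by (intro sum_mono mult_right_mono) auto
    then have "\<delta> * total (nk k + l) \<le> \<delta> * (I * \<Lambda> * \<Sigma>)"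
      using \<delta> by (intro mult_left_mono) (auto simp: \<Sigma>_def sum_distrib_left)
    also have "\<dots> = (v $ i0 / 2 * I) * \<Sigma>" using \<Lambda> by (simp add: \<delta>_def)
    also have "\<dots> \<le> (vt (nk k) $ i0 * I) * \<Sigma>"
      using vk I \<Sigma> by (intro mult_right_mono) auto
    also have "vt (nk k) $ i0 * I = vn (nk k) $ i0" using I by (simp add: vt_def I_def)
    finally show ?thesis using 1 by linarith
  qed
  have "(\<lambda>k. vt (nk k) $ i0) \<longlonglongrightarrow> v $ i0" by (intro tendsto_intros vt_tendsto)
  from order_tendstoD(1)[OF this, of "v $ i0 / 2"] obtain k1 where
    k1: "\<And>k. k \<ge> k1 \<Longrightarrow> v $ i0 / 2 < vt (nk k) $ i0"
    using v unfolding eventually_sequentially by auto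
  define S where "S = Sup (range total)"
  have bdd: "bdd_above (range total)" using total_bounded by (auto simp: bdd_above_def)
  have le_S: "total m \<le> S" for m unfolding S_def using bdd by (intro cSUP_upper) auto
  have "(1 + \<delta>) * total m \<le> S" for m
  proof -
    define k where "k = max m (max k0 k1)"
    have "total m \<le> total (nk k)" using nk_ge[of k] by (intro total_mono) (simp add: k_def)
    then have "(1 + \<delta>) * total m \<le> (1 + \<delta>) * total (nk k)" using \<delta> by (intro mult_left_mono) auto
    also have "\<dots> \<le> total (nk k) + \<delta> * total (nk k + l)"
      using \<delta> total_mono[of "nk k" "nk k + l"] by (simp add: distrib_right)
    also have "\<dots> \<le> total (nk k + l)" using k1 by (intro step) (auto simp: k_def)
    also have "\<dots> \<le> S" by (rule le_S)
    finally show ?thesis .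
  qed
  then have "total m \<le> S / (1 + \<delta>)" for m
    using \<delta> by (simp add: pos_le_divide_eq mult.commute)
  then have "S \<le> S / (1 + \<delta>)" unfolding S_def by (intro cSUP_least) auto
  then have "\<delta> * S \<le> 0" using \<delta> by (simp add: pos_le_divide_eq algebra_simps)
  then have "S \<le> 0" using \<delta> by (simp add: mult_le_0_iff)
  then show ?thesis using le_S[of n] total_nonneg[of n] by linarith
qed

text \<open>As \<open>v\<close> may have zero coordinates, \<open>total 0 = 0\<close> does not
  suffice. At a deep level all weights are positive, so all boundary measures vanish there, and
  \<open>bm_le\<close> brings this back to level 0.\<close>

lemma negligible_frontier_cyl: "negligible (frontier (cyl 0 i))"
proof -
  obtain i0 where i0: "0 < v $ i0" using v_pos_letter by blast
  obtain n where n: "\<And>i j. 1 \<le> A 0 n $ i $ j" using A_eventually_ge_1 by blast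
  have "bm n j = 0" for j
  proof -
    have "v $ i0 * 1 \<le> v $ i0 * A 0 n $ i0 $ j" using n i0 by (intro mult_left_mono) auto
    also have "\<dots> \<le> vn n $ j"
      unfolding vn_nth_sum[OF le0] vn_0 using v_nonneg A_nonneg by (intro member_le_sum) auto
    finally have "0 < vn n $ j" using i0 by simp
    moreover have "vn n $ j * bm n j \<le> total n"
      unfolding total_def using vn_nonneg bm_nonneg by (intro member_le_sum) auto
    ultimately show ?thesis using bm_nonneg[of n j] by (simp add: total_eq_0 mult_le_0_iff)
  qed
  then have "bm 0 i \<le> 0" using bm_le[OF le0, of i n] by simp
  then have "bm 0 i = 0" using bm_nonneg[of 0 i] by simp
  then have neg: "negligible (bslab 0 i a)" for a
    using measure_bslab[of 0 i a] bslab_lmeasurable by (simp add: negligible_iff_measure)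
  have "frontier (cyl 0 i) \<subseteq> (\<Union>a::int. bslab 0 i (of_int a))"
  proof
    fix x assume "x \<in> frontier (cyl 0 i)"
    then have "x \<in> bslab 0 i (of_int \<lfloor>vn 0 \<bullet> x\<rfloor>)" by (simp add: bslab_def)
    then show "x \<in> (\<Union>a::int. bslab 0 i (of_int a))" by blast
  qed
  moreover have "negligible (\<Union>a::int. bslab 0 i (of_int a))"
    using neg by (intro negligible_countable_Union) auto
  ultimately show ?thesis by (rule negligible_subset[rotated])
qed

end

section \<open>Lebesgue measure on the hyperplane\<close>

lemma inner_bij_Basis:
  assumes "bij_betw \<psi> I Basis" "b \<in> I" "c \<in> I"
  shows "\<psi> b \<bullet> \<psi> c = (if b = c then 1 else 0)"
  using assms inner_Basis[of "\<psi> b" "\<psi> c"] bij_betwE[OF assms(1)]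
  by (auto simp: bij_betw_def inj_on_def)

text \<open>The index set is abstract because later a basis of the hyperplane, together with its
  normal vector, only labels the coordinates.\<close>

lemma distr_lborel_orthonormal:
  fixes \<psi> :: "'c \<Rightarrow> 'v::euclidean_space"
  assumes \<psi>: "bij_betw \<psi> I Basis" and fin: "finite I"
  shows "distr (\<Pi>\<^sub>M b\<in>I. (lborel :: real measure)) borel (\<lambda>f. \<Sum>b\<in>I. f b *\<^sub>R \<psi> b) = lborel"
proof (rule lborel_eqI[symmetric])
  interpret product_sigma_finite "\<lambda>_. lborel :: real measure" by standard
  let ?P = "\<Pi>\<^sub>M b\<in>I. (lborel :: real measure)"
  let ?f = "\<lambda>f. \<Sum>b\<in>I. f b *\<^sub>R \<psi> b"
  have coord: "?f f \<bullet> \<psi> b = f b" if "b \<in> I" for f b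
  proof -
    have "f c *\<^sub>R \<psi> c \<bullet> \<psi> b = (if c = b then f b else 0)" if "c \<in> I" for c
      using inner_bij_Basis[OF \<psi> that \<open>b \<in> I\<close>] by simp
    then have "(\<Sum>c\<in>I. f c *\<^sub>R \<psi> c \<bullet> \<psi> b) = (\<Sum>c\<in>I. if c = b then f b else 0)" by (intro sum.cong) auto
    then show ?thesis using fin that by (simp add: inner_sum_left)
  qed
  have [measurable]: "?f \<in> ?P \<rightarrow>\<^sub>M borel" by measurable
  fix l u :: 'v assume le: "\<And>b. b \<in> Basis \<Longrightarrow> l \<bullet> b \<le> u \<bullet> b"
  have le': "l \<bullet> \<psi> b \<le> u \<bullet> \<psi> b" if "b \<in> I" for b
    using le \<psi> that by (auto simp: bij_betw_def)
  have "?f -` box l u \<inter> space ?P = Pi\<^sub>E I (\<lambda>b. {l \<bullet> \<psi> b<..<u \<bullet> \<psi> b})"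
  proof -
    have "?f f \<in> box l u \<longleftrightarrow> (\<forall>b\<in>I. f b \<in> {l \<bullet> \<psi> b<..<u \<bullet> \<psi> b})" for f
    proof -
      have "?f f \<in> box l u \<longleftrightarrow> (\<forall>b\<in>I. l \<bullet> \<psi> b < ?f f \<bullet> \<psi> b \<and> ?f f \<bullet> \<psi> b < u \<bullet> \<psi> b)"
        unfolding mem_box bij_betw_imp_surj_on[OF \<psi>, symmetric] ball_simps ..
      then show ?thesis using coord by simp
    qed
    then show ?thesis by (auto simp: space_PiM PiE_iff)
  qed
  then have "emeasure (distr ?P borel ?f) (box l u) = emeasure ?P (Pi\<^sub>E I (\<lambda>b. {l \<bullet> \<psi> b<..<u \<bullet> \<psi> b}))"
    by (simp add: emeasure_distr)
  also have "\<dots> = (\<Prod>b\<in>I. emeasure lborel {l \<bullet> \<psi> b<..<u \<bullet> \<psi> b})"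
    using fin by (intro emeasure_PiM) auto
  also have "\<dots> = (\<Prod>b\<in>I. ennreal ((u - l) \<bullet> \<psi> b))"
    using le' by (intro prod.cong) (auto simp: inner_diff_left)
  also have "\<dots> = ennreal (\<Prod>b\<in>I. (u - l) \<bullet> \<psi> b)"
    using le' by (intro prod_ennreal) (auto simp: inner_diff_left)
  also have "(\<Prod>b\<in>I. (u - l) \<bullet> \<psi> b) = (\<Prod>b\<in>Basis. (u - l) \<bullet> b)"
    by (rule prod.reindex_bij_betw[OF \<psi>])
  finally show "emeasure (distr ?P borel ?f) (box l u) = (\<Prod>b\<in>Basis. (u - l) \<bullet> b)" .
qed simp

text \<open>Fubini: the set is a product with a full line, which has infinite measure, so the base
  must be null.\<close>

lemma emeasure_PiM_insert_zero:
  fixes F :: "'v::euclidean_space set" and g :: "'c \<Rightarrow> 'v"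
  assumes "finite I" "i \<notin> I" "F \<in> sets borel"
    and "emeasure (\<Pi>\<^sub>M b\<in>insert i I. (lborel :: real measure))
      ((\<lambda>f. \<Sum>b\<in>I. f b *\<^sub>R g b) -` F \<inter> space (\<Pi>\<^sub>M b\<in>insert i I. lborel)) = 0"
  shows "emeasure (\<Pi>\<^sub>M b\<in>I. (lborel :: real measure))
      ((\<lambda>f. \<Sum>b\<in>I. f b *\<^sub>R g b) -` F \<inter> space (\<Pi>\<^sub>M b\<in>I. lborel)) = 0"
proof -
  interpret product_sigma_finite "\<lambda>_. lborel :: real measure" by standard
  let ?P = "\<Pi>\<^sub>M b\<in>I. (lborel :: real measure)" and ?Q = "\<Pi>\<^sub>M b\<in>insert i I. (lborel :: real measure)"
  let ?f = "\<lambda>f. \<Sum>b\<in>I. f b *\<^sub>R g b"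
  have [measurable]: "?f \<in> ?P \<rightarrow>\<^sub>M borel" "F \<in> sets borel" using assms(3) by measurable
  have [measurable]: "?f \<in> ?Q \<rightarrow>\<^sub>M borel"
    by (intro borel_measurable_sum borel_measurable_scaleR borel_measurable_const measurable_component_singleton[THEN measurable_compose] measurable_lborel1 measurable_ident_sets) auto
  have "0 = (\<integral>\<^sup>+f. indicator F (?f f) \<partial>?Q)"
  proof -
    have "(\<integral>\<^sup>+f. indicator F (?f f) \<partial>?Q) = (\<integral>\<^sup>+f. indicator (?f -` F \<inter> space ?Q) f \<partial>?Q)"
      by (intro nn_integral_cong) (auto simp: indicator_def)
    also have "\<dots> = emeasure ?Q (?f -` F \<inter> space ?Q)"
      by (intro nn_integral_indicator) measurable
    finally show ?thesis using assms(4) by simp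
  qed
  also have "\<dots> = (\<integral>\<^sup>+x. (\<integral>\<^sup>+y. indicator F (?f (x(i := y))) \<partial>lborel) \<partial>?P)"
    using assms(1,2) by (intro product_nn_integral_insert) measurable
  also have "\<dots> = (\<integral>\<^sup>+x. indicator F (?f x) * \<infinity> \<partial>?P)"
  proof (intro nn_integral_cong)
    fix x
    have "?f (x(i := y)) = ?f x" for y using assms(2) by (intro sum.cong) auto
    then show "(\<integral>\<^sup>+y. indicator F (?f (x(i := y))) \<partial>lborel) = indicator F (?f x) * \<infinity>" by simp
  qed
  finally have "(\<integral>\<^sup>+x. indicator F (?f x) * \<infinity> \<partial>?P) = 0" by simp
  then have "AE x in ?P. indicator F (?f x) * (\<infinity> :: ennreal) = 0"
    by (subst (asm) nn_integral_0_iff_AE) measurable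
  then have "AE x in ?P. ?f x \<notin> F"
    by (rule AE_mp) (auto simp: indicator_def split: if_splits)
  then show ?thesis
    by (subst (asm) AE_iff_measurable[of "?f -` F \<inter> space ?P"]) (auto intro: measurable_sets)
qed

text \<open>A null set swept out by lines transversal to the hyperplane has a null base. The
  direction \<open>e\<close> need not be orthogonal to the hyperplane, as a linear isomorphism
  straightens it.\<close>

lemma null_sets_lebesgue_subspace:
  fixes w e :: "'v::euclidean_space"
  assumes we: "w \<bullet> e \<noteq> 0" and F: "F \<subseteq> orthogonal_hyperplane w" "F \<in> sets borel"
    and neg: "negligible {x + t *\<^sub>R e | x t. x \<in> F}"
  shows "F \<in> null_sets (lebesgue_subspace (orthogonal_hyperplane w))"
proof -
  define V where "V = orthogonal_hyperplane w"
  have w0: "w \<noteq> 0" using we by auto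
  have V: "subspace V" "dim V = DIM('v) - 1"
    using dim_hyperplane[OF w0] subspace_hyperplane[of w] by (simp_all add: V_def orthogonal_hyperplane_def)
  define B where "B = (SOME B. orthonormal_basis_of V B)"
  have B: "orthonormal_basis_of V B"
    unfolding B_def using orthonormal_basis_of_exists[OF V(1)] by (rule someI_ex)
  then have orth: "pairwise orthogonal B" "\<And>b. b \<in> B \<Longrightarrow> norm b = 1" "span B = V"
    by (auto simp: orthonormal_basis_of_def)
  have "0 \<notin> B" using orth(2) by force
  then have indep: "independent B" using orth(1) by (intro pairwise_orthogonal_independent)
  then have fin: "finite B" by (rule independent_imp_finite)
  have "card B = DIM('v) - 1" using V(2) indep orth(3) by (metis dim_span_eq_card_independent)
  moreover have wB: "w \<notin> B"
  proof
    assume "w \<in> B"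
    then have "w \<in> V" using orth(3) span_base by blast
    then show False using w0 by (simp add: V_def orthogonal_hyperplane_def)
  qed
  ultimately have "card (insert w B) = card (Basis :: 'v set)"
    using fin DIM_positive[where 'a='v] by simp
  then obtain \<psi> where \<psi>: "bij_betw \<psi> (insert w B) (Basis :: 'v set)"
    using finite_same_card_bij[of "insert w B" "Basis :: 'v set"] fin by auto
  note \<psi>_inner = inner_bij_Basis[OF \<psi>]
  define p where "p y = (\<Sum>b\<in>B. (y \<bullet> \<psi> b) *\<^sub>R b)" for y
  \<comment> \<open>\<open>T\<close> carries the standard coordinates to the basis \<open>B\<close>
    together with \<open>e\<close>; being injective, it has a linear left inverse, under which null
    sets stay null.\<close>
  define T where "T y = p y + (y \<bullet> \<psi> w) *\<^sub>R e" for y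
  have wp: "w \<bullet> p y = 0" for y
  proof -
    have "p y \<in> V" unfolding p_def orth(3)[symmetric] by (intro span_sum span_scale span_base)
    then show ?thesis by (simp add: V_def orthogonal_hyperplane_def)
  qed
  have lin: "linear T"
    by (auto intro!: linearI simp: T_def p_def inner_add_left sum.distrib scaleR_sum_right algebra_simps)
  have "inj T"
  proof (subst linear_injective_0[OF lin], intro allI impI)
    fix y assume Ty: "T y = 0"
    then have "w \<bullet> T y = 0" by simp
    then have yw: "y \<bullet> \<psi> w = 0" using we by (simp add: T_def inner_add_right wp)
    then have p0: "(\<Sum>b\<in>B. (y \<bullet> \<psi> b) *\<^sub>R b) = 0" using Ty by (simp add: T_def p_def)
    have "\<forall>c. (\<Sum>b\<in>B. c b *\<^sub>R b) = 0 \<longrightarrow> (\<forall>b\<in>B. c b = 0)"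
      using indep by (simp add: independent_explicit)
    from this[rule_format, OF p0] have "y \<bullet> \<psi> b = 0" if "b \<in> B" for b
      using that by blast
    then have "y \<bullet> c = 0" if "c \<in> Basis" for c
      using that yw unfolding bij_betw_imp_surj_on[OF \<psi>, symmetric] by auto
    then show "y = 0" by (simp add: euclidean_eq_iff[of y 0])
  qed
  then obtain g where g: "linear g" "\<And>y. g (T y) = y"
    using linear_injective_left_inverse[OF lin] by (auto simp: fun_eq_iff)
  define N where "N = p -` F"
  have [measurable]: "p \<in> borel_measurable borel" "F \<in> sets borel" unfolding p_def using F(2) by measurable
  have "N \<subseteq> g ` {x + t *\<^sub>R e | x t. x \<in> F}"
  proof
    fix y assume "y \<in> N"
    then have "T y \<in> {x + t *\<^sub>R e | x t. x \<in> F}" by (auto simp: N_def T_def)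
    then show "y \<in> g ` {x + t *\<^sub>R e | x t. x \<in> F}" by (rule rev_image_eqI) (simp add: g(2))
  qed
  moreover have "negligible (g ` {x + t *\<^sub>R e | x t. x \<in> F})"
    using g(1) by (intro negligible_differentiable_image_negligible neg
        bounded_linear_imp_differentiable_on) (simp_all add: linear_conv_bounded_linear)
  ultimately have "negligible N" by (rule negligible_subset[rotated])
  moreover have N: "N \<in> sets borel" unfolding N_def using measurable_sets[of p borel borel F] by simp
  ultimately have "emeasure lborel N = 0"
    using null_sets_completion_iff[of N lborel] by (simp add: negligible_iff_null_sets null_sets_def)
  let ?Q = "\<Pi>\<^sub>M b\<in>insert w B. (lborel :: real measure)"
  let ?\<Phi> = "\<lambda>f. \<Sum>b\<in>insert w B. f b *\<^sub>R \<psi> b"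
  have "0 = emeasure (distr ?Q borel ?\<Phi>) N"
    using distr_lborel_orthonormal[OF \<psi>] fin \<open>emeasure lborel N = 0\<close> by simp
  also have "\<dots> = emeasure ?Q (?\<Phi> -` N \<inter> space ?Q)"
    by (intro emeasure_distr N) measurable
  also have "?\<Phi> -` N = (\<lambda>f. \<Sum>b\<in>B. f b *\<^sub>R b) -` F"
  proof -
    have "?\<Phi> f \<bullet> \<psi> b = f b" if "b \<in> B" for f b
    proof -
      have "?\<Phi> f \<bullet> \<psi> b = (\<Sum>c\<in>insert w B. if c = b then f b else 0)"
        unfolding inner_sum_left using \<psi>_inner that by (intro sum.cong) auto
      then show ?thesis using that fin by simp
    qed
    then have "p (?\<Phi> f) = (\<Sum>b\<in>B. f b *\<^sub>R b)" for f
      unfolding p_def by (intro sum.cong) auto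
    then show ?thesis by (auto simp: N_def)
  qed
  finally have "emeasure (\<Pi>\<^sub>M b\<in>B. (lborel :: real measure))
      ((\<lambda>f. \<Sum>b\<in>B. f b *\<^sub>R b) -` F \<inter> space (\<Pi>\<^sub>M b\<in>B. lborel)) = 0"
    using emeasure_PiM_insert_zero[OF fin wB F(2), of "\<lambda>b. b"] by simp
  moreover have FV: "F \<in> sets (restrict_space borel V)"
    using F V(1) by (auto simp: sets_restrict_space_iff V_def closed_subspace borel_closed)
  ultimately have "F \<in> null_sets (distr (\<Pi>\<^sub>M b\<in>B. (lborel :: real measure)) (restrict_space borel V)
      (\<lambda>f. \<Sum>b\<in>B. f b *\<^sub>R b))"
    using orthonormal_basis_of_measurable[OF B] by (intro null_setsI) (simp_all add: emeasure_distr)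
  then show ?thesis
    unfolding lebesgue_subspace_def V_def[symmetric] Let_def B_def[symmetric]
    by (rule null_sets_completionI)
qed

context price
begin

lemma projection_along_u: "projection_along u 1 x = proj 0 x"
  by (simp add: projection_along_def proj_def ut_def un_0 inner_commute divide_inverse)

lemma rauzy_subtile_eq: "rauzy_subtile \<sigma> u i = closure (proj 0 ` {ab p | p. pre 0 (p @ [i])})"
proof -
  have "pre 0 (p @ [i]) \<longleftrightarrow> (\<exists>\<omega>. limit_word \<sigma> \<omega> \<and> p @ [i] = stake (length p + 1) \<omega>)" for p
    by (simp add: pre_def)
  then have "{projection_along u 1 (ab p) | p.
     \<exists>\<omega>. limit_word \<sigma> \<omega> \<and> p @ [i] = stake (length p + 1) \<omega>} = proj 0 ` {ab p | p. pre 0 (p @ [i])}"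
    by (auto simp: projection_along_u)
  then show ?thesis by (simp only: rauzy_subtile_def)
qed

lemma continuous_on_proj: "continuous_on S (proj n)"
  by (intro linear_continuous_on linear_conv_bounded_linear[THEN iffD1] linear_proj)

lemma cyl_iff_rauzy_subtile: "x \<in> cyl 0 i \<longleftrightarrow> proj 0 x \<in> rauzy_subtile \<sigma> u i"
proof
  assume x: "x \<in> cyl 0 i"
  have "closed (proj 0 -` rauzy_subtile \<sigma> u i)"
    by (intro continuous_closed_vimage) (auto simp: rauzy_subtile_eq continuous_on_proj
        intro: continuous_on_interior[of UNIV])
  moreover have "{ab p + t *\<^sub>R un 0 | p t. pre 0 (p @ [i])} \<subseteq> proj 0 -` rauzy_subtile \<sigma> u i"
    using closure_subset by (fastforce simp: rauzy_subtile_eq proj_add proj_scale)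
  ultimately show "proj 0 x \<in> rauzy_subtile \<sigma> u i"
    using x closure_minimal unfolding cyl_def by blast
next
  assume x: "proj 0 x \<in> rauzy_subtile \<sigma> u i"
  have "proj 0 (ab p) \<in> cyl 0 i" if "pre 0 (p @ [i])" for p
    using add_ut_in_cyl[OF that, of "- (1 \<bullet> ab p)"] by (simp add: proj_def)
  then have "rauzy_subtile \<sigma> u i \<subseteq> cyl 0 i"
    unfolding rauzy_subtile_eq by (intro closure_minimal closed_cyl) auto
  then have "proj 0 x + (1 \<bullet> x) *\<^sub>R ut 0 \<in> cyl 0 i" using x cyl_translate_ut by blast
  then show "x \<in> cyl 0 i" using proj_decomp[of x 0] by simp
qed

lemma frontier_rauzy_subtile_null:
  "top_of_set (orthogonal_hyperplane 1) frontier_of rauzy_subtile \<sigma> u i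
     \<in> null_sets (lebesgue_subspace (orthogonal_hyperplane (1 :: real ^ 'a)))"
proof -
  define H where "H = orthogonal_hyperplane (1 :: real ^ 'a)"
  define R where "R = rauzy_subtile \<sigma> u i"
  define F where "F = top_of_set H frontier_of R"
  have clH: "closed H"
    using closed_hyperplane[of "1 :: real ^ 'a" 0] by (simp add: H_def orthogonal_hyperplane_def)
  have projH: "proj 0 x \<in> H" for x
    by (simp add: H_def orthogonal_hyperplane_def proj_def inner_diff_right inner_one_ut)
  then have RH: "R \<subseteq> H" unfolding R_def rauzy_subtile_eq using clH by (intro closure_minimal) auto
  have "closed R" by (simp add: R_def rauzy_subtile_eq)
  then have clR: "closedin (top_of_set H) R" using RH by (simp add: closed_subset)
  have "closedin (top_of_set H) F" unfolding F_def by (rule closedin_frontier_of)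
  then have "closed F" "F \<subseteq> H" using clH by (auto simp: closedin_closed_eq closedin_imp_subset)
  have FR: "F \<subseteq> R" unfolding F_def using clR by (rule frontier_of_subset_closedin)
  have "{x + t *\<^sub>R ut 0 | x t. x \<in> F} \<subseteq> frontier (cyl 0 i)"
  proof clarify
    fix x t assume x: "x \<in> F"
    then have xH: "x \<in> H" using \<open>F \<subseteq> H\<close> by blast
    have proj_H: "proj 0 y = y" if "y \<in> H" for y
      using that by (simp add: H_def orthogonal_hyperplane_def proj_def)
    have mem: "y + t *\<^sub>R ut 0 \<in> cyl 0 i \<longleftrightarrow> y \<in> R" if "y \<in> H" for y
      by (simp add: cyl_iff_rauzy_subtile R_def proj_add proj_scale proj_H[OF that])
    have "x + t *\<^sub>R ut 0 \<notin> interior (cyl 0 i)"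
    proof
      assume int: "x + t *\<^sub>R ut 0 \<in> interior (cyl 0 i)"
      \<comment> \<open>The slice of the interior at height \<open>t\<close> is relatively open in
        \<open>H\<close> and contained in \<open>R\<close>, so \<open>x\<close> would be a relative
        interior point.\<close>
      define T where "T = H \<inter> (\<lambda>y. y + t *\<^sub>R ut 0) -` interior (cyl 0 i)"
      have "openin (top_of_set H) T"
        unfolding T_def by (intro continuous_openin_preimage_gen continuous_intros) auto
      moreover have "T \<subseteq> R" using mem interior_subset by (auto simp: T_def)
      moreover have "x \<in> T" using int xH by (simp add: T_def)
      ultimately have "x \<in> top_of_set H interior_of R" using interior_of_maximal by blast
      then show False using x by (simp add: F_def frontier_of_def)
    qed
    moreover have "x + t *\<^sub>R ut 0 \<in> cyl 0 i" using mem[OF xH] x FR by blast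
    ultimately show "x + t *\<^sub>R ut 0 \<in> frontier (cyl 0 i)"
      by (simp add: frontier_def closed_cyl)
  qed
  then have "negligible {x + t *\<^sub>R ut 0 | x t. x \<in> F}"
    using negligible_frontier_cyl negligible_subset by blast
  then have "F \<in> null_sets (lebesgue_subspace H)"
    unfolding H_def using \<open>F \<subseteq> H\<close> \<open>closed F\<close> inner_one_ut[of 0]
    by (intro null_sets_lebesgue_subspace[of 1 "ut 0"]) (auto simp: H_def borel_closed)
  then show ?thesis by (simp add: F_def H_def R_def)
qed

end

lemma property_PRICE_imp_price:
  assumes "directive \<sigma>" "property_PRICE \<sigma>" "generalized_right_eigenvector \<sigma> u"
    and "2 \<le> CARD('a::finite)" "limit_word \<sigma> \<omega>"
  shows "\<exists>v nk lk h B C. price \<sigma> (u :: real ^ 'a) v nk lk h B C"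
proof -
  interpret directive \<sigma> by (rule assms(1))
  obtain nk lk h C and v :: "real ^ 'a" and B :: "real ^ 'a ^ 'a" where price: "strict_mono nk" "strict_mono lk" "\<forall>i. 0 \<le> v $ i" "v \<noteq> 0"
    "\<forall>i j. 0 < B $ i $ j" "\<forall>k. h \<le> lk k \<and> block_matrix \<sigma> (lk k - h) (lk k) = B"
    "\<forall>k. \<forall>j<lk k. \<sigma> (nk k + j) = \<sigma> j"
    "\<forall>k. \<forall>\<^sub>F m in sequentially. irreducible (char_polynomial (block_matrix \<sigma> k m :: rat ^ 'a ^ 'a))"
    "0 < C" "\<forall>k. balanced C (language \<sigma> (nk k + lk k))"
    "(\<lambda>k. let w = transpose (block_matrix \<sigma> 0 (nk k)) *v v in w /\<^sub>R infnorm w) \<longlonglongrightarrow> v"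
    using assms(2) unfolding property_PRICE_def by blast
  have u: "\<exists>x. (\<forall>i. 0 < x $ i) \<and> u = A 0 n *v x" for n
  proof -
    have "u \<in> {c *\<^sub>R u | c. 0 < c}" by (auto intro!: exI[of _ 1])
    then have "u \<in> (\<lambda>x. A 0 n *v x) ` positive_cone"
      using assms(3) unfolding generalized_right_eigenvector_def by blast
    then show ?thesis by (auto simp: positive_cone_def)
  qed
  have "pre 0 []" using assms(5) by (auto simp: pre_def)
  then have "price \<sigma> u v nk lk h B C"
    using price u assms(4) by unfold_locales simp_all
  then show ?thesis by blast
qed

text \<open>The hyperplane is a single point, and subsets of a one-point space have no
  boundary.\<close>

lemma frontier_of_rauzy_subtile_one_letter:
  fixes u :: "real ^ 'a::finite"
  assumes "CARD('a) < 2" "1 \<bullet> u \<noteq> 0"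
  shows "top_of_set (orthogonal_hyperplane 1) frontier_of rauzy_subtile \<sigma> u i = {}"
proof -
  obtain a :: 'a where a: "UNIV = {a}"
    using assms(1) by (metis One_nat_def card_1_singletonE less_2_cases zero_less_card_finite not_less_zero)
  have H: "orthogonal_hyperplane (1 :: real ^ 'a) = {0}"
  proof -
    have "x = 0" if "1 \<bullet> x = 0" for x :: "real ^ 'a"
    proof -
      have "x $ a = 0" using that unfolding inner_one_vec a by simp
      then show ?thesis using a by (metis UNIV_I singletonD vec_eq_iff zero_index)
    qed
    then show ?thesis by (auto simp: orthogonal_hyperplane_def)
  qed
  have "projection_along u 1 x \<in> orthogonal_hyperplane 1" for x
    using assms(2) by (simp add: projection_along_def orthogonal_hyperplane_def inner_diff_right inner_commute)
  then have "rauzy_subtile \<sigma> u i \<subseteq> {0}"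
    unfolding rauzy_subtile_def H by (intro closure_minimal) auto
  then have "rauzy_subtile \<sigma> u i = {} \<or> rauzy_subtile \<sigma> u i = {0}" by blast
  then show ?thesis unfolding H by (auto simp: frontier_of_def interior_of_def closure_of_def)
qed

theorem proposition6p7:
  fixes S :: "('a::finite list \<Rightarrow> 'a list) set"
    and \<sigma> :: "nat \<Rightarrow> 'a list \<Rightarrow> 'a list"
    and u :: "real ^ 'a"
  assumes "\<And>s. s \<in> S \<Longrightarrow> substitution s \<and> unimodular s"
    and "\<And>n. \<sigma> n \<in> S"
    and "property_PRICE \<sigma>"
    and "generalized_right_eigenvector \<sigma> u"
  shows "top_of_set (orthogonal_hyperplane 1) frontier_of rauzy_subtile \<sigma> u i
           \<in> null_sets (lebesgue_subspace (orthogonal_hyperplane (1 :: real ^ 'a)))"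
proof -
  have "directive \<sigma>" using assms(1,2) by unfold_locales blast+
  have u: "1 \<bullet> u \<noteq> 0"
  proof -
    have "0 < u $ j" for j
      using assms(4) by (simp add: generalized_right_eigenvector_def positive_cone_def)
    then have "0 < (\<Sum>j\<in>UNIV. u $ j)" by (intro sum_pos) auto
    then show ?thesis by (simp add: inner_one_vec)
  qed
  \<comment> \<open>Without limit words every subtile is empty; the last case is that of the locale
    \<open>price\<close>.\<close>
  consider "CARD('a) < 2" | "\<nexists>\<omega>. limit_word \<sigma> \<omega>" | \<omega> where "2 \<le> CARD('a)" "limit_word \<sigma> \<omega>"
    by fastforce
  then show ?thesis
  proof cases
    case 1
    then show ?thesis using frontier_of_rauzy_subtile_one_letter[OF _ u] by simp
  next
    case 2
    then show ?thesis by (simp add: rauzy_subtile_def)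
  next
    case 3
    then obtain v nk lk h B C where "price \<sigma> u v nk lk h B C"
      using property_PRICE_imp_price[OF \<open>directive \<sigma>\<close> assms(3,4)] by blast
    then show ?thesis by (rule price.frontier_rauzy_subtile_null)
  qed
qed

end
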